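(* Let $R$ be a ring with unity and let $\mathcal{X}$ be a semibrick of left $R$-modules such that every $X\in\mathcal{X}$ has projective dimension at most one and $\mathcal{X}$ contains no $\mathcal{X}$-divisible objects. Let $Y\in\mathcal{X}$ and let $\bar{Y}=Y_{\mathcal{X}}(\infty)$ be its Prüfer module. Then the endomorphism ring $E=\mathrm{End}(\bar{Y})$ is local, and its Jacobson radical is $J=\{f\in E\mid f(Y)=0\}$. Moreover, every nonzero endomorphism of $\bar{Y}$ is surjective.
   Context: A brick is a finitely presented left $R$-module whose endomorphism ring is a division ring. A semibrick is a class $\mathcal{X}$ of pairwise non-isomorphic bricks with $\mathrm{Hom}(X,X')=0$ for distinct $X,X'\in\mathcal{X}$. A module $M$ is $\mathcal{X}$-divisible if $\mathrm{Ext}^1(X,M)=0$ for all $X\in\mathcal{X}$. $\mathcal{X}$-universal sequences: let $Y$ be a module. For each $X\in\mathcal{X}$, $\mathrm{Ext}^1(X,Y)$ is a left $\mathrm{End}(X)$-module (acting by pull-back; compositions written from left to right). Choose a basis $(0\to Y\to M_{X,i}\to X\to 0)_{i\in I_X}$ over the division ring $\mathrm{End}(X)$. The $\mathcal{X}$-universal short exact sequence $0\to Y\to M\to\bigoplus_{X\in\mathcal{X}}X^{(I_X)}\to 0$ starting from $Y$ is the push-out of $0\to\bigoplus_{X}Y^{(I_X)}\to\bigoplus_{X,i}M_{X,i}\to\bigoplus_{X}X^{(I_X)}\to 0$ along the summation map $\bigoplus_X Y^{(I_X)}\to Y$. Define $Y_{\mathcal{X}}(1)=Y$ and let $Y_{\mathcal{X}}(i)\to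 Y_{\mathcal{X}}(i+1)$ be the monomorphism of an $\mathcal{X}$-universal sequence starting from $Y_{\mathcal{X}}(i)$; $Y_{\mathcal{X}}(\infty)$ is the direct limit, and $Y$ is viewed as a submodule of it. For $Y\in\mathcal{X}$, $\bar{Y}=Y_{\mathcal{X}}(\infty)$ is called a Prüfer module. *)

theory Defs
  imports "HOL-Algebra.Module" "HOL-Algebra.AbelCoset"
begin

section \<open>Left modules over a ring with unity\<close>

text \<open>The library locale \<^locale>\<open>module\<close> requires a commutative base ring; its record type is reused
  (the multiplicative fields of a module record are irrelevant).\<close>

locale left_module = R?: ring R + M?: abelian_group M
    for R :: "('r, 'a) ring_scheme" (structure) and M :: "('r, 'm, 'b) module_scheme" (structure) +
  assumes smult_closed [simp, intro]:
      "\<lbrakk>a \<in> carrier R; x \<in> carrier M\<rbrakk> \<Longrightarrow> a \<odot>\<^bsub>M\<^esub> x \<in> carrier M"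
    and smult_l_distr:
      "\<lbrakk>a \<in> carrier R; b \<in> carrier R; x \<in> carrier M\<rbrakk> \<Longrightarrow>
        (a \<oplus> b) \<odot>\<^bsub>M\<^esub> x = a \<odot>\<^bsub>M\<^esub> x \<oplus>\<^bsub>M\<^esub> b \<odot>\<^bsub>M\<^esub> x"
    and smult_r_distr:
      "\<lbrakk>a \<in> carrier R; x \<in> carrier M; y \<in> carrier M\<rbrakk> \<Longrightarrow>
        a \<odot>\<^bsub>M\<^esub> (x \<oplus>\<^bsub>M\<^esub> y) = a \<odot>\<^bsub>M\<^esub> x \<oplus>\<^bsub>M\<^esub> a \<odot>\<^bsub>M\<^esub> y"
    and smult_assoc:
      "\<lbrakk>a \<in> carrier R; b \<in> carrier R; x \<in> carrier M\<rbrakk> \<Longrightarrow>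
        (a \<otimes> b) \<odot>\<^bsub>M\<^esub> x = a \<odot>\<^bsub>M\<^esub> (b \<odot>\<^bsub>M\<^esub> x)"
    and smult_one [simp]: "x \<in> carrier M \<Longrightarrow> \<one> \<odot>\<^bsub>M\<^esub> x = x"

text \<open>Homomorphisms are extensional functions, so that equality of homomorphisms is equality in HOL.\<close>

definition lhom :: "('r, 'a) ring_scheme \<Rightarrow> ('r, 'm) module \<Rightarrow> ('r, 'n) module \<Rightarrow> ('m \<Rightarrow> 'n) set" where
  "lhom R M N = {f \<in> carrier M \<rightarrow>\<^sub>E carrier N.
     (\<forall>x\<in>carrier M. \<forall>y\<in>carrier M. f (x \<oplus>\<^bsub>M\<^esub> y) = f x \<oplus>\<^bsub>N\<^esub> f y) \<and>
     (\<forall>r\<in>carrier R. \<forall>x\<in>carrier M. f (r \<odot>\<^bsub>M\<^esub> x) = r \<odot>\<^bsub>N\<^esub> f x)}"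

definition zero_hom :: "('r, 'm) module \<Rightarrow> ('r, 'n) module \<Rightarrow> 'm \<Rightarrow> 'n" where
  "zero_hom M N = (\<lambda>x\<in>carrier M. \<zero>\<^bsub>N\<^esub>)"

definition liso :: "('r, 'a) ring_scheme \<Rightarrow> ('r, 'm) module \<Rightarrow> ('r, 'n) module \<Rightarrow> ('m \<Rightarrow> 'n) set" where
  "liso R M N = {f \<in> lhom R M N. bij_betw f (carrier M) (carrier N)}"

text \<open>Compositions are written from left to right: \<open>f \<otimes> g\<close> is first \<open>f\<close>, then \<open>g\<close>.\<close>

definition End_ring :: "('r, 'a) ring_scheme \<Rightarrow> ('r, 'm) module \<Rightarrow> ('m \<Rightarrow> 'm) ring" where
  "End_ring R M =
     \<lparr>carrier = lhom R M M,
      mult = (\<lambda>f g. compose (carrier M) g f),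
      one = (\<lambda>x\<in>carrier M. x),
      zero = zero_hom M M,
      add = (\<lambda>f g. \<lambda>x\<in>carrier M. f x \<oplus>\<^bsub>M\<^esub> g x)\<rparr>"

definition prod_module :: "('r, 'm) module \<Rightarrow> ('r, 'n) module \<Rightarrow> ('r, 'm \<times> 'n) module" where
  "prod_module M N =
     \<lparr>carrier = carrier M \<times> carrier N,
      mult = undefined, one = undefined,
      zero = (\<zero>\<^bsub>M\<^esub>, \<zero>\<^bsub>N\<^esub>),
      add = (\<lambda>(x, y) (x', y'). (x \<oplus>\<^bsub>M\<^esub> x', y \<oplus>\<^bsub>N\<^esub> y')),
      smult = (\<lambda>r (x, y). (r \<odot>\<^bsub>M\<^esub> x, r \<odot>\<^bsub>N\<^esub> y))\<rparr>"

definition direct_sum :: "'k set \<Rightarrow> ('k \<Rightarrow> ('r, 'm) module) \<Rightarrow> ('r, 'k \<Rightarrow> 'm) module" where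
  "direct_sum K M =
     \<lparr>carrier = {f \<in> \<Pi>\<^sub>E k\<in>K. carrier (M k). finite {k\<in>K. f k \<noteq> \<zero>\<^bsub>M k\<^esub>}},
      mult = undefined, one = undefined,
      zero = (\<lambda>k\<in>K. \<zero>\<^bsub>M k\<^esub>),
      add = (\<lambda>f g. \<lambda>k\<in>K. f k \<oplus>\<^bsub>M k\<^esub> g k),
      smult = (\<lambda>r f. \<lambda>k\<in>K. r \<odot>\<^bsub>M k\<^esub> f k)\<rparr>"

definition quotient_module :: "('r, 'm) module \<Rightarrow> 'm set \<Rightarrow> ('r, 'm set) module" where
  "quotient_module M N =
     \<lparr>carrier = a_rcosets\<^bsub>M\<^esub> N,
      mult = undefined, one = undefined,
      zero = N,
      add = (\<lambda>A B. A <+>\<^bsub>M\<^esub> B),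
      smult = (\<lambda>r A. \<Union>a\<in>A. N +>\<^bsub>M\<^esub> (r \<odot>\<^bsub>M\<^esub> a))\<rparr>"

definition regular_module :: "('r, 'a) ring_scheme \<Rightarrow> ('r, 'r) module" where
  "regular_module R =
     \<lparr>carrier = carrier R, mult = mult R, one = one R, zero = zero R, add = add R, smult = mult R\<rparr>"

definition free_module :: "('r, 'a) ring_scheme \<Rightarrow> 'k set \<Rightarrow> ('r, 'k \<Rightarrow> 'r) module" where
  "free_module R K = direct_sum K (\<lambda>_. regular_module R)"

text \<open>\<open>S\<close> is a basis of \<open>V\<close> if every element of \<open>V\<close> is a unique finite linear combination of
  elements of \<open>S\<close>.\<close>

definition is_basis :: "('r, 'a) ring_scheme \<Rightarrow> ('r, 'm) module \<Rightarrow> 'm set \<Rightarrow> bool" where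
  "is_basis R V S \<longleftrightarrow> S \<subseteq> carrier V \<and>
     (\<forall>v\<in>carrier V. \<exists>!c. c \<in> carrier (free_module R S) \<and>
        v = (\<Oplus>\<^bsub>V\<^esub> s \<in> {s\<in>S. c s \<noteq> \<zero>\<^bsub>R\<^esub>}. c s \<odot>\<^bsub>V\<^esub> s))"

section \<open>Finiteness and homological conditions\<close>

definition short_exact ::
  "('r, 'a) ring_scheme \<Rightarrow> ('r, 'l) module \<Rightarrow> ('l \<Rightarrow> 'm) \<Rightarrow> ('r, 'm) module \<Rightarrow> ('m \<Rightarrow> 'n)
     \<Rightarrow> ('r, 'n) module \<Rightarrow> bool" where
  "short_exact R A f B g C \<longleftrightarrow>
     left_module R A \<and> left_module R B \<and> left_module R C \<and>
     f \<in> lhom R A B \<and> g \<in> lhom R B C \<and>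
     inj_on f (carrier A) \<and>
     f ` carrier A = {b \<in> carrier B. g b = \<zero>\<^bsub>C\<^esub>} \<and>
     g ` carrier B = carrier C"

definition finitely_presented :: "('r, 'a) ring_scheme \<Rightarrow> ('r, 'm) module \<Rightarrow> bool" where
  "finitely_presented R M \<longleftrightarrow> left_module R M \<and>
     (\<exists>(m::nat) (n::nat) f g.
        f \<in> lhom R (free_module R {..<m}) (free_module R {..<n}) \<and>
        g \<in> lhom R (free_module R {..<n}) M \<and>
        f ` carrier (free_module R {..<m}) =
          {x \<in> carrier (free_module R {..<n}). g x = \<zero>\<^bsub>M\<^esub>} \<and>
        g ` carrier (free_module R {..<n}) = carrier M)"

text \<open>Projective modules are the direct summands of free modules. It is no restriction to index the
  free module by a set of elements of the type of \<open>P\<close>, since \<open>P\<close> is a quotient of \<open>R\<^sup>(\<^sup>P\<^sup>)\<close>.\<close>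

definition projective_module :: "('r, 'a) ring_scheme \<Rightarrow> ('r, 'm) module \<Rightarrow> bool" where
  "projective_module R P \<longleftrightarrow> left_module R P \<and>
     (\<exists>(I :: 'm set) s p. s \<in> lhom R P (free_module R I) \<and> p \<in> lhom R (free_module R I) P \<and>
        (\<forall>x\<in>carrier P. p (s x) = x))"

text \<open>The type of the resolving modules is no restriction: if \<open>M\<close> has projective dimension at most one
  then, by Schanuel's lemma, the kernel of the canonical map from the free module on the
  carrier of \<open>M\<close> onto \<open>M\<close> is projective.\<close>

definition proj_dim_le_one :: "('r, 'a) ring_scheme \<Rightarrow> ('r, 'm) module \<Rightarrow> bool" where
  "proj_dim_le_one R M \<longleftrightarrow>
     (\<exists>(P1 :: ('r, 'm \<Rightarrow> 'r) module) (P0 :: ('r, 'm \<Rightarrow> 'r) module) f g.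
        projective_module R P1 \<and> projective_module R P0 \<and> short_exact R P1 f P0 g M)"

section \<open>Extensions and \<open>Ext\<^sup>1\<close>\<close>

record ('r, 'e, 'y, 'x) extn =
  mid :: "('r, 'e) module"
  incl :: "'y \<Rightarrow> 'e"
  proj :: "'e \<Rightarrow> 'x"

definition is_extn ::
  "('r, 'a) ring_scheme \<Rightarrow> ('r, 'x) module \<Rightarrow> ('r, 'y) module \<Rightarrow> ('r, 'e, 'y, 'x) extn \<Rightarrow> bool" where
  "is_extn R X Y E \<longleftrightarrow> short_exact R Y (incl E) (mid E) (proj E) X"

definition equiv_extn ::
  "('r, 'a) ring_scheme \<Rightarrow> ('r, 'y) module \<Rightarrow> ('r, 'e, 'y, 'x) extn \<Rightarrow> ('r, 'd, 'y, 'x) extn \<Rightarrow> bool" where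
  "equiv_extn R Y E E' \<longleftrightarrow> (\<exists>\<phi>\<in>liso R (mid E) (mid E').
     (\<forall>y\<in>carrier Y. \<phi> (incl E y) = incl E' y) \<and>
     (\<forall>e\<in>carrier (mid E). proj E' (\<phi> e) = proj E e))"

definition pullback_extn ::
  "('r, 'y) module \<Rightarrow> ('r, 'z) module \<Rightarrow> ('z \<Rightarrow> 'x) \<Rightarrow> ('r, 'e, 'y, 'x) extn
     \<Rightarrow> ('r, 'e \<times> 'z, 'y, 'z) extn" where
  "pullback_extn Y Z f E = (let
       C = {(e, z). e \<in> carrier (mid E) \<and> z \<in> carrier Z \<and> proj E e = f z}
     in \<lparr>mid = (prod_module (mid E) Z)\<lparr>carrier := C\<rparr>,
         incl = (\<lambda>y\<in>carrier Y. (incl E y, \<zero>\<^bsub>Z\<^esub>)),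
         proj = (\<lambda>p\<in>C. snd p)\<rparr>)"

definition pushout_extn ::
  "('r, 'y) module \<Rightarrow> ('r, 'z) module \<Rightarrow> ('y \<Rightarrow> 'z) \<Rightarrow> ('r, 'e, 'y, 'x) extn
     \<Rightarrow> ('r, ('e \<times> 'z) set, 'z, 'x) extn" where
  "pushout_extn Y Z g E = (let
       P = prod_module (mid E) Z;
       N = {(incl E y, \<ominus>\<^bsub>Z\<^esub> g y) | y. y \<in> carrier Y}
     in \<lparr>mid = quotient_module P N,
         incl = (\<lambda>z\<in>carrier Z. N +>\<^bsub>P\<^esub> (\<zero>\<^bsub>mid E\<^esub>, z)),
         proj = (\<lambda>A\<in>a_rcosets\<^bsub>P\<^esub> N. the_elem ((\<lambda>p. proj E (fst p)) ` A))\<rparr>)"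

definition sum_extn ::
  "'k set \<Rightarrow> ('k \<Rightarrow> ('r, 'y) module) \<Rightarrow> ('k \<Rightarrow> ('r, 'e, 'y, 'x) extn)
     \<Rightarrow> ('r, 'k \<Rightarrow> 'e, 'k \<Rightarrow> 'y, 'k \<Rightarrow> 'x) extn" where
  "sum_extn K Y E =
     \<lparr>mid = direct_sum K (\<lambda>k. mid (E k)),
      incl = (\<lambda>f\<in>carrier (direct_sum K Y). \<lambda>k\<in>K. incl (E k) (f k)),
      proj = (\<lambda>f\<in>carrier (direct_sum K (\<lambda>k. mid (E k))). \<lambda>k\<in>K. proj (E k) (f k))\<rparr>"

definition summation_map :: "'k set \<Rightarrow> ('r, 'y) module \<Rightarrow> ('k \<Rightarrow> 'y) \<Rightarrow> 'y" where
  "summation_map K Y =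
     (\<lambda>f\<in>carrier (direct_sum K (\<lambda>_. Y)). \<Oplus>\<^bsub>Y\<^esub> k \<in> {k\<in>K. f k \<noteq> \<zero>\<^bsub>Y\<^esub>}. f k)"

definition diagonal_map :: "'k set \<Rightarrow> ('r, 'x) module \<Rightarrow> 'x \<Rightarrow> 'k \<Rightarrow> 'x" where
  "diagonal_map K X = (\<lambda>x\<in>carrier X. \<lambda>k\<in>K. x)"

text \<open>The Baer sum: pull back the direct sum of the two extensions along the diagonal \<open>X \<rightarrow> X \<oplus> X\<close> and
  push out along the summation map \<open>Y \<oplus> Y \<rightarrow> Y\<close>.\<close>

definition baer_sum ::
  "('r, 'x) module \<Rightarrow> ('r, 'y) module \<Rightarrow> ('r, 'e, 'y, 'x) extn \<Rightarrow> ('r, 'e, 'y, 'x) extn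
     \<Rightarrow> ('r, (((bool \<Rightarrow> 'e) \<times> 'x) \<times> 'y) set, 'y, 'x) extn" where
  "baer_sum X Y E E' =
     pushout_extn (direct_sum UNIV (\<lambda>_::bool. Y)) Y (summation_map UNIV Y)
       (pullback_extn (direct_sum UNIV (\<lambda>_::bool. Y)) X (diagonal_map UNIV X)
         (sum_extn UNIV (\<lambda>_. Y) (\<lambda>b. if b then E else E')))"

definition split_extn :: "('r, 'x) module \<Rightarrow> ('r, 'y) module \<Rightarrow> ('r, 'y \<times> 'x, 'y, 'x) extn" where
  "split_extn X Y =
     \<lparr>mid = prod_module Y X,
      incl = (\<lambda>y\<in>carrier Y. (y, \<zero>\<^bsub>X\<^esub>)),
      proj = (\<lambda>p\<in>carrier (prod_module Y X). snd p)\<rparr>"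

text \<open>Elements of \<open>Ext\<^sup>1(X, Y)\<close> are equivalence classes of extensions with middle term on the type
  \<open>'y \<times> 'x\<close>. Every extension of \<open>X\<close> by \<open>Y\<close>, on whatever type, is equivalent to such an extension,
  because its middle term is in bijection with \<open>Y \<times> X\<close>.\<close>

definition extn_class ::
  "('r, 'a) ring_scheme \<Rightarrow> ('r, 'x) module \<Rightarrow> ('r, 'y) module \<Rightarrow> ('r, 'e, 'y, 'x) extn
     \<Rightarrow> ('r, 'y \<times> 'x, 'y, 'x) extn set" where
  "extn_class R X Y E = {E'. is_extn R X Y E' \<and> equiv_extn R Y E E'}"

text \<open>\<open>Ext\<^sup>1(X, Y)\<close> as a left module over \<^term>\<open>End_ring R X\<close>, which acts by pull-back.\<close>

definition Ext1 ::
  "('r, 'a) ring_scheme \<Rightarrow> ('r, 'x) module \<Rightarrow> ('r, 'y) module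
     \<Rightarrow> ('x \<Rightarrow> 'x, ('r, 'y \<times> 'x, 'y, 'x) extn set) module" where
  "Ext1 R X Y =
     \<lparr>carrier = {extn_class R X Y E | E :: ('r, 'y \<times> 'x, 'y, 'x) extn. is_extn R X Y E},
      mult = undefined, one = undefined,
      zero = extn_class R X Y (split_extn X Y),
      add = (\<lambda>A B. \<Union>E\<in>A. \<Union>E'\<in>B. extn_class R X Y (baer_sum X Y E E')),
      smult = (\<lambda>f A. \<Union>E\<in>A. extn_class R X Y (pullback_extn Y X f E))\<rparr>"

section \<open>Semibricks and divisible modules\<close>

definition division_ring :: "('r, 'a) ring_scheme \<Rightarrow> bool" where
  "division_ring D \<longleftrightarrow> ring D \<and> \<one>\<^bsub>D\<^esub> \<noteq> \<zero>\<^bsub>D\<^esub> \<and> Units D = carrier D - {\<zero>\<^bsub>D\<^esub>}"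

definition brick :: "('r, 'a) ring_scheme \<Rightarrow> ('r, 'm) module \<Rightarrow> bool" where
  "brick R X \<longleftrightarrow> finitely_presented R X \<and> division_ring (End_ring R X)"

definition semibrick :: "('r, 'a) ring_scheme \<Rightarrow> ('r, 'm) module set \<Rightarrow> bool" where
  "semibrick R \<X> \<longleftrightarrow> (\<forall>X\<in>\<X>. brick R X) \<and>
     (\<forall>X\<in>\<X>. \<forall>X'\<in>\<X>. X \<noteq> X' \<longrightarrow> liso R X X' = {} \<and> lhom R X X' = {zero_hom X X'})"

definition divisible :: "('r, 'a) ring_scheme \<Rightarrow> ('r, 'm) module set \<Rightarrow> ('r, 'n) module \<Rightarrow> bool" where
  "divisible R \<X> M \<longleftrightarrow> left_module R M \<and> (\<forall>X\<in>\<X>. carrier (Ext1 R X M) = {\<zero>\<^bsub>Ext1 R X M\<^esub>})"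

section \<open>Universal sequences and Pruefer modules\<close>

text \<open>A choice of bases assigns to each \<open>X \<in> \<X>\<close> a set \<open>B X\<close> of extensions of \<open>X\<close> by \<open>Y\<close>, pairwise
  inequivalent, whose classes form a basis of \<open>Ext\<^sup>1(X, Y)\<close>. Thus \<open>B X\<close> plays the role of the index
  set \<open>I\<^sub>X\<close>, and the direct sums below are indexed by the pairs \<open>(X, E)\<close> with \<open>E \<in> B X\<close>.\<close>

definition ext_bases ::
  "('r, 'a) ring_scheme \<Rightarrow> ('r, 'x) module set \<Rightarrow> ('r, 'y) module
     \<Rightarrow> (('r, 'x) module \<Rightarrow> ('r, 'y \<times> 'x, 'y, 'x) extn set) \<Rightarrow> bool" where
  "ext_bases R \<X> Y B \<longleftrightarrow> (\<forall>X\<in>\<X>.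
     (\<forall>E\<in>B X. is_extn R X Y E) \<and>
     inj_on (extn_class R X Y) (B X) \<and>
     is_basis (End_ring R X) (Ext1 R X Y) (extn_class R X Y ` B X))"

definition universal_extn ::
  "('r, 'x) module set \<Rightarrow> ('r, 'y) module
     \<Rightarrow> (('r, 'x) module \<Rightarrow> ('r, 'y \<times> 'x, 'y, 'x) extn set)
     \<Rightarrow> ('r, ((('r, 'x) module \<times> ('r, 'y \<times> 'x, 'y, 'x) extn \<Rightarrow> 'y \<times> 'x) \<times> 'y) set, 'y,
         ('r, 'x) module \<times> ('r, 'y \<times> 'x, 'y, 'x) extn \<Rightarrow> 'x) extn" where
  "universal_extn \<X> Y B =
     pushout_extn (direct_sum (Sigma \<X> B) (\<lambda>_. Y)) Y (summation_map (Sigma \<X> B) Y)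
       (sum_extn (Sigma \<X> B) (\<lambda>_. Y) snd)"

text \<open>\<open>0 \<rightarrow> Y \<rightarrow> M \<rightarrow> \<Oplus> X \<rightarrow> 0\<close>, given as the extension \<open>S\<close> with \<open>M = mid S\<close>, is an \<open>\<X>\<close>-universal sequence
  if it is (up to equivalence) the push-out constructed from some choice of bases.\<close>

definition universal_seq ::
  "('r, 'a) ring_scheme \<Rightarrow> ('r, 'x) module set \<Rightarrow> ('r, 'y) module
     \<Rightarrow> ('r, 'e, 'y, ('r, 'x) module \<times> ('r, 'y \<times> 'x, 'y, 'x) extn \<Rightarrow> 'x) extn \<Rightarrow> bool" where
  "universal_seq R \<X> Y S \<longleftrightarrow> (\<exists>B. ext_bases R \<X> Y B \<and>
     is_extn R (direct_sum (Sigma \<X> B) fst) Y S \<and>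
     equiv_extn R Y S (universal_extn \<X> Y B))"

text \<open>A tower \<open>T 0 \<rightarrow> T 1 \<rightarrow> T 2 \<rightarrow> \<dots>\<close> is a choice of \<open>Y\<^sub>\<X>(1) \<rightarrow> Y\<^sub>\<X>(2) \<rightarrow> Y\<^sub>\<X>(3) \<rightarrow> \<dots>\<close> (indices are shifted
  by one). All \<open>T n\<close> live on one type, which may have to be larger than that of \<open>Y\<close>; hence the
  initial identification \<open>j\<close> of \<open>Y\<close> with \<open>T 0\<close>.\<close>

definition universal_tower ::
  "('r, 'a) ring_scheme \<Rightarrow> ('r, 'x) module set \<Rightarrow> ('r, 'y) module \<Rightarrow> ('y \<Rightarrow> 'e)
     \<Rightarrow> (nat \<Rightarrow> ('r, 'e) module) \<Rightarrow> (nat \<Rightarrow> 'e \<Rightarrow> 'e) \<Rightarrow> bool" where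
  "universal_tower R \<X> Y j T u \<longleftrightarrow> j \<in> liso R Y (T 0) \<and>
     (\<forall>n. \<exists>S. universal_seq R \<X> (T n) S \<and> mid S = T (Suc n) \<and> incl S = u n)"

primrec transition :: "(nat \<Rightarrow> 'e \<Rightarrow> 'e) \<Rightarrow> nat \<Rightarrow> nat \<Rightarrow> 'e \<Rightarrow> 'e" where
  "transition u m 0 x = x"
| "transition u m (Suc d) x = u (m + d) (transition u m d x)"

text \<open>The direct limit of a sequence of modules: the disjoint union of the modules modulo eventual
  equality; \<open>transition u m (k - m)\<close> is the map from stage \<open>m\<close> to stage \<open>k\<close>.\<close>

definition limit_rel ::
  "(nat \<Rightarrow> ('r, 'e) module) \<Rightarrow> (nat \<Rightarrow> 'e \<Rightarrow> 'e) \<Rightarrow> ((nat \<times> 'e) \<times> (nat \<times> 'e)) set" where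
  "limit_rel T u = {((m, x), (n, y)). x \<in> carrier (T m) \<and> y \<in> carrier (T n) \<and>
     (\<exists>k\<ge>max m n. transition u m (k - m) x = transition u n (k - n) y)}"

definition direct_limit ::
  "(nat \<Rightarrow> ('r, 'e) module) \<Rightarrow> (nat \<Rightarrow> 'e \<Rightarrow> 'e) \<Rightarrow> ('r, (nat \<times> 'e) set) module" where
  "direct_limit T u =
     \<lparr>carrier = (SIGMA n:UNIV. carrier (T n)) // limit_rel T u,
      mult = undefined, one = undefined,
      zero = limit_rel T u `` {(0, \<zero>\<^bsub>T 0\<^esub>)},
      add = (\<lambda>A B. \<Union>(m, x)\<in>A. \<Union>(n, y)\<in>B. let k = max m n in
        limit_rel T u `` {(k, transition u m (k - m) x \<oplus>\<^bsub>T k\<^esub> transition u n (k - n) y)}),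
      smult = (\<lambda>r A. \<Union>(n, x)\<in>A. limit_rel T u `` {(n, r \<odot>\<^bsub>T n\<^esub> x)})\<rparr>"

definition limit_map ::
  "(nat \<Rightarrow> ('r, 'e) module) \<Rightarrow> (nat \<Rightarrow> 'e \<Rightarrow> 'e) \<Rightarrow> nat \<Rightarrow> 'e \<Rightarrow> (nat \<times> 'e) set" where
  "limit_map T u n = (\<lambda>x\<in>carrier (T n). limit_rel T u `` {(n, x)})"

section \<open>Local rings and the Jacobson radical\<close>

definition left_ideal :: "'r set \<Rightarrow> ('r, 'a) ring_scheme \<Rightarrow> bool" where
  "left_ideal I E \<longleftrightarrow> additive_subgroup I E \<and> (\<forall>r\<in>carrier E. \<forall>x\<in>I. r \<otimes>\<^bsub>E\<^esub> x \<in> I)"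

definition maximal_left_ideal :: "'r set \<Rightarrow> ('r, 'a) ring_scheme \<Rightarrow> bool" where
  "maximal_left_ideal I E \<longleftrightarrow> left_ideal I E \<and> I \<noteq> carrier E \<and>
     (\<forall>L. left_ideal L E \<longrightarrow> I \<subseteq> L \<longrightarrow> L = I \<or> L = carrier E)"

definition local_ring :: "('r, 'a) ring_scheme \<Rightarrow> bool" where
  "local_ring E \<longleftrightarrow> ring E \<and> (\<exists>!I. maximal_left_ideal I E)"

definition jacobson_radical :: "('r, 'a) ring_scheme \<Rightarrow> 'r set" where
  "jacobson_radical E = {x \<in> carrier E. \<forall>I. maximal_left_ideal I E \<longrightarrow> x \<in> I}"

end

theory Submission
  imports Defs
begin

text \<open>
  Let \<open>0 \<rightarrow> Ker \<rightarrow> F \<rightarrow> X \<rightarrow> 0\<close> be a finite free presentation of \<open>X \<in> \<X>\<close>. Extensions of \<open>X\<close> by a module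
  \<open>N\<close> are classified by the maps \<open>Ker \<rightarrow> N\<close> modulo those that extend to \<open>F\<close>, compatibly with Baer
  sums and pull-backs. That the classes of the extensions used in a universal sequence starting
  from \<open>Y\<^sub>i\<close> generate \<open>Ext\<^sup>1(X, Y\<^sub>i)\<close> means that every map \<open>Ker \<rightarrow> Y\<^sub>i\<close> extends to \<open>F \<rightarrow> Y\<^sub>i\<^sub>+\<^sub>1\<close>; that
  they are linearly independent means that every map \<open>X \<rightarrow> Y\<^sub>i\<^sub>+\<^sub>1\<close> has image in \<open>Y\<^sub>i\<close>. In the limit
  \<open>Y\<^sub>\<infinity>\<close>, every nonzero map from some \<open>X \<in> \<X>\<close> is therefore an isomorphism of \<open>X = Y\<close> onto the submodule
  \<open>Y\<close>, and \<open>Y\<^sub>\<infinity>\<close> is \<open>\<X>\<close>-divisible.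

  Let \<open>f\<close> be a nonzero endomorphism of \<open>Y\<^sub>\<infinity>\<close> with image \<open>I\<close>. On the first layer \<open>Y\<^sub>i\<^sub>+\<^sub>1 / Y\<^sub>i\<close> where it does
  not vanish, \<open>f\<close> restricts to a nonzero map from some \<open>X \<in> \<X>\<close>, so \<open>Y \<subseteq> I\<close>. Since \<open>X\<close> has projective
  dimension at most one, the quotient \<open>I\<close> of \<open>Y\<^sub>\<infinity>\<close> is again divisible, so every map \<open>X \<rightarrow> Y\<^sub>\<infinity> / I\<close> lifts to
  \<open>Y\<^sub>\<infinity>\<close>, where it has image in \<open>Y \<subseteq> I\<close>; thus \<open>Y\<^sub>\<infinity> / I\<close> receives no nonzero map from \<open>\<X>\<close> and vanishes.
  If \<open>f(Y) \<noteq> 0\<close>, then \<open>f\<close> is bijective on \<open>Y\<close>, and inductively on every \<open>Y\<^sub>i\<close>. Hence the nonunits of the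
  endomorphism ring form the left ideal of all \<open>f\<close> with \<open>f(Y) = 0\<close>.
\<close>

section \<open>Linear maps and submodules\<close>

lemma (in abelian_group) diff_add_cancel [simp]:
  "\<lbrakk>x \<in> carrier G; y \<in> carrier G\<rbrakk> \<Longrightarrow> (x \<ominus> y) \<oplus> y = x"
  by (simp add: a_minus_def a_assoc l_neg)

lemma (in abelian_group) add_diff_cancel [simp]:
  "\<lbrakk>x \<in> carrier G; y \<in> carrier G\<rbrakk> \<Longrightarrow> (x \<oplus> y) \<ominus> y = x"
  by (simp add: a_minus_def a_assoc r_neg)

lemma (in abelian_group) diff_zero [simp]: "x \<in> carrier G \<Longrightarrow> x \<ominus> \<zero> = x"
  using add_diff_cancel [of x \<zero>] by simp

lemma (in abelian_group) diff_eq_zero_iff [simp]: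
  assumes "x \<in> carrier G" "y \<in> carrier G"
  shows "x \<ominus> y = \<zero> \<longleftrightarrow> x = y"
  using diff_add_cancel [OF assms] assms by (auto simp: a_minus_def r_neg)

lemma (in abelian_group) add_diff_add:
  "\<lbrakk>a \<in> carrier G; b \<in> carrier G; c \<in> carrier G; d \<in> carrier G\<rbrakk> \<Longrightarrow>
    (a \<oplus> b) \<ominus> (c \<oplus> d) = (a \<ominus> c) \<oplus> (b \<ominus> d)"
  by (simp add: a_minus_def minus_add a_ac)

lemma (in abelian_group) add_add_swap:
  "\<lbrakk>a \<in> carrier G; b \<in> carrier G; c \<in> carrier G; d \<in> carrier G\<rbrakk> \<Longrightarrow>
    (a \<oplus> b) \<oplus> (c \<oplus> d) = (a \<oplus> c) \<oplus> (b \<oplus> d)"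
  by (simp add: a_ac)

lemma left_moduleI:
  assumes "ring R"
    and "\<And>x y. \<lbrakk>x \<in> carrier M; y \<in> carrier M\<rbrakk> \<Longrightarrow> x \<oplus>\<^bsub>M\<^esub> y \<in> carrier M"
    and "\<zero>\<^bsub>M\<^esub> \<in> carrier M"
    and "\<And>x y z. \<lbrakk>x \<in> carrier M; y \<in> carrier M; z \<in> carrier M\<rbrakk> \<Longrightarrow>
      (x \<oplus>\<^bsub>M\<^esub> y) \<oplus>\<^bsub>M\<^esub> z = x \<oplus>\<^bsub>M\<^esub> (y \<oplus>\<^bsub>M\<^esub> z)"
    and "\<And>x y. \<lbrakk>x \<in> carrier M; y \<in> carrier M\<rbrakk> \<Longrightarrow> x \<oplus>\<^bsub>M\<^esub> y = y \<oplus>\<^bsub>M\<^esub> x"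
    and "\<And>x. x \<in> carrier M \<Longrightarrow> \<zero>\<^bsub>M\<^esub> \<oplus>\<^bsub>M\<^esub> x = x"
    and "\<And>x. x \<in> carrier M \<Longrightarrow> \<exists>y\<in>carrier M. y \<oplus>\<^bsub>M\<^esub> x = \<zero>\<^bsub>M\<^esub>"
    and "\<And>a x. \<lbrakk>a \<in> carrier R; x \<in> carrier M\<rbrakk> \<Longrightarrow> a \<odot>\<^bsub>M\<^esub> x \<in> carrier M"
    and "\<And>a b x. \<lbrakk>a \<in> carrier R; b \<in> carrier R; x \<in> carrier M\<rbrakk> \<Longrightarrow>
      (a \<oplus>\<^bsub>R\<^esub> b) \<odot>\<^bsub>M\<^esub> x = a \<odot>\<^bsub>M\<^esub> x \<oplus>\<^bsub>M\<^esub> b \<odot>\<^bsub>M\<^esub> x"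
    and "\<And>a x y. \<lbrakk>a \<in> carrier R; x \<in> carrier M; y \<in> carrier M\<rbrakk> \<Longrightarrow>
      a \<odot>\<^bsub>M\<^esub> (x \<oplus>\<^bsub>M\<^esub> y) = a \<odot>\<^bsub>M\<^esub> x \<oplus>\<^bsub>M\<^esub> a \<odot>\<^bsub>M\<^esub> y"
    and "\<And>a b x. \<lbrakk>a \<in> carrier R; b \<in> carrier R; x \<in> carrier M\<rbrakk> \<Longrightarrow>
      (a \<otimes>\<^bsub>R\<^esub> b) \<odot>\<^bsub>M\<^esub> x = a \<odot>\<^bsub>M\<^esub> (b \<odot>\<^bsub>M\<^esub> x)"
    and "\<And>x. x \<in> carrier M \<Longrightarrow> \<one>\<^bsub>R\<^esub> \<odot>\<^bsub>M\<^esub> x = x"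
  shows "left_module R M"
  by (intro left_module.intro left_module_axioms.intro abelian_groupI assms)

context left_module
begin

lemma smult_zero_right [simp]:
  assumes "a \<in> carrier R"
  shows "a \<odot>\<^bsub>M\<^esub> \<zero>\<^bsub>M\<^esub> = \<zero>\<^bsub>M\<^esub>"
  using smult_r_distr [OF assms M.zero_closed M.zero_closed] assms
    M.add.r_cancel_one' [of "a \<odot>\<^bsub>M\<^esub> \<zero>\<^bsub>M\<^esub>" "a \<odot>\<^bsub>M\<^esub> \<zero>\<^bsub>M\<^esub>"] by simp

lemma smult_zero_left [simp]:
  assumes "x \<in> carrier M"
  shows "\<zero> \<odot>\<^bsub>M\<^esub> x = \<zero>\<^bsub>M\<^esub>"
  using smult_l_distr [OF R.zero_closed R.zero_closed assms] assms
    M.add.r_cancel_one' [of "\<zero> \<odot>\<^bsub>M\<^esub> x" "\<zero> \<odot>\<^bsub>M\<^esub> x"] by simp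

lemma smult_minus_one:
  assumes "x \<in> carrier M"
  shows "(\<ominus> \<one>) \<odot>\<^bsub>M\<^esub> x = \<ominus>\<^bsub>M\<^esub> x"
  using smult_l_distr [of "\<ominus> \<one>" \<one> x] assms
  by (simp add: R.l_neg M.minus_equality)

lemma smult_minus:
  assumes "a \<in> carrier R" "x \<in> carrier M"
  shows "a \<odot>\<^bsub>M\<^esub> (\<ominus>\<^bsub>M\<^esub> x) = \<ominus>\<^bsub>M\<^esub> (a \<odot>\<^bsub>M\<^esub> x)"
  using smult_r_distr [of a "\<ominus>\<^bsub>M\<^esub> x" x] assms
  by (simp add: M.l_neg M.minus_equality)

lemma smult_diff:
  assumes "a \<in> carrier R" "x \<in> carrier M" "y \<in> carrier M"
  shows "a \<odot>\<^bsub>M\<^esub> (x \<ominus>\<^bsub>M\<^esub> y) = a \<odot>\<^bsub>M\<^esub> x \<ominus>\<^bsub>M\<^esub> a \<odot>\<^bsub>M\<^esub> y"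
  using assms by (simp add: a_minus_def smult_r_distr smult_minus)

lemma smult_finsum:
  assumes "finite A" "a \<in> carrier R" "f \<in> A \<rightarrow> carrier M"
  shows "a \<odot>\<^bsub>M\<^esub> finsum M f A = finsum M (\<lambda>i. a \<odot>\<^bsub>M\<^esub> f i) A"
  using assms(1,3)
proof (induction A)
  case (insert i A)
  then have "f i \<in> carrier M" "f \<in> A \<rightarrow> carrier M" by auto
  moreover have "(\<lambda>i. a \<odot>\<^bsub>M\<^esub> f i) \<in> A \<rightarrow> carrier M" using insert.prems assms(2) by auto
  ultimately show ?case
    using insert assms(2) by (simp add: smult_r_distr M.finsum_insert)
qed (use assms(2) in simp)

end

definition lin :: "('r, 'a) ring_scheme \<Rightarrow> ('r, 'm) module \<Rightarrow> ('r, 'n) module \<Rightarrow> ('m \<Rightarrow> 'n) \<Rightarrow> bool" where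
  "lin R M N f \<longleftrightarrow> (\<forall>x\<in>carrier M. f x \<in> carrier N) \<and>
     (\<forall>x\<in>carrier M. \<forall>y\<in>carrier M. f (x \<oplus>\<^bsub>M\<^esub> y) = f x \<oplus>\<^bsub>N\<^esub> f y) \<and>
     (\<forall>r\<in>carrier R. \<forall>x\<in>carrier M. f (r \<odot>\<^bsub>M\<^esub> x) = r \<odot>\<^bsub>N\<^esub> f x)"

lemma linI:
  assumes "\<And>x. x \<in> carrier M \<Longrightarrow> f x \<in> carrier N"
    and "\<And>x y. \<lbrakk>x \<in> carrier M; y \<in> carrier M\<rbrakk> \<Longrightarrow> f (x \<oplus>\<^bsub>M\<^esub> y) = f x \<oplus>\<^bsub>N\<^esub> f y"
    and "\<And>r x. \<lbrakk>r \<in> carrier R; x \<in> carrier M\<rbrakk> \<Longrightarrow> f (r \<odot>\<^bsub>M\<^esub> x) = r \<odot>\<^bsub>N\<^esub> f x"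
  shows "lin R M N f"
  using assms by (simp add: lin_def)

lemma lin_closed: "lin R M N f \<Longrightarrow> x \<in> carrier M \<Longrightarrow> f x \<in> carrier N"
  and lin_add: "lin R M N f \<Longrightarrow> x \<in> carrier M \<Longrightarrow> y \<in> carrier M \<Longrightarrow> f (x \<oplus>\<^bsub>M\<^esub> y) = f x \<oplus>\<^bsub>N\<^esub> f y"
  and lin_smult: "lin R M N f \<Longrightarrow> r \<in> carrier R \<Longrightarrow> x \<in> carrier M \<Longrightarrow> f (r \<odot>\<^bsub>M\<^esub> x) = r \<odot>\<^bsub>N\<^esub> f x"
  by (simp_all add: lin_def)

lemma lhom_iff: "f \<in> lhom R M N \<longleftrightarrow> lin R M N f \<and> f \<in> extensional (carrier M)"
  by (auto simp: lhom_def lin_def PiE_def)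

lemma lhom_lin: "f \<in> lhom R M N \<Longrightarrow> lin R M N f"
  by (simp add: lhom_iff)

lemma lin_cong:
  assumes "\<And>x. x \<in> carrier M \<Longrightarrow> f x = g x" "left_module R M"
  shows "lin R M N f = lin R M N g"
proof -
  interpret M: left_module R M by fact
  show ?thesis unfolding lin_def by (simp add: assms(1) cong: ball_cong)
qed

lemma lin_congI:
  "lin R M N g \<Longrightarrow> left_module R M \<Longrightarrow> (\<And>x. x \<in> carrier M \<Longrightarrow> f x = g x) \<Longrightarrow> lin R M N f"
  using lin_cong by metis

lemma lin_restrict:
  assumes "left_module R M" "lin R M N f"
  shows "restrict f (carrier M) \<in> lhom R M N"
  using assms lin_cong [of M "restrict f (carrier M)" f R N] by (simp add: lhom_iff)

lemma lin_comp: "lin R L M f \<Longrightarrow> lin R M N g \<Longrightarrow> lin R L N (\<lambda>x. g (f x))"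
  by (simp add: lin_def)

lemma lin_id: "lin R M M (\<lambda>x. x)"
  by (simp add: lin_def)

context
  fixes R :: "('r, 'a) ring_scheme" and M :: "('r, 'm) module" and N :: "('r, 'n) module"
  assumes M: "left_module R M" and N: "left_module R N"
begin

interpretation M: left_module R M by (rule M)
interpretation N: left_module R N by (rule N)

lemma lin_zero:
  assumes "lin R M N f"
  shows "f \<zero>\<^bsub>M\<^esub> = \<zero>\<^bsub>N\<^esub>"
  using lin_smult [OF assms M.R.zero_closed M.M.zero_closed] lin_closed [OF assms M.M.zero_closed] by simp

lemma lin_minus:
  assumes "lin R M N f" "x \<in> carrier M"
  shows "f (\<ominus>\<^bsub>M\<^esub> x) = \<ominus>\<^bsub>N\<^esub> f x"
  using lin_smult [OF assms(1) _ assms(2), of "\<ominus>\<^bsub>R\<^esub> \<one>\<^bsub>R\<^esub>"] assms(2) lin_closed [OF assms]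
  by (simp add: M.smult_minus_one N.smult_minus_one)

lemma lin_diff:
  assumes "lin R M N f" "x \<in> carrier M" "y \<in> carrier M"
  shows "f (x \<ominus>\<^bsub>M\<^esub> y) = f x \<ominus>\<^bsub>N\<^esub> f y"
  using assms by (simp add: a_minus_def lin_add lin_minus)

lemma lin_const_zero: "lin R M N (\<lambda>x. \<zero>\<^bsub>N\<^esub>)"
  by (rule linI) auto

lemma lin_plus: "lin R M N f \<Longrightarrow> lin R M N g \<Longrightarrow> lin R M N (\<lambda>x. f x \<oplus>\<^bsub>N\<^esub> g x)"
  by (rule linI) (auto simp: lin_add lin_closed lin_smult N.smult_r_distr N.M.add_add_swap)

lemma lin_minus_fun: "lin R M N f \<Longrightarrow> lin R M N g \<Longrightarrow> lin R M N (\<lambda>x. f x \<ominus>\<^bsub>N\<^esub> g x)"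
  by (rule linI) (auto simp: lin_add lin_closed lin_smult N.smult_diff N.M.add_diff_add)

lemma lin_finsum_fun:
  assumes "finite A" "\<And>i. i \<in> A \<Longrightarrow> lin R M N (f i)"
  shows "lin R M N (\<lambda>x. finsum N (\<lambda>i. f i x) A)"
proof (rule linI)
  fix x y assume "x \<in> carrier M" "y \<in> carrier M"
  then have "finsum N (\<lambda>i. f i (x \<oplus>\<^bsub>M\<^esub> y)) A = finsum N (\<lambda>i. f i x \<oplus>\<^bsub>N\<^esub> f i y) A"
    by (intro N.M.finsum_cong') (auto simp: lin_add [OF assms(2)] lin_closed [OF assms(2)])
  also have "\<dots> = finsum N (\<lambda>i. f i x) A \<oplus>\<^bsub>N\<^esub> finsum N (\<lambda>i. f i y) A"
    using \<open>x \<in> carrier M\<close> \<open>y \<in> carrier M\<close> by (intro N.M.finsum_addf) (auto simp: lin_closed [OF assms(2)])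
  finally show "finsum N (\<lambda>i. f i (x \<oplus>\<^bsub>M\<^esub> y)) A = finsum N (\<lambda>i. f i x) A \<oplus>\<^bsub>N\<^esub> finsum N (\<lambda>i. f i y) A" .
next
  fix r x assume "r \<in> carrier R" "x \<in> carrier M"
  then show "finsum N (\<lambda>i. f i (r \<odot>\<^bsub>M\<^esub> x)) A = r \<odot>\<^bsub>N\<^esub> finsum N (\<lambda>i. f i x) A"
    by (subst N.smult_finsum)
      (auto simp: assms(1) lin_smult [OF assms(2)] lin_closed [OF assms(2)] intro!: N.M.finsum_cong')
qed (auto intro!: N.M.finsum_closed simp: lin_closed [OF assms(2)])

lemma lin_inj_iff:
  assumes "lin R M N f"
  shows "inj_on f (carrier M) \<longleftrightarrow> (\<forall>x\<in>carrier M. f x = \<zero>\<^bsub>N\<^esub> \<longrightarrow> x = \<zero>\<^bsub>M\<^esub>)" (is "_ \<longleftrightarrow> ?R")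
proof
  assume "inj_on f (carrier M)"
  then show ?R using lin_zero [OF assms] by (metis M.M.zero_closed inj_onD)
next
  assume k: ?R
  show "inj_on f (carrier M)"
  proof (rule inj_onI)
    fix x y assume xy: "x \<in> carrier M" "y \<in> carrier M" "f x = f y"
    then have "f (x \<ominus>\<^bsub>M\<^esub> y) = \<zero>\<^bsub>N\<^esub>"
      using lin_closed [OF assms xy(1)] lin_closed [OF assms xy(2)] by (simp add: lin_diff [OF assms])
    with k xy have "x \<ominus>\<^bsub>M\<^esub> y = \<zero>\<^bsub>M\<^esub>" by simp
    then show "x = y" using xy by simp
  qed
qed

end

definition submod :: "('r, 'a) ring_scheme \<Rightarrow> 'm set \<Rightarrow> ('r, 'm) module \<Rightarrow> bool" where
  "submod R N M \<longleftrightarrow> N \<subseteq> carrier M \<and> \<zero>\<^bsub>M\<^esub> \<in> N \<and> (\<forall>x\<in>N. \<forall>y\<in>N. x \<oplus>\<^bsub>M\<^esub> y \<in> N) \<and>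
     (\<forall>r\<in>carrier R. \<forall>x\<in>N. r \<odot>\<^bsub>M\<^esub> x \<in> N)"

lemma submod_subset: "submod R N M \<Longrightarrow> x \<in> N \<Longrightarrow> x \<in> carrier M"
  and submod_zero: "submod R N M \<Longrightarrow> \<zero>\<^bsub>M\<^esub> \<in> N"
  and submod_add: "submod R N M \<Longrightarrow> x \<in> N \<Longrightarrow> y \<in> N \<Longrightarrow> x \<oplus>\<^bsub>M\<^esub> y \<in> N"
  and submod_smult: "submod R N M \<Longrightarrow> r \<in> carrier R \<Longrightarrow> x \<in> N \<Longrightarrow> r \<odot>\<^bsub>M\<^esub> x \<in> N"
  by (auto simp: submod_def)

lemma submod_carrier: "left_module R M \<Longrightarrow> submod R (carrier M) M"
proof -
  assume "left_module R M"
  then interpret left_module R M .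
  show ?thesis by (simp add: submod_def)
qed

context
  fixes R :: "('r, 'a) ring_scheme" and M :: "('r, 'm) module" and N :: "'m set"
  assumes M: "left_module R M" and N: "submod R N M"
begin

interpretation M: left_module R M by (rule M)

lemma submod_minus: "x \<in> N \<Longrightarrow> \<ominus>\<^bsub>M\<^esub> x \<in> N"
  using submod_smult [OF N, of "\<ominus>\<^bsub>R\<^esub> \<one>\<^bsub>R\<^esub>" x] submod_subset [OF N] by (simp add: M.smult_minus_one)

lemma submod_diff: "x \<in> N \<Longrightarrow> y \<in> N \<Longrightarrow> x \<ominus>\<^bsub>M\<^esub> y \<in> N"
  by (simp add: a_minus_def submod_minus submod_add [OF N])

lemma submod_diff_right:
  assumes "x \<in> carrier M" "y \<in> N" "x \<ominus>\<^bsub>M\<^esub> y \<in> N"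
  shows "x \<in> N"
  using submod_add [OF N assms(3,2)] assms submod_subset [OF N] by simp

lemma submod_left_module: "left_module R (M\<lparr>carrier := N\<rparr>)"
proof (rule left_moduleI)
  fix x assume "x \<in> carrier (M\<lparr>carrier := N\<rparr>)"
  then show "\<exists>y\<in>carrier (M\<lparr>carrier := N\<rparr>). y \<oplus>\<^bsub>M\<lparr>carrier := N\<rparr>\<^esub> x = \<zero>\<^bsub>M\<lparr>carrier := N\<rparr>\<^esub>"
    using submod_minus [of x] submod_subset [OF N] by (auto intro!: bexI [of _ "\<ominus>\<^bsub>M\<^esub> x"] simp: M.M.l_neg)
qed (auto simp: submod_subset [OF N] submod_zero [OF N] submod_add [OF N] submod_smult [OF N] M.smult_l_distr
    M.smult_r_distr M.smult_assoc M.M.a_assoc M.R.ring_axioms intro: M.M.a_comm)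

end

lemma lin_submod_dom: "submod R N M \<Longrightarrow> lin R M L f \<Longrightarrow> lin R (M\<lparr>carrier := N\<rparr>) L f"
  by (auto simp: lin_def submod_def subset_iff)

lemma lin_submod_cod:
  "lin R L M f \<Longrightarrow> (\<And>x. x \<in> carrier L \<Longrightarrow> f x \<in> N) \<Longrightarrow> lin R L (M\<lparr>carrier := N\<rparr>) f"
  by (auto simp: lin_def)

lemma lin_submod_incl: "submod R N M \<Longrightarrow> lin R L (M\<lparr>carrier := N\<rparr>) f \<Longrightarrow> lin R L M f"
  by (auto simp: lin_def submod_def)

lemma submod_image:
  assumes "left_module R M" "left_module R N" "lin R M N f" "submod R A M"
  shows "submod R (f ` A) N"
  unfolding submod_def
proof (intro conjI ballI)
  show "f ` A \<subseteq> carrier N" using assms by (auto simp: lin_closed submod_subset)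
  show "\<zero>\<^bsub>N\<^esub> \<in> f ` A"
    using lin_zero [OF assms(1-3)] submod_zero [OF assms(4)] by (metis imageI)
  fix x y assume "x \<in> f ` A" "y \<in> f ` A"
  then obtain a b where "a \<in> A" "b \<in> A" "x = f a" "y = f b" by auto
  then show "x \<oplus>\<^bsub>N\<^esub> y \<in> f ` A"
    using submod_add [OF assms(4), of a b] lin_add [OF assms(3), of a b] submod_subset [OF assms(4)] by (metis imageI)
next
  fix r x assume "r \<in> carrier R" "x \<in> f ` A"
  then obtain a where "a \<in> A" "x = f a" by auto
  then show "r \<odot>\<^bsub>N\<^esub> x \<in> f ` A"
    using submod_smult [OF assms(4) \<open>r \<in> carrier R\<close>, of a] lin_smult [OF assms(3) \<open>r \<in> carrier R\<close>, of a]
      submod_subset [OF assms(4)] by (metis imageI)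
qed

lemma submod_vimage:
  assumes "left_module R M" "left_module R N" "lin R M N f" "submod R A N"
  shows "submod R {x \<in> carrier M. f x \<in> A} M"
proof -
  interpret M: left_module R M by fact
  show ?thesis
    using assms(4) lin_zero [OF assms(1-3)]
    by (auto simp: submod_def lin_add [OF assms(3)] lin_smult [OF assms(3)])
qed

lemma submod_zero_set: "left_module R M \<Longrightarrow> submod R {\<zero>\<^bsub>M\<^esub>} M"
proof -
  assume "left_module R M"
  then interpret left_module R M .
  show ?thesis by (simp add: submod_def)
qed

lemma submod_ker:
  assumes "left_module R M" "left_module R N" "lin R M N f"
  shows "submod R {x \<in> carrier M. f x = \<zero>\<^bsub>N\<^esub>} M"
  using submod_vimage [OF assms submod_zero_set [OF assms(2)]] by simp

lemma submod_eq:
  assumes M: "left_module R M" and N: "left_module R N" and f: "lin R M N f" and g: "lin R M N g"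
  shows "submod R {x \<in> carrier M. f x = g x} M"
proof -
  interpret M: left_module R M by fact
  show ?thesis
    using lin_zero [OF M N f] lin_zero [OF M N g]
    by (auto simp: submod_def lin_add [OF f] lin_add [OF g] lin_smult [OF f] lin_smult [OF g])
qed

text \<open>Quotients, transport of structure and direct limits are all instances.\<close>

lemma left_module_locally_image:
  fixes Q :: "('r, 'q) module" and M :: "'i \<Rightarrow> ('r, 'm) module" and \<kappa> :: "'i \<Rightarrow> 'm \<Rightarrow> 'q"
  assumes M: "\<And>i. left_module R (M i)"
    and lin: "\<And>i. lin R (M i) Q (\<kappa> i)"
    and zero: "\<And>i. \<kappa> i \<zero>\<^bsub>M i\<^esub> = \<zero>\<^bsub>Q\<^esub>"
    and cover: "\<And>x y z. \<lbrakk>x \<in> carrier Q; y \<in> carrier Q; z \<in> carrier Q\<rbrakk> \<Longrightarrow>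
       \<exists>i. {x, y, z} \<subseteq> \<kappa> i ` carrier (M i)"
  shows "left_module R Q"
proof -
  have c1: "\<exists>i a. a \<in> carrier (M i) \<and> x = \<kappa> i a" if "x \<in> carrier Q" for x
    using cover [OF that that that] by auto
  have c2: "\<exists>i a b. a \<in> carrier (M i) \<and> b \<in> carrier (M i) \<and> x = \<kappa> i a \<and> y = \<kappa> i b"
    if "x \<in> carrier Q" "y \<in> carrier Q" for x y
    using cover [OF that that(2)] by auto
  have c3: "\<exists>i a b c. a \<in> carrier (M i) \<and> b \<in> carrier (M i) \<and> c \<in> carrier (M i) \<and>
      x = \<kappa> i a \<and> y = \<kappa> i b \<and> z = \<kappa> i c"
    if "x \<in> carrier Q" "y \<in> carrier Q" "z \<in> carrier Q" for x y z
    using cover [OF that] by auto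
  have za: "\<zero>\<^bsub>M i\<^esub> \<in> carrier (M i)" for i
  proof -
    interpret left_module R "M i" by (rule M)
    show ?thesis by simp
  qed
  show ?thesis
  proof (rule left_moduleI)
    show "ring R" using M by (simp add: left_module_def)
    show "\<zero>\<^bsub>Q\<^esub> \<in> carrier Q" using lin_closed [OF lin za] zero by metis
  next
    fix x y assume "x \<in> carrier Q" "y \<in> carrier Q"
    then obtain i a b where *: "a \<in> carrier (M i)" "b \<in> carrier (M i)" "x = \<kappa> i a" "y = \<kappa> i b"
      using c2 by meson
    interpret left_module R "M i" by (rule M)
    show "x \<oplus>\<^bsub>Q\<^esub> y \<in> carrier Q" "x \<oplus>\<^bsub>Q\<^esub> y = y \<oplus>\<^bsub>Q\<^esub> x"
      using * lin_add [OF lin, of a i b] lin_add [OF lin, of b i a] lin_closed [OF lin, of "a \<oplus>\<^bsub>M i\<^esub> b" i]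
      by (auto simp: M.a_comm)
  next
    fix x y z assume "x \<in> carrier Q" "y \<in> carrier Q" "z \<in> carrier Q"
    then obtain i a b c where *: "a \<in> carrier (M i)" "b \<in> carrier (M i)" "c \<in> carrier (M i)"
      "x = \<kappa> i a" "y = \<kappa> i b" "z = \<kappa> i c"
      using c3 by meson
    interpret left_module R "M i" by (rule M)
    have "\<kappa> i ((a \<oplus>\<^bsub>M i\<^esub> b) \<oplus>\<^bsub>M i\<^esub> c) = \<kappa> i (a \<oplus>\<^bsub>M i\<^esub> (b \<oplus>\<^bsub>M i\<^esub> c))"
      using * by (simp add: M.a_assoc)
    then show "x \<oplus>\<^bsub>Q\<^esub> y \<oplus>\<^bsub>Q\<^esub> z = x \<oplus>\<^bsub>Q\<^esub> (y \<oplus>\<^bsub>Q\<^esub> z)"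
      using * by (simp add: lin_add [OF lin])
  next
    fix x assume "x \<in> carrier Q"
    then obtain i a where *: "a \<in> carrier (M i)" "x = \<kappa> i a" using c1 by meson
    interpret left_module R "M i" by (rule M)
    have "\<kappa> i (\<zero>\<^bsub>M i\<^esub> \<oplus>\<^bsub>M i\<^esub> a) = \<kappa> i a" "\<kappa> i (\<ominus>\<^bsub>M i\<^esub> a \<oplus>\<^bsub>M i\<^esub> a) = \<zero>\<^bsub>Q\<^esub>"
      "\<kappa> i (\<one>\<^bsub>R\<^esub> \<odot>\<^bsub>M i\<^esub> a) = \<kappa> i a"
      using * by (simp_all add: M.l_neg zero)
    then show "\<zero>\<^bsub>Q\<^esub> \<oplus>\<^bsub>Q\<^esub> x = x" "\<exists>y\<in>carrier Q. y \<oplus>\<^bsub>Q\<^esub> x = \<zero>\<^bsub>Q\<^esub>" "\<one>\<^bsub>R\<^esub> \<odot>\<^bsub>Q\<^esub> x = x"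
      using * lin_closed [OF lin, of "\<ominus>\<^bsub>M i\<^esub> a" i] lin_add [OF lin, of "\<zero>\<^bsub>M i\<^esub>" i a]
        lin_add [OF lin, of "\<ominus>\<^bsub>M i\<^esub> a" i a] lin_smult [OF lin, of "\<one>\<^bsub>R\<^esub>" a i]
      by (auto simp: zero simp del: smult_one)
  next
    fix r x assume r: "r \<in> carrier R" and "x \<in> carrier Q"
    then obtain i a where *: "a \<in> carrier (M i)" "x = \<kappa> i a" using c1 by meson
    interpret left_module R "M i" by (rule M)
    show "r \<odot>\<^bsub>Q\<^esub> x \<in> carrier Q"
      using * r lin_smult [OF lin r, of a i] lin_closed [OF lin, of "r \<odot>\<^bsub>M i\<^esub> a" i] by simp
  next
    fix r s x assume r: "r \<in> carrier R" "s \<in> carrier R" and "x \<in> carrier Q"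
    then obtain i a where *: "a \<in> carrier (M i)" "x = \<kappa> i a" using c1 by meson
    interpret left_module R "M i" by (rule M)
    have "\<kappa> i ((r \<oplus>\<^bsub>R\<^esub> s) \<odot>\<^bsub>M i\<^esub> a) = \<kappa> i (r \<odot>\<^bsub>M i\<^esub> a \<oplus>\<^bsub>M i\<^esub> s \<odot>\<^bsub>M i\<^esub> a)"
      "\<kappa> i ((r \<otimes>\<^bsub>R\<^esub> s) \<odot>\<^bsub>M i\<^esub> a) = \<kappa> i (r \<odot>\<^bsub>M i\<^esub> (s \<odot>\<^bsub>M i\<^esub> a))"
      using * r by (simp_all add: smult_l_distr smult_assoc)
    then show "(r \<oplus>\<^bsub>R\<^esub> s) \<odot>\<^bsub>Q\<^esub> x = r \<odot>\<^bsub>Q\<^esub> x \<oplus>\<^bsub>Q\<^esub> s \<odot>\<^bsub>Q\<^esub> x"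
      "r \<otimes>\<^bsub>R\<^esub> s \<odot>\<^bsub>Q\<^esub> x = r \<odot>\<^bsub>Q\<^esub> (s \<odot>\<^bsub>Q\<^esub> x)"
      using * r by (simp_all add: lin_add [OF lin] lin_smult [OF lin])
  next
    fix r x y assume r: "r \<in> carrier R" and "x \<in> carrier Q" "y \<in> carrier Q"
    then obtain i a b where *: "a \<in> carrier (M i)" "b \<in> carrier (M i)" "x = \<kappa> i a" "y = \<kappa> i b"
      using c2 by meson
    interpret left_module R "M i" by (rule M)
    have "\<kappa> i (r \<odot>\<^bsub>M i\<^esub> (a \<oplus>\<^bsub>M i\<^esub> b)) = \<kappa> i (r \<odot>\<^bsub>M i\<^esub> a \<oplus>\<^bsub>M i\<^esub> r \<odot>\<^bsub>M i\<^esub> b)"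
      using * r by (simp add: smult_r_distr)
    then show "r \<odot>\<^bsub>Q\<^esub> (x \<oplus>\<^bsub>Q\<^esub> y) = r \<odot>\<^bsub>Q\<^esub> x \<oplus>\<^bsub>Q\<^esub> r \<odot>\<^bsub>Q\<^esub> y"
      using * r by (simp add: lin_add [OF lin] lin_smult [OF lin])
  qed
qed

lemma left_module_surj_image:
  assumes "left_module R M" "lin R M Q \<kappa>" "\<kappa> \<zero>\<^bsub>M\<^esub> = \<zero>\<^bsub>Q\<^esub>" "\<kappa> ` carrier M = carrier Q"
  shows "left_module R Q"
  by (rule left_module_locally_image [of R "\<lambda>_. M" Q "\<lambda>_. \<kappa>"]) (use assms in auto)

lemma lin_factor:
  assumes A: "left_module R A" and X: "left_module R X" and M: "left_module R M"
    and q: "lin R A X q" and surj: "q ` carrier A = carrier X" and g: "lin R A M g"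
    and ker: "\<And>a. a \<in> carrier A \<Longrightarrow> q a = \<zero>\<^bsub>X\<^esub> \<Longrightarrow> g a = \<zero>\<^bsub>M\<^esub>"
  obtains l where "lin R X M l" "\<And>a. a \<in> carrier A \<Longrightarrow> l (q a) = g a"
proof -
  interpret A: left_module R A by fact
  interpret X: left_module R X by fact
  interpret M: left_module R M by fact
  define l where "l x = g (SOME a. a \<in> carrier A \<and> q a = x)" for x
  have l: "l (q a) = g a" if a: "a \<in> carrier A" for a
  proof -
    define b where "b = (SOME b. b \<in> carrier A \<and> q b = q a)"
    have b: "b \<in> carrier A" "q b = q a"
      using someI [of "\<lambda>b. b \<in> carrier A \<and> q b = q a" a] a by (auto simp: b_def)
    then have "q (b \<ominus>\<^bsub>A\<^esub> a) = \<zero>\<^bsub>X\<^esub>"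
      using a lin_closed [OF q a] by (simp add: lin_diff [OF A X q])
    then have "g b \<ominus>\<^bsub>M\<^esub> g a = \<zero>\<^bsub>M\<^esub>"
      using ker [of "b \<ominus>\<^bsub>A\<^esub> a"] a b by (simp add: lin_diff [OF A M g])
    then have "g b = g a" using a b lin_closed [OF g] by simp
    then show ?thesis by (simp add: l_def b_def)
  qed
  have ex: "\<exists>a\<in>carrier A. x = q a" if "x \<in> carrier X" for x using surj that by auto
  have "lin R X M l"
  proof (rule linI)
    fix x assume "x \<in> carrier X"
    then obtain a where "a \<in> carrier A" "x = q a" using ex by blast
    then show "l x \<in> carrier M" using l lin_closed [OF g] by simp
  next
    fix x y assume "x \<in> carrier X" "y \<in> carrier X"
    then obtain a b where ab: "a \<in> carrier A" "x = q a" "b \<in> carrier A" "y = q b" using ex by metis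
    then have "l (q (a \<oplus>\<^bsub>A\<^esub> b)) = l (q a) \<oplus>\<^bsub>M\<^esub> l (q b)"
      by (simp add: l lin_add [OF g])
    then show "l (x \<oplus>\<^bsub>X\<^esub> y) = l x \<oplus>\<^bsub>M\<^esub> l y" using ab by (simp add: lin_add [OF q])
  next
    fix r x assume "x \<in> carrier X" and r: "r \<in> carrier R"
    then obtain a where ab: "a \<in> carrier A" "x = q a" using ex by blast
    then have "l (q (r \<odot>\<^bsub>A\<^esub> a)) = r \<odot>\<^bsub>M\<^esub> l (q a)" using r by (simp add: l lin_smult [OF g])
    then show "l (r \<odot>\<^bsub>X\<^esub> x) = r \<odot>\<^bsub>M\<^esub> l x" using ab r by (simp add: lin_smult [OF q])
  qed
  with l show thesis by (rule that [rotated])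
qed

lemma lin_inverse:
  assumes M: "left_module R M" and N: "left_module R N" and f: "lin R M N f"
    and inj: "inj_on f (carrier M)" and surj: "f ` carrier M = carrier N"
  obtains g where "lin R N M g" "\<And>x. x \<in> carrier M \<Longrightarrow> g (f x) = x"
    "\<And>y. y \<in> carrier N \<Longrightarrow> f (g y) = y"
proof -
  obtain g where g: "lin R N M g" "\<And>x. x \<in> carrier M \<Longrightarrow> g (f x) = x"
    using lin_factor [OF M N M f surj lin_id] inj lin_inj_iff [OF M N f] by metis
  moreover have "f (g y) = y" if "y \<in> carrier N" for y
    using that surj g(2) by (metis imageE)
  ultimately show thesis using that by blast
qed

section \<open>Products, quotients and direct sums\<close>

lemma prod_module_simps [simp]:
  "carrier (prod_module M N) = carrier M \<times> carrier N"
  "\<zero>\<^bsub>prod_module M N\<^esub> = (\<zero>\<^bsub>M\<^esub>, \<zero>\<^bsub>N\<^esub>)"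
  "(x, y) \<oplus>\<^bsub>prod_module M N\<^esub> (x', y') = (x \<oplus>\<^bsub>M\<^esub> x', y \<oplus>\<^bsub>N\<^esub> y')"
  "r \<odot>\<^bsub>prod_module M N\<^esub> (x, y) = (r \<odot>\<^bsub>M\<^esub> x, r \<odot>\<^bsub>N\<^esub> y)"
  by (simp_all add: prod_module_def)

lemma prod_module_left_module:
  assumes "left_module R M" "left_module R N"
  shows "left_module R (prod_module M N)"
proof -
  interpret M: left_module R M by fact
  interpret N: left_module R N by fact
  show ?thesis
  proof (rule left_moduleI)
    fix x assume "x \<in> carrier (prod_module M N)"
    then show "\<exists>y\<in>carrier (prod_module M N). y \<oplus>\<^bsub>prod_module M N\<^esub> x = \<zero>\<^bsub>prod_module M N\<^esub>"
      by (intro bexI [of _ "(\<ominus>\<^bsub>M\<^esub> fst x, \<ominus>\<^bsub>N\<^esub> snd x)"]) (auto simp: M.M.l_neg N.M.l_neg)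
  qed (auto simp: M.M.a_assoc N.M.a_assoc M.smult_l_distr N.smult_l_distr M.smult_r_distr N.smult_r_distr
      M.smult_assoc N.smult_assoc M.R.ring_axioms intro: M.M.a_comm N.M.a_comm)
qed

lemma prod_module_uminus:
  assumes "left_module R M" "left_module R N" "x \<in> carrier M" "y \<in> carrier N"
  shows "\<ominus>\<^bsub>prod_module M N\<^esub> (x, y) = (\<ominus>\<^bsub>M\<^esub> x, \<ominus>\<^bsub>N\<^esub> y)"
proof -
  interpret M: left_module R M by fact
  interpret N: left_module R N by fact
  interpret P: left_module R "prod_module M N" by (rule prod_module_left_module) fact+
  show ?thesis
    by (rule P.M.minus_equality) (use assms in \<open>auto simp: M.M.l_neg N.M.l_neg\<close>)
qed

lemma prod_module_minus:
  assumes "left_module R M" "left_module R N" "x \<in> carrier M" "y \<in> carrier N"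
  shows "(a, b) \<ominus>\<^bsub>prod_module M N\<^esub> (x, y) = (a \<ominus>\<^bsub>M\<^esub> x, b \<ominus>\<^bsub>N\<^esub> y)"
  using prod_module_uminus [OF assms] by (simp add: a_minus_def)

lemma lin_fst: "lin R (prod_module M N) M fst"
  and lin_snd: "lin R (prod_module M N) N snd"
  by (auto intro!: linI)

lemma lin_pair: "lin R L M f \<Longrightarrow> lin R L N g \<Longrightarrow> lin R L (prod_module M N) (\<lambda>x. (f x, g x))"
  by (auto simp: lin_def)

lemma quotient_module_simps [simp]:
  "carrier (quotient_module M N) = a_rcosets\<^bsub>M\<^esub> N"
  "\<zero>\<^bsub>quotient_module M N\<^esub> = N"
  "A \<oplus>\<^bsub>quotient_module M N\<^esub> B = A <+>\<^bsub>M\<^esub> B"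
  by (simp_all add: quotient_module_def)

context
  fixes R :: "('r, 'a) ring_scheme" and M :: "('r, 'm) module" and N :: "'m set"
  assumes M: "left_module R M" and N: "submod R N M"
begin

interpretation M: left_module R M by (rule M)

lemma submod_abelian_subgroup: "abelian_subgroup N M"
proof (rule abelian_subgroupI3)
  show "additive_subgroup N M"
    by (intro additive_subgroup.intro M.add.subgroupI)
      (use N submod_minus [OF M N] in \<open>auto simp: submod_def\<close>)
qed (rule M.abelian_group_axioms)

interpretation S: abelian_subgroup N M by (rule submod_abelian_subgroup)

lemma coset_eq_iff:
  assumes "x \<in> carrier M" "y \<in> carrier M"
  shows "N +>\<^bsub>M\<^esub> x = N +>\<^bsub>M\<^esub> y \<longleftrightarrow> x \<ominus>\<^bsub>M\<^esub> y \<in> N"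
proof
  assume "N +>\<^bsub>M\<^esub> x = N +>\<^bsub>M\<^esub> y"
  then have "N +>\<^bsub>M\<^esub> (x \<ominus>\<^bsub>M\<^esub> y) = N"
    using M.M.a_coset_add_inv2 [of N x y] assms S.a_subset by (simp add: a_minus_def)
  then show "x \<ominus>\<^bsub>M\<^esub> y \<in> N"
    by (rule M.M.a_coset_join1 [OF _ _ S.a_subgroup]) (use assms in simp)
next
  assume "x \<ominus>\<^bsub>M\<^esub> y \<in> N"
  then have "N +>\<^bsub>M\<^esub> (x \<ominus>\<^bsub>M\<^esub> y) = N"
    by (intro M.M.a_coset_join2 [OF _ S.a_subgroup]) (use assms in simp)
  then show "N +>\<^bsub>M\<^esub> x = N +>\<^bsub>M\<^esub> y"
    using M.M.a_coset_add_inv1 [OF _ assms S.a_subset] by (simp add: a_minus_def)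
qed

lemma coset_eq_zero_iff:
  assumes "x \<in> carrier M"
  shows "N +>\<^bsub>M\<^esub> x = N \<longleftrightarrow> x \<in> N"
  using coset_eq_iff [OF assms M.M.zero_closed] assms S.a_subset
  by simp

lemma quotient_coset_map:
  shows "lin R M (quotient_module M N) (\<lambda>x. N +>\<^bsub>M\<^esub> x)"
    and "(\<lambda>x. N +>\<^bsub>M\<^esub> x) ` carrier M = carrier (quotient_module M N)"
    and "left_module R (quotient_module M N)"
proof -
  show l: "lin R M (quotient_module M N) (\<lambda>x. N +>\<^bsub>M\<^esub> x)"
  proof (rule linI)
    fix r x assume rx: "r \<in> carrier R" "x \<in> carrier M"
    have "N +>\<^bsub>M\<^esub> (r \<odot>\<^bsub>M\<^esub> a) = N +>\<^bsub>M\<^esub> (r \<odot>\<^bsub>M\<^esub> x)" if a: "a \<in> N +>\<^bsub>M\<^esub> x" for a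
    proof -
      have "a \<in> carrier M" using a M.M.a_r_coset_subset_G [OF S.a_subset rx(2)] by blast
      moreover have "N +>\<^bsub>M\<^esub> a = N +>\<^bsub>M\<^esub> x"
        using M.M.a_repr_independence [OF a rx(2) S.a_subgroup] by simp
      ultimately show ?thesis
        using rx submod_smult [OF N rx(1), of "a \<ominus>\<^bsub>M\<^esub> x"] by (simp add: coset_eq_iff M.smult_diff)
    qed
    moreover have "N +>\<^bsub>M\<^esub> x \<noteq> {}" using S.a_rcos_self [OF rx(2)] by blast
    ultimately have "(\<Union>a\<in>N +>\<^bsub>M\<^esub> x. N +>\<^bsub>M\<^esub> (r \<odot>\<^bsub>M\<^esub> a)) = N +>\<^bsub>M\<^esub> (r \<odot>\<^bsub>M\<^esub> x)"
      by (intro SUP_eq_const)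
    then show "N +>\<^bsub>M\<^esub> (r \<odot>\<^bsub>M\<^esub> x) = r \<odot>\<^bsub>quotient_module M N\<^esub> (N +>\<^bsub>M\<^esub> x)"
      by (simp add: quotient_module_def)
  qed (auto simp: S.a_rcos_sum M.M.a_rcosetsI S.a_subset)
  show i: "(\<lambda>x. N +>\<^bsub>M\<^esub> x) ` carrier M = carrier (quotient_module M N)"
    by (auto simp: A_RCOSETS_def')
  show "left_module R (quotient_module M N)"
    by (rule left_module_surj_image [OF M l _ i]) (simp add: S.a_subset)
qed

end

definition single :: "'k set \<Rightarrow> ('k \<Rightarrow> ('r, 'm) module) \<Rightarrow> 'k \<Rightarrow> 'm \<Rightarrow> 'k \<Rightarrow> 'm" where
  "single K M k x = (\<lambda>i\<in>K. if i = k then x else \<zero>\<^bsub>M i\<^esub>)"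

definition copair :: "'k set \<Rightarrow> ('k \<Rightarrow> ('r, 'm) module) \<Rightarrow> ('r, 'n) module \<Rightarrow> ('k \<Rightarrow> 'm \<Rightarrow> 'n) \<Rightarrow> ('k \<Rightarrow> 'm) \<Rightarrow> 'n" where
  "copair K M N \<sigma> f = (\<Oplus>\<^bsub>N\<^esub>k\<in>{k\<in>K. f k \<noteq> \<zero>\<^bsub>M k\<^esub>}. \<sigma> k (f k))"

lemma direct_sum_simps [simp]:
  "\<zero>\<^bsub>direct_sum K M\<^esub> = (\<lambda>k\<in>K. \<zero>\<^bsub>M k\<^esub>)"
  "f \<oplus>\<^bsub>direct_sum K M\<^esub> g = (\<lambda>k\<in>K. f k \<oplus>\<^bsub>M k\<^esub> g k)"
  "r \<odot>\<^bsub>direct_sum K M\<^esub> f = (\<lambda>k\<in>K. r \<odot>\<^bsub>M k\<^esub> f k)"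
  by (simp_all add: direct_sum_def)

lemma direct_sum_carrier:
  "f \<in> carrier (direct_sum K M) \<longleftrightarrow> f \<in> extensional K \<and> (\<forall>k\<in>K. f k \<in> carrier (M k)) \<and>
     finite {k\<in>K. f k \<noteq> \<zero>\<^bsub>M k\<^esub>}"
  by (auto simp: direct_sum_def PiE_def)

lemma direct_sum_component: "f \<in> carrier (direct_sum K M) \<Longrightarrow> k \<in> K \<Longrightarrow> f k \<in> carrier (M k)"
  by (simp add: direct_sum_carrier)

lemma direct_sum_finite: "f \<in> carrier (direct_sum K M) \<Longrightarrow> finite {k\<in>K. f k \<noteq> \<zero>\<^bsub>M k\<^esub>}"
  by (simp add: direct_sum_carrier)

lemma lin_component: "k \<in> K \<Longrightarrow> lin R (direct_sum K M) (M k) (\<lambda>f. f k)"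
  by (auto simp: lin_def direct_sum_carrier)

context
  fixes R :: "('r, 'a) ring_scheme" and K :: "'k set" and M :: "'k \<Rightarrow> ('r, 'm) module"
  assumes R: "ring R" and M: "\<And>k. k \<in> K \<Longrightarrow> left_module R (M k)"
begin

lemma direct_sumI:
  assumes "f \<in> extensional K" "\<And>k. k \<in> K \<Longrightarrow> f k \<in> carrier (M k)"
    and "finite A" "\<And>k. k \<in> K \<Longrightarrow> k \<notin> A \<Longrightarrow> f k = \<zero>\<^bsub>M k\<^esub>"
  shows "f \<in> carrier (direct_sum K M)"
proof -
  have "finite {k\<in>K. f k \<noteq> \<zero>\<^bsub>M k\<^esub>}"
    by (rule finite_subset [OF _ assms(3)]) (use assms(4) in blast)
  with assms(1,2) show ?thesis unfolding direct_sum_carrier by blast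
qed

lemma direct_sum_left_module: "left_module R (direct_sum K M)"
proof (rule left_moduleI)
  let ?S = "direct_sum K M"
  let ?supp = "\<lambda>f. {k\<in>K. f k \<noteq> \<zero>\<^bsub>M k\<^esub>}"
  have e: "f \<in> extensional K" if "f \<in> carrier ?S" for f using that by (simp only: direct_sum_carrier)
  show "ring R" by (rule R)
  show "\<zero>\<^bsub>?S\<^esub> \<in> carrier ?S"
  proof (rule direct_sumI)
    fix k assume k: "k \<in> K"
    interpret left_module R "M k" by (rule M [OF k])
    show "\<zero>\<^bsub>?S\<^esub> k \<in> carrier (M k)" using k by simp
    show "\<zero>\<^bsub>?S\<^esub> k = \<zero>\<^bsub>M k\<^esub>" using k by simp
  qed auto
  fix x assume x: "x \<in> carrier ?S"
  show "\<zero>\<^bsub>?S\<^esub> \<oplus>\<^bsub>?S\<^esub> x = x"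
  proof (rule extensionalityI [where A = K])
    fix k assume k: "k \<in> K"
    interpret left_module R "M k" by (rule M [OF k])
    show "(\<zero>\<^bsub>?S\<^esub> \<oplus>\<^bsub>?S\<^esub> x) k = x k" using k direct_sum_component [OF x k] by simp
  qed (simp_all add: e [OF x])
  show "\<one>\<^bsub>R\<^esub> \<odot>\<^bsub>?S\<^esub> x = x"
  proof (rule extensionalityI [where A = K])
    fix k assume k: "k \<in> K"
    interpret left_module R "M k" by (rule M [OF k])
    show "(\<one>\<^bsub>R\<^esub> \<odot>\<^bsub>?S\<^esub> x) k = x k" using k direct_sum_component [OF x k] by simp
  qed (simp_all add: e [OF x])
  show "\<exists>y\<in>carrier ?S. y \<oplus>\<^bsub>?S\<^esub> x = \<zero>\<^bsub>?S\<^esub>"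
  proof
    let ?y = "\<lambda>k\<in>K. \<ominus>\<^bsub>M k\<^esub> x k"
    show "?y \<in> carrier ?S"
    proof (rule direct_sumI [OF _ _ direct_sum_finite [OF x]])
      fix k assume k: "k \<in> K"
      interpret left_module R "M k" by (rule M [OF k])
      show "?y k \<in> carrier (M k)" using k direct_sum_component [OF x k] by simp
      show "?y k = \<zero>\<^bsub>M k\<^esub>" if "k \<notin> ?supp x" using k that by simp
    qed simp
    show "?y \<oplus>\<^bsub>?S\<^esub> x = \<zero>\<^bsub>?S\<^esub>"
    proof (rule extensionalityI [where A = K])
      fix k assume k: "k \<in> K"
      interpret left_module R "M k" by (rule M [OF k])
      show "(?y \<oplus>\<^bsub>?S\<^esub> x) k = \<zero>\<^bsub>?S\<^esub> k" using k direct_sum_component [OF x k] by (simp add: M.l_neg)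
    qed simp_all
  qed
  fix r assume r: "r \<in> carrier R"
  show "r \<odot>\<^bsub>?S\<^esub> x \<in> carrier ?S"
  proof (rule direct_sumI [OF _ _ direct_sum_finite [OF x]])
    fix k assume k: "k \<in> K"
    interpret left_module R "M k" by (rule M [OF k])
    show "(r \<odot>\<^bsub>?S\<^esub> x) k \<in> carrier (M k)" using k r direct_sum_component [OF x k] by simp
    show "(r \<odot>\<^bsub>?S\<^esub> x) k = \<zero>\<^bsub>M k\<^esub>" if "k \<notin> ?supp x" using k r that by simp
  qed simp
  fix s assume s: "s \<in> carrier R"
  show "(r \<oplus>\<^bsub>R\<^esub> s) \<odot>\<^bsub>?S\<^esub> x = r \<odot>\<^bsub>?S\<^esub> x \<oplus>\<^bsub>?S\<^esub> s \<odot>\<^bsub>?S\<^esub> x"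
  proof (rule extensionalityI [where A = K])
    fix k assume k: "k \<in> K"
    interpret left_module R "M k" by (rule M [OF k])
    show "((r \<oplus>\<^bsub>R\<^esub> s) \<odot>\<^bsub>?S\<^esub> x) k = (r \<odot>\<^bsub>?S\<^esub> x \<oplus>\<^bsub>?S\<^esub> s \<odot>\<^bsub>?S\<^esub> x) k"
      using k direct_sum_component [OF x k] r s by (simp add: smult_l_distr)
  qed simp_all
  show "r \<otimes>\<^bsub>R\<^esub> s \<odot>\<^bsub>?S\<^esub> x = r \<odot>\<^bsub>?S\<^esub> (s \<odot>\<^bsub>?S\<^esub> x)"
  proof (rule extensionalityI [where A = K])
    fix k assume k: "k \<in> K"
    interpret left_module R "M k" by (rule M [OF k])
    show "(r \<otimes>\<^bsub>R\<^esub> s \<odot>\<^bsub>?S\<^esub> x) k = (r \<odot>\<^bsub>?S\<^esub> (s \<odot>\<^bsub>?S\<^esub> x)) k"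
      using k direct_sum_component [OF x k] r s by (simp add: smult_assoc)
  qed simp_all
next
  let ?S = "direct_sum K M"
  let ?supp = "\<lambda>f. {k\<in>K. f k \<noteq> \<zero>\<^bsub>M k\<^esub>}"
  fix x y assume x: "x \<in> carrier ?S" and y: "y \<in> carrier ?S"
  show "x \<oplus>\<^bsub>?S\<^esub> y \<in> carrier ?S"
  proof (rule direct_sumI [OF _ _ finite_UnI [OF direct_sum_finite [OF x] direct_sum_finite [OF y]]])
    fix k assume k: "k \<in> K"
    interpret left_module R "M k" by (rule M [OF k])
    show "(x \<oplus>\<^bsub>?S\<^esub> y) k \<in> carrier (M k)"
      using k direct_sum_component [OF x k] direct_sum_component [OF y k] by simp
    show "(x \<oplus>\<^bsub>?S\<^esub> y) k = \<zero>\<^bsub>M k\<^esub>" if "k \<notin> ?supp x \<union> ?supp y" using k that by simp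
  qed simp
  show "x \<oplus>\<^bsub>?S\<^esub> y = y \<oplus>\<^bsub>?S\<^esub> x"
  proof (rule extensionalityI [where A = K])
    fix k assume k: "k \<in> K"
    interpret left_module R "M k" by (rule M [OF k])
    show "(x \<oplus>\<^bsub>?S\<^esub> y) k = (y \<oplus>\<^bsub>?S\<^esub> x) k"
      using k M.a_comm [OF direct_sum_component [OF x k] direct_sum_component [OF y k]] by simp
  qed simp_all
  show "r \<odot>\<^bsub>?S\<^esub> (x \<oplus>\<^bsub>?S\<^esub> y) = r \<odot>\<^bsub>?S\<^esub> x \<oplus>\<^bsub>?S\<^esub> r \<odot>\<^bsub>?S\<^esub> y" if r: "r \<in> carrier R" for r
  proof (rule extensionalityI [where A = K])
    fix k assume k: "k \<in> K"
    interpret left_module R "M k" by (rule M [OF k])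
    show "(r \<odot>\<^bsub>?S\<^esub> (x \<oplus>\<^bsub>?S\<^esub> y)) k = (r \<odot>\<^bsub>?S\<^esub> x \<oplus>\<^bsub>?S\<^esub> r \<odot>\<^bsub>?S\<^esub> y) k"
      using k r direct_sum_component [OF x k] direct_sum_component [OF y k] by (simp add: smult_r_distr)
  qed simp_all
  show "x \<oplus>\<^bsub>?S\<^esub> y \<oplus>\<^bsub>?S\<^esub> z = x \<oplus>\<^bsub>?S\<^esub> (y \<oplus>\<^bsub>?S\<^esub> z)" if z: "z \<in> carrier ?S" for z
  proof (rule extensionalityI [where A = K])
    fix k assume k: "k \<in> K"
    interpret left_module R "M k" by (rule M [OF k])
    show "(x \<oplus>\<^bsub>?S\<^esub> y \<oplus>\<^bsub>?S\<^esub> z) k = (x \<oplus>\<^bsub>?S\<^esub> (y \<oplus>\<^bsub>?S\<^esub> z)) k"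
      using k direct_sum_component [OF x k] direct_sum_component [OF y k] direct_sum_component [OF z k]
      by (simp add: M.a_assoc)
  qed simp_all
qed

lemma lin_direct_sumI:
  assumes "\<And>x. x \<in> carrier L \<Longrightarrow> f x \<in> carrier (direct_sum K M)"
    and "\<And>k. k \<in> K \<Longrightarrow> lin R L (M k) (\<lambda>x. f x k)"
    and "left_module R L"
  shows "lin R L (direct_sum K M) f"
proof -
  interpret L: left_module R L by (rule assms(3))
  have u: "f x k = undefined" if "x \<in> carrier L" "k \<notin> K" for x k
    using assms(1) [OF that(1)] that(2) by (simp add: direct_sum_carrier extensional_def)
  show ?thesis
  proof (rule linI)
    fix x y assume xy: "x \<in> carrier L" "y \<in> carrier L"
    show "f (x \<oplus>\<^bsub>L\<^esub> y) = f x \<oplus>\<^bsub>direct_sum K M\<^esub> f y"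
    proof
      fix k
      show "f (x \<oplus>\<^bsub>L\<^esub> y) k = (f x \<oplus>\<^bsub>direct_sum K M\<^esub> f y) k"
        using lin_add [OF assms(2) xy] u [OF L.M.a_closed [OF xy]] by (cases "k \<in> K") simp_all
    qed
  next
    fix r x assume rx: "r \<in> carrier R" "x \<in> carrier L"
    show "f (r \<odot>\<^bsub>L\<^esub> x) = r \<odot>\<^bsub>direct_sum K M\<^esub> f x"
    proof
      fix k
      show "f (r \<odot>\<^bsub>L\<^esub> x) k = (r \<odot>\<^bsub>direct_sum K M\<^esub> f x) k"
        using lin_smult [OF assms(2) rx] u [OF L.smult_closed [OF rx]] by (cases "k \<in> K") simp_all
    qed
  qed (rule assms(1))
qed

lemma component_zero_closed:
  assumes "k \<in> K"
  shows "\<zero>\<^bsub>M k\<^esub> \<in> carrier (M k)"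
proof -
  interpret left_module R "M k" by (rule M [OF assms])
  show ?thesis by simp
qed

lemma single_closed:
  assumes "k \<in> K" "x \<in> carrier (M k)"
  shows "single K M k x \<in> carrier (direct_sum K M)"
proof -
  have "{i\<in>K. single K M k x i \<noteq> \<zero>\<^bsub>M i\<^esub>} \<subseteq> {k}" by (auto simp: single_def)
  then have "finite {i\<in>K. single K M k x i \<noteq> \<zero>\<^bsub>M i\<^esub>}" by (rule finite_subset) simp
  moreover have "single K M k x i \<in> carrier (M i)" if "i \<in> K" for i
    using assms component_zero_closed [OF that] that by (auto simp: single_def)
  moreover have "single K M k x \<in> extensional K" by (simp add: single_def)
  ultimately show ?thesis unfolding direct_sum_carrier by (intro conjI ballI)
qed

lemma lin_single:
  assumes k: "k \<in> K"
  shows "lin R (M k) (direct_sum K M) (single K M k)"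
proof (rule lin_direct_sumI)
  fix i assume i: "i \<in> K"
  show "lin R (M k) (M i) (\<lambda>x. single K M k x i)"
  proof (cases "i = k")
    case True
    then show ?thesis using i lin_id [of R "M k"] by (simp add: single_def)
  next
    case False
    then show ?thesis using i lin_const_zero [OF M [OF k] M [OF i]] by (simp add: single_def)
  qed
qed (rule single_closed [OF k], assumption, rule M [OF k])

lemma direct_sum_generated:
  assumes N: "submod R N (direct_sum K M)"
    and gen: "\<And>k x. k \<in> K \<Longrightarrow> x \<in> carrier (M k) \<Longrightarrow> single K M k x \<in> N"
    and f: "f \<in> carrier (direct_sum K M)"
  shows "f \<in> N"
proof -
  have "\<forall>f\<in>carrier (direct_sum K M). {k\<in>K. f k \<noteq> \<zero>\<^bsub>M k\<^esub>} = A \<longrightarrow> f \<in> N" if "finite A" for A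
    using that
  proof induction
    case empty
    have "f \<in> N" if "f \<in> carrier (direct_sum K M)" "{k\<in>K. f k \<noteq> \<zero>\<^bsub>M k\<^esub>} = {}" for f
    proof -
      have "f = \<zero>\<^bsub>direct_sum K M\<^esub>"
        by (rule extensionalityI [where A = K]) (use that in \<open>auto simp: direct_sum_carrier\<close>)
      then show ?thesis using submod_zero [OF N] by metis
    qed
    then show ?case by blast
  next
    case (insert a A)
    show ?case
    proof (intro ballI impI)
      fix f assume f: "f \<in> carrier (direct_sum K M)" "{k\<in>K. f k \<noteq> \<zero>\<^bsub>M k\<^esub>} = insert a A"
      then have a: "a \<in> K" by auto
      define g where "g = f(a := \<zero>\<^bsub>M a\<^esub>)"
      have ga: "{k\<in>K. g k \<noteq> \<zero>\<^bsub>M k\<^esub>} = A" using f(2) insert.hyps by (auto simp: g_def)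
      then have g: "g \<in> carrier (direct_sum K M)"
      proof (intro direct_sumI [of _ A])
        show "g \<in> extensional K" using f(1) a by (simp add: direct_sum_carrier g_def extensional_def)
        show "g k \<in> carrier (M k)" if "k \<in> K" for k
          using direct_sum_component [OF f(1) that] component_zero_closed [OF a] by (simp add: g_def)
      qed (use insert.hyps ga in auto)
      have "f k = single K M a (f a) k \<oplus>\<^bsub>M k\<^esub> g k" if k: "k \<in> K" for k
      proof -
        interpret left_module R "M k" by (rule M [OF k])
        note c = direct_sum_component [OF f(1) k]
        show ?thesis
          using k M.r_zero [OF c] M.l_zero [OF c] by (cases "k = a") (auto simp: single_def g_def)
      qed
      then have "f = single K M a (f a) \<oplus>\<^bsub>direct_sum K M\<^esub> g"
        by (intro extensionalityI [where A = K]) (use f(1) in \<open>auto simp: direct_sum_carrier\<close>)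
      moreover have "g \<in> N" using insert.IH g ga by auto
      ultimately show "f \<in> N"
        using submod_add [OF N gen [OF a direct_sum_component [OF f(1) a]]] by metis
    qed
  qed
  then show ?thesis using f direct_sum_finite [OF f] by blast
qed

lemma
  assumes N: "left_module R N" and s: "\<And>k. k \<in> K \<Longrightarrow> lin R (M k) N (\<sigma> k)"
  shows lin_copair: "lin R (direct_sum K M) N (copair K M N \<sigma>)"
    and copair_single: "\<And>k x. k \<in> K \<Longrightarrow> x \<in> carrier (M k) \<Longrightarrow> copair K M N \<sigma> (single K M k x) = \<sigma> k x"
    and copair_superset: "\<And>f A. f \<in> carrier (direct_sum K M) \<Longrightarrow> finite A \<Longrightarrow> A \<subseteq> K \<Longrightarrow>
      {k\<in>K. f k \<noteq> \<zero>\<^bsub>M k\<^esub>} \<subseteq> A \<Longrightarrow> copair K M N \<sigma> f = (\<Oplus>\<^bsub>N\<^esub>k\<in>A. \<sigma> k (f k))"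
proof -
  interpret N: left_module R N by (rule N)
  have c: "\<sigma> k (f k) \<in> carrier N" if "f \<in> carrier (direct_sum K M)" "k \<in> K" for f k
    using lin_closed [OF s] direct_sum_component that by metis
  have z: "\<sigma> k \<zero>\<^bsub>M k\<^esub> = \<zero>\<^bsub>N\<^esub>" if "k \<in> K" for k
    using lin_zero [OF M [OF that] N s [OF that]] .
  show sup: "copair K M N \<sigma> f = (\<Oplus>\<^bsub>N\<^esub>k\<in>A. \<sigma> k (f k))"
    if "f \<in> carrier (direct_sum K M)" "finite A" "A \<subseteq> K" "{k\<in>K. f k \<noteq> \<zero>\<^bsub>M k\<^esub>} \<subseteq> A" for f A
    unfolding copair_def
    by (rule N.M.add.finprod_mono_neutral_cong_left) (use that c [OF that(1)] z in auto)
  show "lin R (direct_sum K M) N (copair K M N \<sigma>)"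
  proof (rule linI)
    interpret D: left_module R "direct_sum K M" by (rule direct_sum_left_module)
    fix f assume f: "f \<in> carrier (direct_sum K M)"
    show "copair K M N \<sigma> f \<in> carrier N"
      unfolding copair_def by (rule N.M.finsum_closed) (use c [OF f] in auto)
    fix g assume g: "g \<in> carrier (direct_sum K M)"
    define A where "A = {k\<in>K. f k \<noteq> \<zero>\<^bsub>M k\<^esub>} \<union> {k\<in>K. g k \<noteq> \<zero>\<^bsub>M k\<^esub>}"
    have A: "finite A" "A \<subseteq> K" "{k\<in>K. f k \<noteq> \<zero>\<^bsub>M k\<^esub>} \<subseteq> A" "{k\<in>K. g k \<noteq> \<zero>\<^bsub>M k\<^esub>} \<subseteq> A"
      using direct_sum_finite [OF f] direct_sum_finite [OF g] by (auto simp: A_def)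
    have fg: "f \<oplus>\<^bsub>direct_sum K M\<^esub> g \<in> carrier (direct_sum K M)"
      using f g by (rule D.M.a_closed)
    have "f k \<oplus>\<^bsub>M k\<^esub> g k = \<zero>\<^bsub>M k\<^esub>" if "k \<in> K" "k \<notin> A" for k
    proof -
      interpret left_module R "M k" by (rule M [OF that(1)])
      show ?thesis using that by (simp add: A_def)
    qed
    then have A': "{k\<in>K. (f \<oplus>\<^bsub>direct_sum K M\<^esub> g) k \<noteq> \<zero>\<^bsub>M k\<^esub>} \<subseteq> A" by auto
    have "(\<Oplus>\<^bsub>N\<^esub>k\<in>A. \<sigma> k ((f \<oplus>\<^bsub>direct_sum K M\<^esub> g) k)) = (\<Oplus>\<^bsub>N\<^esub>k\<in>A. \<sigma> k (f k) \<oplus>\<^bsub>N\<^esub> \<sigma> k (g k))"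
      using A(2) c [OF f] c [OF g] by (intro N.M.finsum_cong')
        (auto simp: subset_iff lin_add [OF s] direct_sum_component [OF f] direct_sum_component [OF g])
    also have "\<dots> = (\<Oplus>\<^bsub>N\<^esub>k\<in>A. \<sigma> k (f k)) \<oplus>\<^bsub>N\<^esub> (\<Oplus>\<^bsub>N\<^esub>k\<in>A. \<sigma> k (g k))"
      using A(2) c [OF f] c [OF g] by (intro N.M.finsum_addf) auto
    finally show "copair K M N \<sigma> (f \<oplus>\<^bsub>direct_sum K M\<^esub> g) = copair K M N \<sigma> f \<oplus>\<^bsub>N\<^esub> copair K M N \<sigma> g"
      by (simp only: sup [OF fg A(1,2) A'] sup [OF f A(1-3)] sup [OF g A(1,2,4)])
  next
    interpret D: left_module R "direct_sum K M" by (rule direct_sum_left_module)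
    fix r f assume r: "r \<in> carrier R" and f: "f \<in> carrier (direct_sum K M)"
    define A where "A = {k\<in>K. f k \<noteq> \<zero>\<^bsub>M k\<^esub>}"
    have A: "finite A" "A \<subseteq> K" "{k\<in>K. f k \<noteq> \<zero>\<^bsub>M k\<^esub>} \<subseteq> A"
      using direct_sum_finite [OF f] by (auto simp: A_def)
    have rf: "r \<odot>\<^bsub>direct_sum K M\<^esub> f \<in> carrier (direct_sum K M)"
      using r f by (rule D.smult_closed)
    have A': "{k\<in>K. (r \<odot>\<^bsub>direct_sum K M\<^esub> f) k \<noteq> \<zero>\<^bsub>M k\<^esub>} \<subseteq> A"
      using left_module.smult_zero_right [OF M r] by (auto simp: A_def)
    have "(\<Oplus>\<^bsub>N\<^esub>k\<in>A. \<sigma> k ((r \<odot>\<^bsub>direct_sum K M\<^esub> f) k)) = (\<Oplus>\<^bsub>N\<^esub>k\<in>A. r \<odot>\<^bsub>N\<^esub> \<sigma> k (f k))"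
      using A(2) c [OF f] r by (intro N.M.finsum_cong')
        (auto simp: subset_iff lin_smult [OF s] direct_sum_component [OF f])
    also have "\<dots> = r \<odot>\<^bsub>N\<^esub> (\<Oplus>\<^bsub>N\<^esub>k\<in>A. \<sigma> k (f k))"
      using A(1,2) r c [OF f] by (intro N.smult_finsum [symmetric]) auto
    finally show "copair K M N \<sigma> (r \<odot>\<^bsub>direct_sum K M\<^esub> f) = r \<odot>\<^bsub>N\<^esub> copair K M N \<sigma> f"
      by (simp only: sup [OF rf A(1,2) A'] sup [OF f A])
  qed
  fix k x assume k: "k \<in> K" "x \<in> carrier (M k)"
  have "copair K M N \<sigma> (single K M k x) = (\<Oplus>\<^bsub>N\<^esub>i\<in>{k}. \<sigma> i (single K M k x i))"
    by (rule sup [OF single_closed [OF k]]) (use k in \<open>auto simp: single_def\<close>)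
  also have "\<dots> = \<sigma> k x"
    using N.M.finsum_insert [of "{}" k "\<lambda>i. \<sigma> i (single K M k x i)"] k lin_closed [OF s] by (simp add: single_def)
  finally show "copair K M N \<sigma> (single K M k x) = \<sigma> k x" .
qed

lemma lin_direct_sum_eq:
  assumes N: "left_module R N" and f: "lin R (direct_sum K M) N f" and g: "lin R (direct_sum K M) N g"
    and eq: "\<And>k x. k \<in> K \<Longrightarrow> x \<in> carrier (M k) \<Longrightarrow> f (single K M k x) = g (single K M k x)"
    and x: "x \<in> carrier (direct_sum K M)"
  shows "f x = g x"
  using direct_sum_generated [OF submod_eq [OF direct_sum_left_module N f g] _ x] eq single_closed by auto

end

section \<open>Free and projective modules\<close>

lemma regular_module_left_module: "ring R \<Longrightarrow> left_module R (regular_module R)"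
proof -
  assume "ring R"
  then interpret ring R .
  show ?thesis
    by (rule left_moduleI)
      (auto simp: regular_module_def a_assoc l_distr r_distr m_assoc ring_axioms
        intro: a_comm bexI [of _ "\<ominus>\<^bsub>R\<^esub> _"] l_neg)
qed

lemma free_module_left_module: "ring R \<Longrightarrow> left_module R (free_module R K)"
  unfolding free_module_def by (rule direct_sum_left_module) (auto intro: regular_module_left_module)

lemma lin_regular_module:
  assumes "ring R" "lin R (regular_module R) N f" "r \<in> carrier R"
  shows "f r = r \<odot>\<^bsub>N\<^esub> f \<one>\<^bsub>R\<^esub>"
proof -
  interpret ring R by fact
  show ?thesis using lin_smult [OF assms(2,3), of "\<one>\<^bsub>R\<^esub>"] assms(3) by (simp add: regular_module_def)
qed

definition unit_vec :: "('r, 'a) ring_scheme \<Rightarrow> 'k set \<Rightarrow> 'k \<Rightarrow> 'k \<Rightarrow> 'r" where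
  "unit_vec R K k = single K (\<lambda>_. regular_module R) k \<one>\<^bsub>R\<^esub>"

context
  fixes R :: "('r, 'a) ring_scheme" and K :: "'k set"
  assumes R: "ring R"
begin

interpretation R: ring R by (rule R)

lemma unit_vec_closed: "k \<in> K \<Longrightarrow> unit_vec R K k \<in> carrier (free_module R K)"
  unfolding unit_vec_def free_module_def
  by (rule single_closed [OF R regular_module_left_module [OF R]]) (simp_all add: regular_module_def)

lemma free_module_generated:
  assumes N: "submod R N (free_module R K)"
    and gen: "\<And>k. k \<in> K \<Longrightarrow> unit_vec R K k \<in> N"
    and x: "x \<in> carrier (free_module R K)"
  shows "x \<in> N"
proof (rule direct_sum_generated [OF R regular_module_left_module [OF R] N [unfolded free_module_def] _
      x [unfolded free_module_def]])
  fix k r assume k: "k \<in> K" and r: "r \<in> carrier (regular_module R)"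
  then have rR: "r \<in> carrier R" by (simp add: regular_module_def)
  have "single K (\<lambda>_. regular_module R) k r = r \<odot>\<^bsub>free_module R K\<^esub> unit_vec R K k"
    unfolding unit_vec_def free_module_def
    by (rule lin_regular_module [OF R lin_single [OF R regular_module_left_module [OF R] k] rR])
  then show "single K (\<lambda>_. regular_module R) k r \<in> N"
    using submod_smult [OF N rR gen [OF k]] by simp
qed

lemma free_module_extend:
  assumes N: "left_module R N" and b: "\<And>k. k \<in> K \<Longrightarrow> b k \<in> carrier N"
  obtains g where "lin R (free_module R K) N g" "\<And>k. k \<in> K \<Longrightarrow> g (unit_vec R K k) = b k"
proof -
  interpret N: left_module R N by (rule N)
  have l: "lin R (regular_module R) N (\<lambda>r. r \<odot>\<^bsub>N\<^esub> b k)" if "k \<in> K" for k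
    by (rule linI) (use b [OF that] in \<open>simp_all add: regular_module_def N.smult_l_distr N.smult_assoc\<close>)
  let ?g = "copair K (\<lambda>_. regular_module R) N (\<lambda>k r. r \<odot>\<^bsub>N\<^esub> b k)"
  show thesis
  proof (rule that)
    show "lin R (free_module R K) N ?g"
      unfolding free_module_def
      by (rule lin_copair) (use R regular_module_left_module [OF R] N l in auto)
    show "?g (unit_vec R K k) = b k" if "k \<in> K" for k
      unfolding unit_vec_def
      by (subst copair_single [OF R regular_module_left_module [OF R] N l])
        (use that b [OF that] in \<open>auto simp: regular_module_def\<close>)
  qed
qed

lemma free_module_lift:
  assumes B: "left_module R B" and C: "left_module R C"
    and q: "lin R B C q" and surj: "q ` carrier B = carrier C"
    and h: "lin R (free_module R K) C h"
  obtains g where "lin R (free_module R K) B g"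
    "\<And>x. x \<in> carrier (free_module R K) \<Longrightarrow> q (g x) = h x"
proof -
  have "\<exists>b. b \<in> carrier B \<and> q b = h (unit_vec R K k)" if "k \<in> K" for k
  proof -
    have "h (unit_vec R K k) \<in> q ` carrier B"
      using lin_closed [OF h unit_vec_closed [OF that]] surj by simp
    then show ?thesis by auto
  qed
  then obtain b where b: "\<And>k. k \<in> K \<Longrightarrow> b k \<in> carrier B" "\<And>k. k \<in> K \<Longrightarrow> q (b k) = h (unit_vec R K k)"
    by metis
  obtain g where g: "lin R (free_module R K) B g" "\<And>k. k \<in> K \<Longrightarrow> g (unit_vec R K k) = b k"
    using free_module_extend [OF B, of b] b(1) by metis
  have "x \<in> {x \<in> carrier (free_module R K). q (g x) = h x}" if "x \<in> carrier (free_module R K)" for x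
    by (rule free_module_generated [OF submod_eq [OF free_module_left_module [OF R] C lin_comp [OF g(1) q] h] _ that])
      (simp add: b g unit_vec_closed)
  then show thesis using that [OF g(1)] by blast
qed

end

lemma projective_module_lift:
  fixes P :: "('r, 'm) module"
  assumes P: "projective_module R P" and B: "left_module R B" and C: "left_module R C"
    and q: "lin R B C q" and surj: "q ` carrier B = carrier C" and h: "lin R P C h"
  obtains g where "lin R P B g" "\<And>x. x \<in> carrier P \<Longrightarrow> q (g x) = h x"
proof -
  obtain I :: "'m set" and s p where sp: "s \<in> lhom R P (free_module R I)"
    "p \<in> lhom R (free_module R I) P" "\<forall>x\<in>carrier P. p (s x) = x"
    using P unfolding projective_module_def by blast
  note s = lhom_lin [OF sp(1)] and p = lhom_lin [OF sp(2)]
  have "ring R" using B by (simp add: left_module_def)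
  from free_module_lift [OF this B C q surj lin_comp [OF p h]]
  obtain g where g: "lin R (free_module R I) B g"
    "\<And>x. x \<in> carrier (free_module R I) \<Longrightarrow> q (g x) = h (p x)" by blast
  show thesis
    by (rule that [OF lin_comp [OF s g(1)]]) (simp add: g(2) lin_closed [OF s] sp(3))
qed

lemma free_module_chain:
  fixes n :: nat and N :: "nat \<Rightarrow> 'm set"
  assumes M: "left_module R M" and N: "\<And>i. submod R (N i) M"
    and mono: "\<And>i j. i \<le> j \<Longrightarrow> N i \<subseteq> N j"
    and \<phi>: "lin R (free_module R {..<n}) M \<phi>"
    and cover: "\<And>x. x \<in> carrier (free_module R {..<n}) \<Longrightarrow> \<exists>i. \<phi> x \<in> N i"
  shows "\<exists>i. \<forall>x\<in>carrier (free_module R {..<n}). \<phi> x \<in> N i"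
proof -
  have R: "ring R" using M by (simp add: left_module_def)
  let ?F = "free_module R {..<n}"
  let ?e = "unit_vec R {..<n}"
  have "\<exists>i. \<phi> (?e k) \<in> N i" if "k < n" for k
    using cover unit_vec_closed [OF R, of k "{..<n}"] that by auto
  then obtain i where i: "\<And>k. k < n \<Longrightarrow> \<phi> (?e k) \<in> N (i k)" by metis
  define m where "m = Max (insert 0 (i ` {..<n}))"
  have "\<phi> (?e k) \<in> N m" if "k < n" for k
    using i [OF that] mono [of "i k" m] that by (auto simp: m_def)
  then have "x \<in> {x \<in> carrier ?F. \<phi> x \<in> N m}" if "x \<in> carrier ?F" for x
    by (intro free_module_generated [OF R submod_vimage [OF free_module_left_module [OF R] M \<phi> N] _ that])
      (auto intro: unit_vec_closed [OF R])
  then show ?thesis by blast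
qed

lemma free_module_finite_support:
  fixes n :: nat and M :: "'k \<Rightarrow> ('r, 'm) module"
  assumes R: "ring R" and M: "\<And>k. k \<in> K \<Longrightarrow> left_module R (M k)"
    and \<phi>: "lin R (free_module R {..<n}) (direct_sum K M) \<phi>"
  obtains A where "finite A" "A \<subseteq> K"
    "\<And>x k. \<lbrakk>x \<in> carrier (free_module R {..<n}); k \<in> K - A\<rbrakk> \<Longrightarrow> \<phi> x k = \<zero>\<^bsub>M k\<^esub>"
proof -
  let ?F = "free_module R {..<n}"
  let ?e = "unit_vec R {..<n}"
  define A where "A = (\<Union>i<n. {k\<in>K. \<phi> (?e i) k \<noteq> \<zero>\<^bsub>M k\<^esub>})"
  have "finite A"
    unfolding A_def
  proof (intro finite_UN_I finite_lessThan)
    fix i assume "i \<in> {..<n}"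
    then show "finite {k\<in>K. \<phi> (?e i) k \<noteq> \<zero>\<^bsub>M k\<^esub>}"
      using direct_sum_finite [OF lin_closed [OF \<phi> unit_vec_closed [OF R]]] by blast
  qed
  moreover have "\<phi> x k = \<zero>\<^bsub>M k\<^esub>" if x: "x \<in> carrier ?F" and k: "k \<in> K - A" for x k
  proof -
    have kK: "k \<in> K" using k by blast
    have "x \<in> {x \<in> carrier ?F. \<phi> x k = \<zero>\<^bsub>M k\<^esub>}"
    proof (rule free_module_generated [OF R submod_ker [OF free_module_left_module [OF R] M [OF kK]
          lin_comp [OF \<phi> lin_component [OF kK]]] _ x])
      fix i assume i: "i \<in> {..<n}"
      then show "?e i \<in> {x \<in> carrier ?F. \<phi> x k = \<zero>\<^bsub>M k\<^esub>}"
        using unit_vec_closed [OF R i] k by (auto simp: A_def)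
    qed
    then show ?thesis by blast
  qed
  moreover have "A \<subseteq> K" by (auto simp: A_def)
  ultimately show thesis using that by blast
qed

section \<open>Extensions\<close>

lemma short_exactD:
  assumes "short_exact R A f B g C"
  shows "left_module R A" "left_module R B" "left_module R C" "lin R A B f" "lin R B C g"
    "inj_on f (carrier A)" "g ` carrier B = carrier C"
    "\<And>a. a \<in> carrier A \<Longrightarrow> f a = \<zero>\<^bsub>B\<^esub> \<Longrightarrow> a = \<zero>\<^bsub>A\<^esub>"
    "\<And>a. a \<in> carrier A \<Longrightarrow> g (f a) = \<zero>\<^bsub>C\<^esub>"
    "\<And>b. b \<in> carrier B \<Longrightarrow> g b = \<zero>\<^bsub>C\<^esub> \<Longrightarrow> \<exists>a\<in>carrier A. f a = b"
    "\<And>c. c \<in> carrier C \<Longrightarrow> \<exists>b\<in>carrier B. g b = c"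
proof -
  show l: "left_module R A" "left_module R B" "left_module R C" "lin R A B f" "lin R B C g"
    "inj_on f (carrier A)" "g ` carrier B = carrier C"
    using assms by (auto simp: short_exact_def lhom_lin)
  show "a = \<zero>\<^bsub>A\<^esub>" if "a \<in> carrier A" "f a = \<zero>\<^bsub>B\<^esub>" for a
    using lin_inj_iff [OF l(1,2,4)] l(6) that by blast
  have k: "f ` carrier A = {b \<in> carrier B. g b = \<zero>\<^bsub>C\<^esub>}" using assms by (simp add: short_exact_def)
  then show "g (f a) = \<zero>\<^bsub>C\<^esub>" if "a \<in> carrier A" for a using that by blast
  show "\<exists>a\<in>carrier A. f a = b" if "b \<in> carrier B" "g b = \<zero>\<^bsub>C\<^esub>" for b
    using k that by (metis (mono_tags, lifting) imageE mem_Collect_eq)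
  show "\<exists>b\<in>carrier B. g b = c" if "c \<in> carrier C" for c
    using l(7) that by (metis imageE)
qed

lemma short_exactI:
  assumes A: "left_module R A" and B: "left_module R B" and C: "left_module R C"
    and f: "lin R A B f" and fe: "f \<in> extensional (carrier A)"
    and g: "lin R B C g" and ge: "g \<in> extensional (carrier B)"
    and inj: "\<And>a. a \<in> carrier A \<Longrightarrow> f a = \<zero>\<^bsub>B\<^esub> \<Longrightarrow> a = \<zero>\<^bsub>A\<^esub>"
    and gf: "\<And>a. a \<in> carrier A \<Longrightarrow> g (f a) = \<zero>\<^bsub>C\<^esub>"
    and ker: "\<And>b. b \<in> carrier B \<Longrightarrow> g b = \<zero>\<^bsub>C\<^esub> \<Longrightarrow> \<exists>a\<in>carrier A. f a = b"
    and surj: "\<And>c. c \<in> carrier C \<Longrightarrow> \<exists>b\<in>carrier B. g b = c"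
  shows "short_exact R A f B g C"
  unfolding short_exact_def
proof (intro conjI)
  show "f ` carrier A = {b \<in> carrier B. g b = \<zero>\<^bsub>C\<^esub>}"
    using ker gf lin_closed [OF f] by (fastforce simp: image_iff)
  show "g ` carrier B = carrier C" using surj lin_closed [OF g] by (fastforce simp: image_iff)
  show "inj_on f (carrier A)" using inj lin_inj_iff [OF A B f] by blast
qed (use assms in \<open>simp_all add: lhom_iff\<close>)

lemma is_extnD:
  assumes "is_extn R X Y E"
  shows "left_module R Y" "left_module R (mid E)" "left_module R X" "lin R Y (mid E) (incl E)"
    "lin R (mid E) X (proj E)" "inj_on (incl E) (carrier Y)" "proj E ` carrier (mid E) = carrier X"
    "\<And>a. a \<in> carrier Y \<Longrightarrow> incl E a = \<zero>\<^bsub>mid E\<^esub> \<Longrightarrow> a = \<zero>\<^bsub>Y\<^esub>"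
    "\<And>a. a \<in> carrier Y \<Longrightarrow> proj E (incl E a) = \<zero>\<^bsub>X\<^esub>"
    "\<And>b. b \<in> carrier (mid E) \<Longrightarrow> proj E b = \<zero>\<^bsub>X\<^esub> \<Longrightarrow> \<exists>a\<in>carrier Y. incl E a = b"
    "\<And>c. c \<in> carrier X \<Longrightarrow> \<exists>b\<in>carrier (mid E). proj E b = c"
  using short_exactD [OF assms [unfolded is_extn_def]] by blast+

text \<open>The middle term is the push-out of \<open>A\<close> and \<open>Y\<close> for any lift \<open>g\<close> of a surjection \<open>A \<rightarrow> X\<close>.\<close>

lemma extn_glue:
  assumes E: "is_extn R X Y E" and A: "left_module R A" and Z: "left_module R Z"
    and g: "lin R A (mid E) g" and surj: "(\<lambda>a. proj E (g a)) ` carrier A = carrier X"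
    and a: "lin R A Z a" and b: "lin R Y Z b"
    and compat: "\<And>x y. \<lbrakk>x \<in> carrier A; y \<in> carrier Y; g x = incl E y\<rbrakk> \<Longrightarrow> a x = b y"
  obtains c where "lin R (mid E) Z c" "\<And>x. x \<in> carrier A \<Longrightarrow> c (g x) = a x"
    "\<And>y. y \<in> carrier Y \<Longrightarrow> c (incl E y) = b y"
proof -
  note E' = is_extnD [OF E]
  interpret M: left_module R "mid E" by (rule E')
  interpret Y: left_module R Y by (rule E')
  interpret X: left_module R X by (rule E')
  interpret Z: left_module R Z by (rule Z)
  interpret A: left_module R A by (rule A)
  let ?P = "prod_module A Y"
  let ?q = "\<lambda>p. g (fst p) \<oplus>\<^bsub>mid E\<^esub> incl E (snd p)"
  let ?h = "\<lambda>p. a (fst p) \<oplus>\<^bsub>Z\<^esub> b (snd p)"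
  have P: "left_module R ?P" by (rule prod_module_left_module [OF A E'(1)])
  have q: "lin R ?P (mid E) ?q"
    by (rule lin_plus [OF P E'(2) lin_comp [OF lin_fst g] lin_comp [OF lin_snd E'(4)]])
  have h: "lin R ?P Z ?h"
    by (rule lin_plus [OF P Z lin_comp [OF lin_fst a] lin_comp [OF lin_snd b]])
  have surj': "?q ` carrier ?P = carrier (mid E)"
  proof (intro equalityI subsetI)
    fix m assume "m \<in> ?q ` carrier ?P" then show "m \<in> carrier (mid E)" using lin_closed [OF q] by blast
  next
    fix m assume m: "m \<in> carrier (mid E)"
    then have "proj E m \<in> (\<lambda>a. proj E (g a)) ` carrier A" using lin_closed [OF E'(5)] surj by simp
    then obtain x where x: "x \<in> carrier A" "proj E m = proj E (g x)" by auto
    note gx = lin_closed [OF g x(1)]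
    have "proj E (m \<ominus>\<^bsub>mid E\<^esub> g x) = \<zero>\<^bsub>X\<^esub>"
      using x m gx lin_closed [OF E'(5) gx] by (simp add: lin_diff [OF E'(2,3,5)])
    then obtain y where y: "y \<in> carrier Y" "incl E y = m \<ominus>\<^bsub>mid E\<^esub> g x"
      using E'(10) m gx by (metis M.M.minus_closed)
    have "?q (x, y) = m" using y x m gx M.M.a_comm [OF gx, of "m \<ominus>\<^bsub>mid E\<^esub> g x"] by simp
    then show "m \<in> ?q ` carrier ?P" using x y by (intro image_eqI [where x = "(x, y)"]) simp_all
  qed
  have ker: "?h p = \<zero>\<^bsub>Z\<^esub>" if p: "p \<in> carrier ?P" "?q p = \<zero>\<^bsub>mid E\<^esub>" for p
  proof -
    obtain x y where xy: "p = (x, y)" "x \<in> carrier A" "y \<in> carrier Y" using p(1) by auto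
    have "incl E y \<oplus>\<^bsub>mid E\<^esub> g x = \<zero>\<^bsub>mid E\<^esub>"
      using p(2) xy lin_closed [OF g] lin_closed [OF E'(4)] by (simp add: M.M.a_comm)
    then have "\<ominus>\<^bsub>mid E\<^esub> g x = incl E y"
      using xy lin_closed [OF g] lin_closed [OF E'(4)] by (intro M.M.minus_equality) auto
    then have "g (\<ominus>\<^bsub>A\<^esub> x) = incl E y" using xy by (simp add: lin_minus [OF A E'(2) g])
    then have "a (\<ominus>\<^bsub>A\<^esub> x) = b y" using compat xy by simp
    then have "\<ominus>\<^bsub>Z\<^esub> a x = b y" using xy by (simp add: lin_minus [OF A Z a])
    then show ?thesis using xy lin_closed [OF a xy(2)] by (metis Z.M.r_neg fst_conv snd_conv)
  qed
  from lin_factor [OF P E'(2) Z q surj' h ker] obtain c where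
    c: "lin R (mid E) Z c" "\<And>p. p \<in> carrier ?P \<Longrightarrow> c (?q p) = ?h p" by blast
  show thesis
  proof (rule that [OF c(1)])
    fix x assume x: "x \<in> carrier A"
    then show "c (g x) = a x"
      using c(2) [of "(x, \<zero>\<^bsub>Y\<^esub>)"] lin_zero [OF E'(1,2,4)] lin_zero [OF E'(1) Z b]
        lin_closed [OF g x] lin_closed [OF a x] by simp
  next
    fix y assume y: "y \<in> carrier Y"
    then show "c (incl E y) = b y"
      using c(2) [of "(\<zero>\<^bsub>A\<^esub>, y)"] lin_zero [OF A E'(2) g] lin_zero [OF A Z a]
        lin_closed [OF E'(4) y] lin_closed [OF b y] by simp
  qed
qed

lemma short_five:
  assumes E: "is_extn R X Y E" and E': "is_extn R X Y E'"
    and c: "lin R (mid E) (mid E') c"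
    and ci: "\<And>y. y \<in> carrier Y \<Longrightarrow> c (incl E y) = incl E' y"
    and cp: "\<And>e. e \<in> carrier (mid E) \<Longrightarrow> proj E' (c e) = proj E e"
  shows "equiv_extn R Y E E'"
proof -
  note D = is_extnD [OF E]
  note D' = is_extnD [OF E']
  interpret M: left_module R "mid E" by (rule D)
  interpret M': left_module R "mid E'" by (rule D')
  interpret X: left_module R X by (rule D)
  have "bij_betw c (carrier (mid E)) (carrier (mid E'))"
    unfolding bij_betw_def
  proof
    show "inj_on c (carrier (mid E))"
      unfolding lin_inj_iff [OF D(2) D'(2) c]
    proof (intro ballI impI)
      fix e assume e: "e \<in> carrier (mid E)" "c e = \<zero>\<^bsub>mid E'\<^esub>"
      then have "proj E e = \<zero>\<^bsub>X\<^esub>" using cp [OF e(1)] lin_zero [OF D'(2,3,5)] by simp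
      then obtain y where y: "y \<in> carrier Y" "incl E y = e" using D(10) e by blast
      then show "e = \<zero>\<^bsub>mid E\<^esub>" using ci e D'(8) lin_zero [OF D(1,2,4)] by metis
    qed
    show "c ` carrier (mid E) = carrier (mid E')"
    proof (intro equalityI subsetI)
      fix m assume "m \<in> c ` carrier (mid E)" then show "m \<in> carrier (mid E')" using lin_closed [OF c] by blast
    next
      fix m assume m: "m \<in> carrier (mid E')"
      obtain e where e: "e \<in> carrier (mid E)" "proj E e = proj E' m"
        using D(11) lin_closed [OF D'(5) m] by metis
      note ce = lin_closed [OF c e(1)]
      have "proj E' (m \<ominus>\<^bsub>mid E'\<^esub> c e) = \<zero>\<^bsub>X\<^esub>"
        using m ce e cp [OF e(1)] lin_closed [OF D'(5) m] by (simp add: lin_diff [OF D'(2,3,5)])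
      then obtain y where y: "y \<in> carrier Y" "incl E' y = m \<ominus>\<^bsub>mid E'\<^esub> c e"
        using D'(10) m ce by (metis M'.M.minus_closed)
      have "c (incl E y \<oplus>\<^bsub>mid E\<^esub> e) = m"
        using y m ce e lin_closed [OF D(4) y(1)] by (simp add: lin_add [OF c] ci)
      then show "m \<in> c ` carrier (mid E)" using e lin_closed [OF D(4) y(1)] by (metis M.M.a_closed imageI)
    qed
  qed
  then have "restrict c (carrier (mid E)) \<in> liso R (mid E) (mid E')"
    using lin_restrict [OF D(2) c] by (simp add: liso_def bij_betw_restrict_eq)
  then show ?thesis
    unfolding equiv_extn_def using ci cp lin_closed [OF D(4)] by (intro bexI) auto
qed

lemma lin_through_surj:
  assumes P: "left_module R P" and \<kappa>: "lin R P Q \<kappa>" "\<kappa> ` carrier P = carrier Q"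
    and h: "lin R P X (\<lambda>p. h (\<kappa> p))"
  shows "lin R Q X h"
proof -
  interpret P: left_module R P by (rule P)
  have ex: "\<exists>p\<in>carrier P. x = \<kappa> p" if "x \<in> carrier Q" for x using \<kappa>(2) that by auto
  show ?thesis
  proof (rule linI)
    fix x assume "x \<in> carrier Q"
    then show "h x \<in> carrier X" using ex lin_closed [OF h] by metis
  next
    fix x y assume "x \<in> carrier Q" "y \<in> carrier Q"
    then obtain p q where "p \<in> carrier P" "q \<in> carrier P" "x = \<kappa> p" "y = \<kappa> q" using ex by metis
    then show "h (x \<oplus>\<^bsub>Q\<^esub> y) = h x \<oplus>\<^bsub>X\<^esub> h y" using lin_add [OF \<kappa>(1), of p q] lin_add [OF h, of p q] by simp
  next
    fix r x assume r: "r \<in> carrier R" and "x \<in> carrier Q"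
    then obtain p where "p \<in> carrier P" "x = \<kappa> p" using ex by metis
    then show "h (r \<odot>\<^bsub>Q\<^esub> x) = r \<odot>\<^bsub>X\<^esub> h x" using lin_smult [OF \<kappa>(1) r, of p] lin_smult [OF h r, of p] by simp
  qed
qed

lemma is_extn_pushout:
  assumes E: "is_extn R X Y E" and Z: "left_module R Z" and g: "lin R Y Z g"
  defines "PO \<equiv> pushout_extn Y Z g E"
  obtains a where "is_extn R X Z PO" "lin R (mid E) (mid PO) a"
    "\<And>y. y \<in> carrier Y \<Longrightarrow> a (incl E y) = incl PO (g y)"
    "\<And>e. e \<in> carrier (mid E) \<Longrightarrow> proj PO (a e) = proj E e"
proof -
  note D = is_extnD [OF E]
  interpret M: left_module R "mid E" by (rule D)
  interpret Y: left_module R Y by (rule D)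
  interpret X: left_module R X by (rule D)
  interpret Z: left_module R Z by (rule Z)
  define P where "P = prod_module (mid E) Z"
  have P: "left_module R P" unfolding P_def by (rule prod_module_left_module [OF D(2) Z])
  interpret P: left_module R P by (rule P)
  define N where "N = {(incl E y, \<ominus>\<^bsub>Z\<^esub> g y) | y. y \<in> carrier Y}"
  have N_im: "N = (\<lambda>y. (incl E y, \<zero>\<^bsub>Z\<^esub> \<ominus>\<^bsub>Z\<^esub> g y)) ` carrier Y"
    using lin_closed [OF g] by (auto simp: N_def a_minus_def)
  have N: "submod R N P"
    unfolding N_im P_def
    by (rule submod_image [OF D(1) P [unfolded P_def] _ submod_carrier [OF D(1)]])
      (intro lin_pair D(4) lin_minus_fun D(1) Z lin_const_zero g)
  define \<kappa> where "\<kappa> p = N +>\<^bsub>P\<^esub> p" for p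
  define Q where "Q = quotient_module P N"
  have \<kappa>: "lin R P Q \<kappa>" "\<kappa> ` carrier P = carrier Q" "left_module R Q"
    using quotient_coset_map [OF P N] by (simp_all add: \<kappa>_def [abs_def] Q_def)
  have \<kappa>_eq: "\<kappa> p = \<kappa> q \<longleftrightarrow> p \<ominus>\<^bsub>P\<^esub> q \<in> N" if "p \<in> carrier P" "q \<in> carrier P" for p q
    unfolding \<kappa>_def by (rule coset_eq_iff [OF P N that])
  have Pm: "(x, y) \<in> carrier P \<longleftrightarrow> x \<in> carrier (mid E) \<and> y \<in> carrier Z" for x y by (simp add: P_def)
  have Q0: "\<kappa> p = \<zero>\<^bsub>Q\<^esub> \<longleftrightarrow> p \<in> N" if "p \<in> carrier P" for p
    unfolding \<kappa>_def Q_def using coset_eq_zero_iff [OF P N that] by simp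
  have mid: "mid PO = Q" by (simp add: PO_def pushout_extn_def Let_def Q_def P_def N_def)
  have incl: "incl PO z = \<kappa> (\<zero>\<^bsub>mid E\<^esub>, z)" if "z \<in> carrier Z" for z
    using that by (simp add: PO_def pushout_extn_def Let_def \<kappa>_def P_def N_def)
  have incl_ext: "incl PO \<in> extensional (carrier Z)" by (simp add: PO_def pushout_extn_def Let_def)
  have proj_ext: "proj PO \<in> extensional (carrier Q)"
    by (simp add: PO_def pushout_extn_def Let_def Q_def P_def N_def)
  have proj: "proj PO (\<kappa> p) = proj E (fst p)" if p: "p \<in> carrier P" for p
  proof -
    obtain e z where ez: "p = (e, z)" "e \<in> carrier (mid E)" "z \<in> carrier Z"
      using p by (cases p) (simp add: P_def)
    have "\<kappa> p \<in> carrier Q" using lin_closed [OF \<kappa>(1) p] .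
    then have "proj PO (\<kappa> p) = the_elem ((\<lambda>p. proj E (fst p)) ` \<kappa> p)"
      by (simp add: PO_def pushout_extn_def Let_def Q_def P_def N_def)
    also have "(\<lambda>p. proj E (fst p)) ` \<kappa> p = {proj E e}"
    proof -
      have "\<kappa> p = (\<lambda>y. (incl E y \<oplus>\<^bsub>mid E\<^esub> e, (\<ominus>\<^bsub>Z\<^esub> g y) \<oplus>\<^bsub>Z\<^esub> z)) ` carrier Y"
        by (auto simp: \<kappa>_def a_r_coset_def' N_def P_def ez(1))
      moreover have "proj E (incl E y \<oplus>\<^bsub>mid E\<^esub> e) = proj E e" if "y \<in> carrier Y" for y
        using that ez lin_closed [OF D(4) that] lin_closed [OF D(5) ez(2)] by (simp add: lin_add [OF D(5)] D(9))
      ultimately show ?thesis using Y.M.zero_closed by (auto simp: image_iff intro!: exI [of _ "\<zero>\<^bsub>Y\<^esub>"])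
    qed
    finally show ?thesis by (simp add: ez)
  qed
  have \<kappa>i: "\<kappa> (incl E y, z) = \<kappa> (\<zero>\<^bsub>mid E\<^esub>, z \<oplus>\<^bsub>Z\<^esub> g y)" if y: "y \<in> carrier Y" and z: "z \<in> carrier Z" for y z
  proof -
    note iy = lin_closed [OF D(4) y] and gy = lin_closed [OF g y]
    have "(incl E y, z) \<ominus>\<^bsub>P\<^esub> (\<zero>\<^bsub>mid E\<^esub>, z \<oplus>\<^bsub>Z\<^esub> g y) = (incl E y, z \<ominus>\<^bsub>Z\<^esub> (z \<oplus>\<^bsub>Z\<^esub> g y))"
      unfolding P_def using prod_module_minus [OF D(2) Z, of "\<zero>\<^bsub>mid E\<^esub>" "z \<oplus>\<^bsub>Z\<^esub> g y"] iy gy z by simp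
    also have "z \<ominus>\<^bsub>Z\<^esub> (z \<oplus>\<^bsub>Z\<^esub> g y) = \<ominus>\<^bsub>Z\<^esub> g y"
      using z gy Z.M.add_diff_add [of z "\<zero>\<^bsub>Z\<^esub>" z "g y"] by (simp add: a_minus_def Z.M.r_neg)
    finally have "(incl E y, z) \<ominus>\<^bsub>P\<^esub> (\<zero>\<^bsub>mid E\<^esub>, z \<oplus>\<^bsub>Z\<^esub> g y) \<in> N" using y by (auto simp: N_def)
    then show ?thesis using \<kappa>_eq iy gy z by (simp add: Pm)
  qed
  have emb: "lin R (mid E) P (\<lambda>e. (e, \<zero>\<^bsub>Z\<^esub>))" "lin R Z P (\<lambda>z. (\<zero>\<^bsub>mid E\<^esub>, z))"
    unfolding P_def by (intro lin_pair lin_id lin_const_zero D(2) Z)+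
  show thesis
  proof (rule that)
    show "lin R (mid E) (mid PO) (\<lambda>e. \<kappa> (e, \<zero>\<^bsub>Z\<^esub>))"
      unfolding mid by (rule lin_comp [OF emb(1) \<kappa>(1)])
    show "\<kappa> (incl E y, \<zero>\<^bsub>Z\<^esub>) = incl PO (g y)" if "y \<in> carrier Y" for y
      using \<kappa>i [OF that, of "\<zero>\<^bsub>Z\<^esub>"] lin_closed [OF g that] incl by simp
    show "proj PO (\<kappa> (e, \<zero>\<^bsub>Z\<^esub>)) = proj E e" if "e \<in> carrier (mid E)" for e
      using proj [of "(e, \<zero>\<^bsub>Z\<^esub>)"] that by (simp add: Pm)
    show "is_extn R X Z PO"
      unfolding is_extn_def mid
    proof (rule short_exactI)
      show "lin R Z Q (incl PO)"
        by (rule lin_congI [OF lin_comp [OF emb(2) \<kappa>(1)] Z incl])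
      have "lin R P X (\<lambda>p. proj E (fst p))"
        unfolding P_def by (rule lin_comp [OF lin_fst D(5)])
      then have "lin R P X (\<lambda>p. proj PO (\<kappa> p))" by (rule lin_congI [OF _ P proj])
      then show "lin R Q X (proj PO)" by (rule lin_through_surj [OF P \<kappa>(1,2)])
      fix z assume z: "z \<in> carrier Z"
      show "proj PO (incl PO z) = \<zero>\<^bsub>X\<^esub>"
        using proj [of "(\<zero>\<^bsub>mid E\<^esub>, z)"] z lin_zero [OF D(2,3,5)] by (simp add: incl Pm)
      assume "incl PO z = \<zero>\<^bsub>Q\<^esub>"
      then have "(\<zero>\<^bsub>mid E\<^esub>, z) \<in> N" using z Q0 by (simp add: incl Pm)
      then obtain y where y: "y \<in> carrier Y" "incl E y = \<zero>\<^bsub>mid E\<^esub>" "z = \<ominus>\<^bsub>Z\<^esub> g y" by (auto simp: N_def)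
      then have "y = \<zero>\<^bsub>Y\<^esub>" using D(8) by blast
      then show "z = \<zero>\<^bsub>Z\<^esub>" using y lin_zero [OF D(1) Z g] by simp
    next
      fix q assume "q \<in> carrier Q" and q0: "proj PO q = \<zero>\<^bsub>X\<^esub>"
      then obtain p where p: "p \<in> carrier P" "q = \<kappa> p" using \<kappa>(2) by (metis imageE)
      then obtain e z where ez: "q = \<kappa> (e, z)" "e \<in> carrier (mid E)" "z \<in> carrier Z"
        by (cases p) (simp add: Pm)
      then have "proj E e = \<zero>\<^bsub>X\<^esub>" using proj [of "(e, z)"] q0 by (simp add: Pm)
      then obtain y where y: "y \<in> carrier Y" "incl E y = e" using D(10) ez by blast
      then show "\<exists>z\<in>carrier Z. incl PO z = q"
        using \<kappa>i [OF y(1) ez(3)] ez lin_closed [OF g y(1)] incl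
        by (intro bexI [of _ "z \<oplus>\<^bsub>Z\<^esub> g y"]) simp_all
    next
      fix x assume "x \<in> carrier X"
      then obtain e where e: "e \<in> carrier (mid E)" "proj E e = x" using D(11) by blast
      then show "\<exists>q\<in>carrier Q. proj PO q = x"
        using proj [of "(e, \<zero>\<^bsub>Z\<^esub>)"] lin_closed [OF \<kappa>(1), of "(e, \<zero>\<^bsub>Z\<^esub>)"]
        by (intro bexI [of _ "\<kappa> (e, \<zero>\<^bsub>Z\<^esub>)"]) (simp_all add: Pm)
    qed (use Z D \<kappa>(3) incl_ext proj_ext in auto)
  qed
qed

lemma pullback_extn_simps:
  "carrier (mid (pullback_extn Y Z f E)) = {(e, z). e \<in> carrier (mid E) \<and> z \<in> carrier Z \<and> proj E e = f z}"
  "y \<in> carrier Y \<Longrightarrow> incl (pullback_extn Y Z f E) y = (incl E y, \<zero>\<^bsub>Z\<^esub>)"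
  "p \<in> carrier (mid (pullback_extn Y Z f E)) \<Longrightarrow> proj (pullback_extn Y Z f E) p = snd p"
  by (simp_all add: pullback_extn_def Let_def)

lemma mid_pullback_extn:
  "mid (pullback_extn Y Z f E) =
     (prod_module (mid E) Z)\<lparr>carrier := {p \<in> carrier (prod_module (mid E) Z). proj E (fst p) = f (snd p)}\<rparr>"
  by (auto simp: pullback_extn_def Let_def intro!: arg_cong [where f = "\<lambda>c. (prod_module (mid E) Z)\<lparr>carrier := c\<rparr>"])

lemma pullback_extn_submod:
  assumes E: "is_extn R X Y E" and Z: "left_module R Z" and f: "lin R Z X f"
  shows "submod R {p \<in> carrier (prod_module (mid E) Z). proj E (fst p) = f (snd p)} (prod_module (mid E) Z)"
  using is_extnD [OF E]
  by (intro submod_eq [OF prod_module_left_module [OF _ Z] _ lin_comp [OF lin_fst] lin_comp [OF lin_snd f]]) auto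

lemma is_extn_pullback:
  assumes E: "is_extn R X Y E" and Z: "left_module R Z" and f: "lin R Z X f"
  shows "is_extn R Z Y (pullback_extn Y Z f E)"
proof -
  note D = is_extnD [OF E]
  interpret M: left_module R "mid E" by (rule D)
  interpret Y: left_module R Y by (rule D)
  interpret X: left_module R X by (rule D)
  interpret Z: left_module R Z by (rule Z)
  define PB where "PB = pullback_extn Y Z f E"
  let ?P = "prod_module (mid E) Z"
  let ?C = "{p \<in> carrier ?P. proj E (fst p) = f (snd p)}"
  have P: "left_module R ?P" by (rule prod_module_left_module [OF D(2) Z])
  have C: "submod R ?C ?P" by (rule pullback_extn_submod [OF E Z f])
  have mid: "mid PB = ?P\<lparr>carrier := ?C\<rparr>" by (simp add: PB_def mid_pullback_extn)
  have cM: "left_module R (mid PB)" unfolding mid by (rule submod_left_module [OF P C])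
  have cC: "carrier (mid PB) = ?C" by (simp add: mid)
  have z: "\<zero>\<^bsub>mid PB\<^esub> = (\<zero>\<^bsub>mid E\<^esub>, \<zero>\<^bsub>Z\<^esub>)" by (simp add: mid)
  note s = pullback_extn_simps [where Y = Y and Z = Z and f = f and E = E, folded PB_def]
  have f0: "f \<zero>\<^bsub>Z\<^esub> = \<zero>\<^bsub>X\<^esub>" by (rule lin_zero [OF Z D(3) f])
  show ?thesis
    unfolding PB_def [symmetric] is_extn_def
  proof (rule short_exactI)
    have "lin R Y (mid PB) (\<lambda>y. (incl E y, \<zero>\<^bsub>Z\<^esub>))"
      unfolding mid
      by (rule lin_submod_cod [OF lin_pair [OF D(4) lin_const_zero [OF D(1) Z]]])
        (auto simp: D(9) f0 lin_closed [OF D(4)])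
    then show "lin R Y (mid PB) (incl PB)" by (rule lin_congI [OF _ D(1) s(2)])
    have "lin R (mid PB) Z snd" unfolding mid by (rule lin_submod_dom [OF C lin_snd])
    then show "lin R (mid PB) Z (proj PB)" by (rule lin_congI [OF _ cM s(3)])
    show "incl PB \<in> extensional (carrier Y)" "proj PB \<in> extensional (carrier (mid PB))"
      by (simp_all add: PB_def pullback_extn_def Let_def)
    show "a = \<zero>\<^bsub>Y\<^esub>" if "a \<in> carrier Y" "incl PB a = \<zero>\<^bsub>mid PB\<^esub>" for a
      using that D(8) by (simp add: s z)
    show "proj PB (incl PB a) = \<zero>\<^bsub>Z\<^esub>" if "a \<in> carrier Y" for a
      using that s(3) [of "(incl E a, \<zero>\<^bsub>Z\<^esub>)"] lin_closed [OF D(4) that] by (simp add: s(1,2) D(9) f0)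
    show "\<exists>a\<in>carrier Y. incl PB a = b" if b: "b \<in> carrier (mid PB)" "proj PB b = \<zero>\<^bsub>Z\<^esub>" for b
    proof -
      have "snd b = \<zero>\<^bsub>Z\<^esub>" using s(3) b by simp
      then obtain e where e: "b = (e, \<zero>\<^bsub>Z\<^esub>)" "e \<in> carrier (mid E)" "proj E e = \<zero>\<^bsub>X\<^esub>"
        using b(1) by (cases b) (simp add: cC f0)
      then show ?thesis using D(10) s(2) by metis
    qed
    show "\<exists>b\<in>carrier (mid PB). proj PB b = c" if c: "c \<in> carrier Z" for c
    proof -
      obtain e where e: "e \<in> carrier (mid E)" "proj E e = f c" using D(11) lin_closed [OF f c] by blast
      then have "(e, c) \<in> carrier (mid PB)" using c by (simp add: cC)
      then show ?thesis using s(3) by force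
    qed
  qed (rule D Z cM)+
qed

lemma sum_extn_simps:
  "mid (sum_extn K Y E) = direct_sum K (\<lambda>k. mid (E k))"
  "y \<in> carrier (direct_sum K Y) \<Longrightarrow> incl (sum_extn K Y E) y = (\<lambda>k\<in>K. incl (E k) (y k))"
  "e \<in> carrier (direct_sum K (\<lambda>k. mid (E k))) \<Longrightarrow> proj (sum_extn K Y E) e = (\<lambda>k\<in>K. proj (E k) (e k))"
  by (simp_all add: sum_extn_def)

lemma lin_direct_sum_map:
  assumes R: "ring R" and M: "\<And>k. k \<in> K \<Longrightarrow> left_module R (M k)"
    and N: "\<And>k. k \<in> K \<Longrightarrow> left_module R (N k)" and f: "\<And>k. k \<in> K \<Longrightarrow> lin R (M k) (N k) (f k)"
  shows "lin R (direct_sum K M) (direct_sum K N) (\<lambda>x. \<lambda>k\<in>K. f k (x k))"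
proof (rule lin_direct_sumI [OF R N])
  fix x assume x: "x \<in> carrier (direct_sum K M)"
  show "(\<lambda>k\<in>K. f k (x k)) \<in> carrier (direct_sum K N)"
  proof (rule direct_sumI [OF R N _ _ direct_sum_finite [OF x]])
    fix k assume k: "k \<in> K"
    show "(\<lambda>k\<in>K. f k (x k)) k \<in> carrier (N k)"
      using k lin_closed [OF f [OF k] direct_sum_component [OF x k]] by simp
    show "(\<lambda>k\<in>K. f k (x k)) k = \<zero>\<^bsub>N k\<^esub>" if "k \<notin> {k\<in>K. x k \<noteq> \<zero>\<^bsub>M k\<^esub>}"
      using k that lin_zero [OF M [OF k] N [OF k] f [OF k]] by simp
  qed simp_all
next
  fix k assume k: "k \<in> K"
  then show "lin R (direct_sum K M) (N k) (\<lambda>x. (\<lambda>k\<in>K. f k (x k)) k)"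
    using lin_comp [OF lin_component [OF k, of R M] f [OF k]] by simp
qed (use direct_sum_left_module [OF R M] in auto)

lemma is_extn_sum:
  assumes R: "ring R" and E: "\<And>k. k \<in> K \<Longrightarrow> is_extn R (X k) (Y k) (E k)"
  shows "is_extn R (direct_sum K X) (direct_sum K Y) (sum_extn K Y E)"
proof -
  note D = is_extnD [OF E]
  let ?S = "sum_extn K Y E"
  let ?M = "\<lambda>k. mid (E k)"
  have Y: "left_module R (direct_sum K Y)" by (rule direct_sum_left_module [OF R D(1)])
  have X: "left_module R (direct_sum K X)" by (rule direct_sum_left_module [OF R D(3)])
  have M: "left_module R (direct_sum K ?M)" by (rule direct_sum_left_module [OF R D(2)])
  have i: "lin R (direct_sum K Y) (direct_sum K ?M) (incl ?S)"
    by (rule lin_congI [OF lin_direct_sum_map [OF R D(1) D(2) D(4)] Y sum_extn_simps(2)])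
  have p: "lin R (direct_sum K ?M) (direct_sum K X) (proj ?S)"
    by (rule lin_congI [OF lin_direct_sum_map [OF R D(2) D(3) D(5)] M sum_extn_simps(3)])
  show ?thesis
    unfolding is_extn_def sum_extn_simps(1)
  proof (rule short_exactI [OF Y M X i _ p])
    show "incl ?S \<in> extensional (carrier (direct_sum K Y))"
      "proj ?S \<in> extensional (carrier (direct_sum K ?M))"
      by (simp_all add: sum_extn_def)
    fix y assume y: "y \<in> carrier (direct_sum K Y)"
    show "proj ?S (incl ?S y) = \<zero>\<^bsub>direct_sum K X\<^esub>"
      using lin_closed [OF i y] D(9) direct_sum_component [OF y]
      by (auto simp: sum_extn_simps y fun_eq_iff)
    assume "incl ?S y = \<zero>\<^bsub>direct_sum K ?M\<^esub>"
    then have "incl (E k) (y k) = \<zero>\<^bsub>mid (E k)\<^esub>" if "k \<in> K" for k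
      using that by (simp add: sum_extn_simps y fun_eq_iff) metis
    then have "y k = \<zero>\<^bsub>Y k\<^esub>" if "k \<in> K" for k using D(8) direct_sum_component [OF y] that by blast
    then show "y = \<zero>\<^bsub>direct_sum K Y\<^esub>"
      by (intro extensionalityI [where A = K]) (use y in \<open>auto simp: direct_sum_carrier\<close>)
  next
    fix e assume e: "e \<in> carrier (direct_sum K ?M)" and "proj ?S e = \<zero>\<^bsub>direct_sum K X\<^esub>"
    then have "proj (E k) (e k) = \<zero>\<^bsub>X k\<^esub>" if "k \<in> K" for k
      using that by (simp add: sum_extn_simps fun_eq_iff) metis
    then have "\<exists>a\<in>carrier (Y k). incl (E k) a = e k" if "k \<in> K" for k
      using D(10) direct_sum_component [OF e] that by blast
    then obtain a where a: "\<And>k. k \<in> K \<Longrightarrow> a k \<in> carrier (Y k)" "\<And>k. k \<in> K \<Longrightarrow> incl (E k) (a k) = e k" by metis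
    have y: "restrict a K \<in> carrier (direct_sum K Y)"
      by (rule direct_sumI [OF R D(1) _ _ direct_sum_finite [OF e]]) (use a D(8) in auto)
    have "incl ?S (restrict a K) = e"
      unfolding sum_extn_simps(2) [OF y]
      by (rule extensionalityI [where A = K]) (use e a in \<open>auto simp: direct_sum_carrier\<close>)
    with y show "\<exists>y\<in>carrier (direct_sum K Y). incl ?S y = e" by blast
  next
    fix x assume x: "x \<in> carrier (direct_sum K X)"
    have "\<exists>e\<in>carrier (mid (E k)). proj (E k) e = x k \<and> (x k = \<zero>\<^bsub>X k\<^esub> \<longrightarrow> e = \<zero>\<^bsub>mid (E k)\<^esub>)" if k: "k \<in> K" for k
    proof (cases "x k = \<zero>\<^bsub>X k\<^esub>")
      case True
      interpret left_module R "mid (E k)" by (rule D(2) [OF k])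
      show ?thesis using True lin_zero [OF D(2) [OF k] D(3) [OF k] D(5) [OF k]] by (intro bexI [of _ "\<zero>\<^bsub>mid (E k)\<^esub>"]) auto
    next
      case False
      then show ?thesis using D(11) [OF k direct_sum_component [OF x k]] by blast
    qed
    then obtain e where e: "\<And>k. k \<in> K \<Longrightarrow> e k \<in> carrier (mid (E k))" "\<And>k. k \<in> K \<Longrightarrow> proj (E k) (e k) = x k"
      "\<And>k. k \<in> K \<Longrightarrow> x k = \<zero>\<^bsub>X k\<^esub> \<Longrightarrow> e k = \<zero>\<^bsub>mid (E k)\<^esub>" by metis
    have c: "restrict e K \<in> carrier (direct_sum K ?M)"
      by (rule direct_sumI [OF R D(2) _ _ direct_sum_finite [OF x]]) (use e in auto)
    have "proj ?S (restrict e K) = x"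
      unfolding sum_extn_simps(3) [OF c]
      by (rule extensionalityI [where A = K]) (use e x in \<open>auto simp: direct_sum_carrier\<close>)
    with c show "\<exists>e\<in>carrier (direct_sum K ?M). proj ?S e = x" by blast
  qed
qed

text \<open>A set-theoretic section of \<open>proj E\<close> identifies the middle term with \<open>Y \<times> X\<close> as a set.\<close>

lemma extn_on_product:
  fixes X :: "('r, 'x) module" and Y :: "('r, 'y) module"
  assumes E: "is_extn R X Y E"
  obtains E' :: "('r, 'y \<times> 'x, 'y, 'x) extn" where "is_extn R X Y E'" "equiv_extn R Y E E'"
proof -
  note D = is_extnD [OF E]
  let ?M = "mid E"
  interpret M: left_module R ?M by (rule D)
  interpret X: left_module R X by (rule D)
  obtain s where s: "\<And>x. x \<in> carrier X \<Longrightarrow> s x \<in> carrier ?M" "\<And>x. x \<in> carrier X \<Longrightarrow> proj E (s x) = x"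
    using D(11) by metis
  define \<gamma> where "\<gamma> = (\<lambda>(y, x). incl E y \<oplus>\<^bsub>?M\<^esub> s x)"
  have bij: "bij_betw \<gamma> (carrier Y \<times> carrier X) (carrier ?M)"
    unfolding bij_betw_def
  proof
    have p: "proj E (\<gamma> (y, x)) = x" if "y \<in> carrier Y" "x \<in> carrier X" for x y
      using that s lin_closed [OF D(4) that(1)] by (simp add: \<gamma>_def lin_add [OF D(5)] D(9))
    show "inj_on \<gamma> (carrier Y \<times> carrier X)"
    proof (rule inj_onI, clarify)
      fix y x y' x' assume *: "y \<in> carrier Y" "x \<in> carrier X" "y' \<in> carrier Y" "x' \<in> carrier X"
        and eq: "\<gamma> (y, x) = \<gamma> (y', x')"
      then have x: "x = x'" using p by metis
      then have "incl E y = incl E y'"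
        using eq * s(1) lin_closed [OF D(4)] by (simp add: \<gamma>_def)
      then show "y = y' \<and> x = x'" using x * D(6) by (simp add: inj_on_eq_iff)
    qed
    show "\<gamma> ` (carrier Y \<times> carrier X) = carrier ?M"
    proof (intro equalityI subsetI)
      fix m assume "m \<in> \<gamma> ` (carrier Y \<times> carrier X)"
      then show "m \<in> carrier ?M" using s(1) lin_closed [OF D(4)] by (auto simp: \<gamma>_def)
    next
      fix m assume m: "m \<in> carrier ?M"
      note pm = lin_closed [OF D(5) m]
      have "proj E (m \<ominus>\<^bsub>?M\<^esub> s (proj E m)) = \<zero>\<^bsub>X\<^esub>"
        using m pm s by (simp add: lin_diff [OF D(2,3,5)])
      then obtain y where y: "y \<in> carrier Y" "incl E y = m \<ominus>\<^bsub>?M\<^esub> s (proj E m)"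
        using D(10) m s(1) [OF pm] by (metis M.M.minus_closed)
      then have "\<gamma> (y, proj E m) = m" using m s(1) [OF pm] by (simp add: \<gamma>_def)
      then show "m \<in> \<gamma> ` (carrier Y \<times> carrier X)" using y pm by (metis SigmaI imageI)
    qed
  qed
  define \<beta> where "\<beta> = the_inv_into (carrier Y \<times> carrier X) \<gamma>"
  have \<gamma>\<beta>: "\<gamma> (\<beta> m) = m" if "m \<in> carrier ?M" for m
    unfolding \<beta>_def by (rule f_the_inv_into_f_bij_betw [OF bij]) (use that in blast)
  have \<beta>\<gamma>: "\<beta> (\<gamma> p) = p" if "p \<in> carrier Y \<times> carrier X" for p
    unfolding \<beta>_def using bij that by (simp add: bij_betw_def the_inv_into_f_f)
  have \<beta>bij: "bij_betw \<beta> (carrier ?M) (carrier Y \<times> carrier X)"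
    unfolding \<beta>_def by (rule bij_betw_the_inv_into [OF bij])
  define M' :: "('r, 'y \<times> 'x) module" where
    "M' = \<lparr>carrier = carrier Y \<times> carrier X, mult = undefined, one = undefined, zero = \<beta> \<zero>\<^bsub>?M\<^esub>,
       add = (\<lambda>p q. \<beta> (\<gamma> p \<oplus>\<^bsub>?M\<^esub> \<gamma> q)), smult = (\<lambda>r p. \<beta> (r \<odot>\<^bsub>?M\<^esub> \<gamma> p))\<rparr>"
  have \<beta>: "lin R ?M M' \<beta>"
    using \<beta>bij by (intro linI) (auto simp: M'_def \<gamma>\<beta> dest: bij_betwE)
  have im: "\<beta> ` carrier ?M = carrier M'" using \<beta>bij by (simp add: M'_def bij_betw_def)
  have M': "left_module R M'" by (rule left_module_surj_image [OF D(2) \<beta> _ im]) (simp add: M'_def)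
  define E' :: "('r, 'y \<times> 'x, 'y, 'x) extn" where
    "E' = \<lparr>mid = M', incl = (\<lambda>y\<in>carrier Y. \<beta> (incl E y)), proj = (\<lambda>p\<in>carrier M'. proj E (\<gamma> p))\<rparr>"
  have \<gamma>c: "\<gamma> p \<in> carrier ?M" if "p \<in> carrier M'" for p
    using bij that by (auto simp: M'_def dest: bij_betwE)
  have "lin R ?M X (\<lambda>m. proj E (\<gamma> (\<beta> m)))"
    by (rule lin_congI [OF D(5) D(2)]) (simp add: \<gamma>\<beta>)
  then have p': "lin R M' X (\<lambda>p. proj E (\<gamma> p))" by (rule lin_through_surj [OF D(2) \<beta> im])
  have i': "lin R Y M' (\<lambda>y. \<beta> (incl E y))" by (rule lin_comp [OF D(4) \<beta>])
  have \<beta>c: "\<beta> m \<in> carrier M'" if "m \<in> carrier ?M" for m using lin_closed [OF \<beta> that] .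
  have extn: "is_extn R X Y E'"
    unfolding is_extn_def
  proof (rule short_exactI)
    show "lin R Y (mid E') (incl E')"
      using lin_congI [OF i' D(1), of "incl E'"] by (simp add: E'_def)
    show "lin R (mid E') X (proj E')"
      using lin_congI [OF p' M', of "proj E'"] by (simp add: E'_def)
    fix y assume y: "y \<in> carrier Y"
    note iy = lin_closed [OF D(4) y]
    show "proj E' (incl E' y) = \<zero>\<^bsub>X\<^esub>" using y D(9) \<beta>c [OF iy] by (simp add: E'_def \<gamma>\<beta> [OF iy])
    assume "incl E' y = \<zero>\<^bsub>mid E'\<^esub>"
    then have "\<gamma> (\<beta> (incl E y)) = \<gamma> (\<beta> \<zero>\<^bsub>?M\<^esub>)" using y by (simp add: E'_def M'_def)
    then have "incl E y = \<zero>\<^bsub>?M\<^esub>" by (simp add: \<gamma>\<beta> iy)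
    then show "y = \<zero>\<^bsub>Y\<^esub>" using D(8) y by blast
  next
    fix b assume b: "b \<in> carrier (mid E')" "proj E' b = \<zero>\<^bsub>X\<^esub>"
    then have b': "b \<in> carrier M'" "proj E (\<gamma> b) = \<zero>\<^bsub>X\<^esub>" by (auto simp: E'_def)
    then obtain y where y: "y \<in> carrier Y" "incl E y = \<gamma> b" using D(10) \<gamma>c by blast
    then have "incl E' y = b" using b'(1) by (simp add: E'_def M'_def \<beta>\<gamma>)
    with y show "\<exists>y\<in>carrier Y. incl E' y = b" by blast
  next
    fix x assume "x \<in> carrier X"
    then obtain e where e: "e \<in> carrier ?M" "proj E e = x" using D(11) by blast
    then have "proj E' (\<beta> e) = x" using \<beta>c by (simp add: E'_def \<gamma>\<beta>)
    then show "\<exists>b\<in>carrier (mid E'). proj E' b = x" using \<beta>c [OF e(1)] by (auto simp: E'_def)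
  qed (use D M' in \<open>auto simp: E'_def\<close>)
  moreover have "equiv_extn R Y E E'"
    by (rule short_five [OF E extn, of \<beta>]) (use \<beta> \<beta>c \<gamma>\<beta> in \<open>auto simp: E'_def\<close>)
  ultimately show thesis using that by blast
qed

section \<open>\<open>Ext\<^sup>1\<close> through a free cover\<close>

lemma lin_through_inj:
  assumes A: "left_module R A" and Y: "left_module R Y" and B: "left_module R B"
    and i: "lin R Y B i" and inj: "inj_on i (carrier Y)"
    and g: "lin R A B g" and im: "\<And>a. a \<in> carrier A \<Longrightarrow> \<exists>y\<in>carrier Y. i y = g a"
  obtains \<phi> where "lin R A Y \<phi>" "\<And>a. a \<in> carrier A \<Longrightarrow> i (\<phi> a) = g a"
proof -
  interpret A: left_module R A by (rule A)
  interpret Y: left_module R Y by (rule Y)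
  obtain \<phi> where \<phi>: "\<And>a. a \<in> carrier A \<Longrightarrow> \<phi> a \<in> carrier Y" "\<And>a. a \<in> carrier A \<Longrightarrow> i (\<phi> a) = g a"
    using im by metis
  have "lin R A Y \<phi>"
  proof (rule linI)
    fix a b assume ab: "a \<in> carrier A" "b \<in> carrier A"
    have "i (\<phi> (a \<oplus>\<^bsub>A\<^esub> b)) = i (\<phi> a \<oplus>\<^bsub>Y\<^esub> \<phi> b)"
      using ab by (simp add: \<phi> lin_add [OF i] lin_add [OF g])
    then show "\<phi> (a \<oplus>\<^bsub>A\<^esub> b) = \<phi> a \<oplus>\<^bsub>Y\<^esub> \<phi> b"
      using ab \<phi>(1) by (intro inj_onD [OF inj]) auto
  next
    fix r a assume ra: "r \<in> carrier R" "a \<in> carrier A"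
    have "i (\<phi> (r \<odot>\<^bsub>A\<^esub> a)) = i (r \<odot>\<^bsub>Y\<^esub> \<phi> a)"
      using ra by (simp add: \<phi> lin_smult [OF i] lin_smult [OF g])
    then show "\<phi> (r \<odot>\<^bsub>A\<^esub> a) = r \<odot>\<^bsub>Y\<^esub> \<phi> a"
      using ra \<phi>(1) by (intro inj_onD [OF inj]) auto
  qed (rule \<phi>(1))
  then show thesis using \<phi>(2) that by blast
qed

lemma lin_summation_map:
  assumes Y: "left_module R Y"
  shows "lin R (direct_sum K (\<lambda>_. Y)) Y (summation_map K Y)"
    and "k \<in> K \<Longrightarrow> y \<in> carrier Y \<Longrightarrow> summation_map K Y (single K (\<lambda>_. Y) k y) = y"
proof -
  have R: "ring R" using Y by (simp add: left_module_def)
  have D: "left_module R (direct_sum K (\<lambda>_. Y))" by (rule direct_sum_left_module [OF R Y])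
  have e: "summation_map K Y f = copair K (\<lambda>_. Y) Y (\<lambda>_ y. y) f" if "f \<in> carrier (direct_sum K (\<lambda>_. Y))" for f
    using that by (simp add: summation_map_def copair_def)
  have c: "lin R (direct_sum K (\<lambda>_. Y)) Y (copair K (\<lambda>_. Y) Y (\<lambda>_ y. y))"
    by (rule lin_copair [OF R Y Y lin_id])
  then show "lin R (direct_sum K (\<lambda>_. Y)) Y (summation_map K Y)"
    by (rule lin_congI [OF _ D e])
  show "summation_map K Y (single K (\<lambda>_. Y) k y) = y" if "k \<in> K" "y \<in> carrier Y"
    using e [OF single_closed [OF R Y that]] copair_single [OF R Y Y lin_id that] by simp
qed

lemma summation_map_bool:
  assumes Y: "left_module R Y" and f: "f \<in> carrier (direct_sum UNIV (\<lambda>_::bool. Y))"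
  shows "summation_map UNIV Y f = f True \<oplus>\<^bsub>Y\<^esub> f False"
proof -
  interpret Y: left_module R Y by (rule Y)
  have R: "ring R" using Y by (simp add: left_module_def)
  have "summation_map UNIV Y f = (\<Oplus>\<^bsub>Y\<^esub>b\<in>{True, False}. f b)"
    using copair_superset [OF R Y Y lin_id f, of "{True, False}"] f
    unfolding copair_def summation_map_def by auto
  also have "\<dots> = f True \<oplus>\<^bsub>Y\<^esub> f False"
    using direct_sum_component [OF f] by simp
  finally show ?thesis .
qed

locale free_cover =
  fixes R :: "('r, 'a) ring_scheme" and X :: "('r, 'x) module" and n :: nat and p :: "(nat \<Rightarrow> 'r) \<Rightarrow> 'x"
  assumes X: "left_module R X"
    and p: "lin R (free_module R {..<n}) X p"
    and p_surj: "p ` carrier (free_module R {..<n}) = carrier X"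
begin

abbreviation F :: "('r, nat \<Rightarrow> 'r) module" where "F \<equiv> free_module R {..<n}"

definition Ker :: "('r, nat \<Rightarrow> 'r) module" where
  "Ker = F\<lparr>carrier := {x \<in> carrier F. p x = \<zero>\<^bsub>X\<^esub>}\<rparr>"

lemma R: "ring R" using X by (simp add: left_module_def)

lemma F: "left_module R F" by (rule free_module_left_module [OF R])

lemma Ker_submod: "submod R {x \<in> carrier F. p x = \<zero>\<^bsub>X\<^esub>} F"
  by (rule submod_ker [OF F X p])

lemma Ker: "left_module R Ker"
  unfolding Ker_def by (rule submod_left_module [OF F Ker_submod])

lemma Ker_iff: "x \<in> carrier Ker \<longleftrightarrow> x \<in> carrier F \<and> p x = \<zero>\<^bsub>X\<^esub>"
  by (simp add: Ker_def)

lemma Ker_F: "x \<in> carrier Ker \<Longrightarrow> x \<in> carrier F"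
  by (simp add: Ker_iff)

lemma lin_Ker: "lin R F M f \<Longrightarrow> lin R Ker M f"
  unfolding Ker_def by (rule lin_submod_dom [OF Ker_submod])

lemma F_lift:
  assumes "left_module R B" "left_module R C" "lin R B C q" "q ` carrier B = carrier C" "lin R X C h"
  obtains g where "lin R F B g" "\<And>x. x \<in> carrier F \<Longrightarrow> q (g x) = h (p x)"
  using free_module_lift [OF R assms(1-4) lin_comp [OF p assms(5)]] by blast

lemma F_factor:
  assumes M: "left_module R M" and g: "lin R F M g" and z: "\<And>k. k \<in> carrier Ker \<Longrightarrow> g k = \<zero>\<^bsub>M\<^esub>"
  obtains l where "lin R X M l" "\<And>x. x \<in> carrier F \<Longrightarrow> l (p x) = g x"
  using lin_factor [OF F X M p p_surj g] z unfolding Ker_iff by blast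

text \<open>\<open>rep \<phi> E h\<close>: the pull-back of \<open>E\<close> along \<open>h\<close> is the push-out of \<open>0 \<rightarrow> Ker \<rightarrow> F \<rightarrow> X \<rightarrow> 0\<close> along \<open>\<phi>\<close>.\<close>

definition rep :: "((nat \<Rightarrow> 'r) \<Rightarrow> 'y) \<Rightarrow> ('r, 'e, 'y, 'q) extn \<Rightarrow> ('x \<Rightarrow> 'q) \<Rightarrow> bool" where
  "rep \<phi> E h \<longleftrightarrow> (\<exists>g. lin R F (mid E) g \<and> (\<forall>x\<in>carrier F. proj E (g x) = h (p x)) \<and>
     (\<forall>k\<in>carrier Ker. g k = incl E (\<phi> k)))"

lemma repI:
  assumes "lin R F (mid E) g" "\<And>x. x \<in> carrier F \<Longrightarrow> proj E (g x) = h (p x)"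
    "\<And>k. k \<in> carrier Ker \<Longrightarrow> g k = incl E (\<phi> k)"
  shows "rep \<phi> E h"
  using assms by (auto simp: rep_def)

lemma repE:
  assumes "rep \<phi> E h"
  obtains g where "lin R F (mid E) g" "\<And>x. x \<in> carrier F \<Longrightarrow> proj E (g x) = h (p x)"
    "\<And>k. k \<in> carrier Ker \<Longrightarrow> g k = incl E (\<phi> k)"
  using assms by (auto simp: rep_def)

lemma rep_cong:
  assumes "rep \<phi> E h" "\<And>k. k \<in> carrier Ker \<Longrightarrow> \<phi> k = \<psi> k" "\<And>x. x \<in> carrier X \<Longrightarrow> h x = h' x"
  shows "rep \<psi> E h'"
proof -
  from assms(1) obtain g where "lin R F (mid E) g" "\<And>x. x \<in> carrier F \<Longrightarrow> proj E (g x) = h (p x)"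
    "\<And>k. k \<in> carrier Ker \<Longrightarrow> g k = incl E (\<phi> k)" by (rule repE) blast
  then show ?thesis by (intro repI [of E g]) (simp_all add: assms(2,3) lin_closed [OF p])
qed

lemma rep_exists:
  assumes E: "is_extn R Q Y E" and h: "lin R X Q h"
  obtains \<phi> where "lin R Ker Y \<phi>" "rep \<phi> E h"
proof -
  note D = is_extnD [OF E]
  obtain g where g: "lin R F (mid E) g" "\<And>x. x \<in> carrier F \<Longrightarrow> proj E (g x) = h (p x)"
    using F_lift [OF D(2,3,5,7) h] by blast
  have "\<exists>y\<in>carrier Y. incl E y = g k" if "k \<in> carrier Ker" for k
    using D(10) lin_closed [OF g(1)] g(2) that lin_zero [OF X D(3) h] by (simp add: Ker_iff)
  from lin_through_inj [OF Ker D(1,2,4,6) lin_Ker [OF g(1)] this]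
  obtain \<phi> where "lin R Ker Y \<phi>" "\<And>k. k \<in> carrier Ker \<Longrightarrow> incl E (\<phi> k) = g k" by blast
  with g show thesis by (intro that [of \<phi>] repI [of E g]) auto
qed

lemma rep_add:
  assumes E: "is_extn R Q Y E" and \<phi>: "lin R Ker Y \<phi>" "rep \<phi> E h" and \<psi>: "lin R Ker Y \<psi>" "rep \<psi> E h'"
  shows "rep (\<lambda>k. \<phi> k \<oplus>\<^bsub>Y\<^esub> \<psi> k) E (\<lambda>x. h x \<oplus>\<^bsub>Q\<^esub> h' x)"
proof -
  note D = is_extnD [OF E]
  from \<phi>(2) obtain g where g: "lin R F (mid E) g" "\<And>x. x \<in> carrier F \<Longrightarrow> proj E (g x) = h (p x)"
    "\<And>k. k \<in> carrier Ker \<Longrightarrow> g k = incl E (\<phi> k)" by (rule repE) blast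
  from \<psi>(2) obtain g' where g': "lin R F (mid E) g'" "\<And>x. x \<in> carrier F \<Longrightarrow> proj E (g' x) = h' (p x)"
    "\<And>k. k \<in> carrier Ker \<Longrightarrow> g' k = incl E (\<psi> k)" by (rule repE) blast
  show ?thesis
    by (rule repI [OF lin_plus [OF F D(2) g(1) g'(1)]])
      (simp_all add: lin_add [OF D(5)] lin_add [OF D(4)] g(2,3) g'(2,3) lin_closed [OF g(1)]
        lin_closed [OF g'(1)] lin_closed [OF \<phi>(1)] lin_closed [OF \<psi>(1)])
qed

lemma rep_zero:
  assumes E: "is_extn R Q Y E"
  shows "rep (\<lambda>k. \<zero>\<^bsub>Y\<^esub>) E (\<lambda>x. \<zero>\<^bsub>Q\<^esub>)"
  using is_extnD [OF E]
  by (intro repI [of E "\<lambda>_. \<zero>\<^bsub>mid E\<^esub>"] lin_const_zero F) (simp_all add: lin_zero [of R "mid E" Q] lin_zero [of R Y "mid E"])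

lemma rep_finsum:
  assumes E: "is_extn R Q Y E" and "finite A"
    and "\<And>s. s \<in> A \<Longrightarrow> lin R Ker Y (\<phi> s)" "\<And>s. s \<in> A \<Longrightarrow> rep (\<phi> s) E (h s)"
    "\<And>s. s \<in> A \<Longrightarrow> lin R X Q (h s)"
  shows "rep (\<lambda>k. finsum Y (\<lambda>s. \<phi> s k) A) E (\<lambda>x. finsum Q (\<lambda>s. h s x) A)"
  using assms(2-)
proof (induction A)
  case empty
  interpret Y: left_module R Y by (rule is_extnD [OF E])
  interpret Q: left_module R Q by (rule is_extnD [OF E])
  show ?case using rep_zero [OF E] by simp
next
  case (insert s A)
  interpret Y: left_module R Y by (rule is_extnD [OF E])
  interpret Q: left_module R Q by (rule is_extnD [OF E])
  have l: "lin R Ker Y (\<lambda>k. finsum Y (\<lambda>s. \<phi> s k) A)"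
    by (rule lin_finsum_fun [OF Ker Y.left_module_axioms]) (use insert in auto)
  have "rep (\<lambda>k. \<phi> s k \<oplus>\<^bsub>Y\<^esub> finsum Y (\<lambda>s. \<phi> s k) A) E (\<lambda>x. h s x \<oplus>\<^bsub>Q\<^esub> finsum Q (\<lambda>s. h s x) A)"
    by (rule rep_add [OF E _ _ l]) (use insert in auto)
  then show ?case
  proof (rule rep_cong)
    show "\<phi> s k \<oplus>\<^bsub>Y\<^esub> finsum Y (\<lambda>s. \<phi> s k) A = finsum Y (\<lambda>s. \<phi> s k) (insert s A)" if "k \<in> carrier Ker" for k
      using insert.hyps lin_closed [OF insert.prems(1) that] by (subst Y.M.finsum_insert) auto
    show "h s x \<oplus>\<^bsub>Q\<^esub> finsum Q (\<lambda>s. h s x) A = finsum Q (\<lambda>s. h s x) (insert s A)" if "x \<in> carrier X" for x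
      using insert.hyps lin_closed [OF insert.prems(3) that] by (subst Q.M.finsum_insert) auto
  qed
qed

lemma rep_map:
  assumes "rep \<phi> E h" and \<phi>: "lin R Ker Y \<phi>" and h: "lin R X Q h" and a: "lin R (mid E) (mid E') a"
    and "\<And>y. y \<in> carrier Y \<Longrightarrow> a (incl E y) = incl E' (b y)"
    and "\<And>e. e \<in> carrier (mid E) \<Longrightarrow> proj E' (a e) = d (proj E e)"
  shows "rep (\<lambda>k. b (\<phi> k)) E' (\<lambda>x. d (h x))"
proof -
  from assms(1) obtain g where g: "lin R F (mid E) g" "\<And>x. x \<in> carrier F \<Longrightarrow> proj E (g x) = h (p x)"
    "\<And>k. k \<in> carrier Ker \<Longrightarrow> g k = incl E (\<phi> k)" by (rule repE) blast
  show ?thesis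
    by (rule repI [OF lin_comp [OF g(1) a]]) (simp_all add: assms g lin_closed [OF g(1)] lin_closed [OF \<phi>])
qed

lemma rep_comp:
  assumes "rep \<phi> E h" and t: "lin R F F t" and f: "lin R X X f"
    and pt: "\<And>x. x \<in> carrier F \<Longrightarrow> p (t x) = f (p x)"
  shows "rep (\<lambda>k. \<phi> (t k)) E (\<lambda>x. h (f x))"
proof -
  from assms(1) obtain g where g: "lin R F (mid E) g" "\<And>x. x \<in> carrier F \<Longrightarrow> proj E (g x) = h (p x)"
    "\<And>k. k \<in> carrier Ker \<Longrightarrow> g k = incl E (\<phi> k)" by (rule repE) blast
  have tK: "t k \<in> carrier Ker" if "k \<in> carrier Ker" for k
    using that lin_closed [OF t] lin_zero [OF X X f] by (simp add: Ker_iff pt)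
  show ?thesis
    by (rule repI [OF lin_comp [OF t g(1)]]) (simp_all add: g pt lin_closed [OF t] tK)
qed

lemma End_lift:
  assumes f: "lin R X X f"
  obtains t where "lin R F F t" "\<And>x. x \<in> carrier F \<Longrightarrow> p (t x) = f (p x)"
    "lin R Ker Ker t"
proof -
  obtain t where t: "lin R F F t" "\<And>x. x \<in> carrier F \<Longrightarrow> p (t x) = f (p x)"
    using F_lift [OF F X p p_surj f] by blast
  have "t k \<in> {x \<in> carrier F. p x = \<zero>\<^bsub>X\<^esub>}" if "k \<in> carrier Ker" for k
    using that lin_closed [OF t(1)] lin_zero [OF X X f] by (simp add: Ker_iff t(2))
  then have "lin R Ker Ker t"
    using lin_submod_cod [OF lin_Ker [OF t(1)]] unfolding Ker_def by blast
  with t that show thesis by blast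
qed

lemma rep_extends_iff:
  assumes E: "is_extn R Q Y E" and h: "lin R X Q h" and \<phi>: "lin R Ker Y \<phi>" "rep \<phi> E h"
  shows "(\<exists>\<chi>. lin R F Y \<chi> \<and> (\<forall>k\<in>carrier Ker. \<phi> k = \<chi> k)) \<longleftrightarrow>
    (\<exists>l. lin R X (mid E) l \<and> (\<forall>x\<in>carrier X. proj E (l x) = h x))"
proof -
  note D = is_extnD [OF E]
  interpret M: left_module R "mid E" by (rule D)
  interpret Q: left_module R Q by (rule D)
  from \<phi>(2) obtain g where g: "lin R F (mid E) g" "\<And>x. x \<in> carrier F \<Longrightarrow> proj E (g x) = h (p x)"
    "\<And>k. k \<in> carrier Ker \<Longrightarrow> g k = incl E (\<phi> k)" by (rule repE) blast
  note gc = lin_closed [OF g(1)]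
  have ex: "\<exists>y\<in>carrier F. x = p y" if "x \<in> carrier X" for x using p_surj that by auto
  show ?thesis
  proof
    assume "\<exists>\<chi>. lin R F Y \<chi> \<and> (\<forall>k\<in>carrier Ker. \<phi> k = \<chi> k)"
    then obtain \<chi> where \<chi>: "lin R F Y \<chi>" "\<And>k. k \<in> carrier Ker \<Longrightarrow> \<phi> k = \<chi> k" by blast
    note i\<chi> = lin_comp [OF \<chi>(1) D(4)]
    have "g k \<ominus>\<^bsub>mid E\<^esub> incl E (\<chi> k) = \<zero>\<^bsub>mid E\<^esub>" if "k \<in> carrier Ker" for k
      using lin_closed [OF i\<chi> Ker_F [OF that]] that by (simp add: g(3) \<chi>(2))
    from F_factor [OF D(2) lin_minus_fun [OF F D(2) g(1) i\<chi>] this]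
    obtain l where l: "lin R X (mid E) l" "\<And>x. x \<in> carrier F \<Longrightarrow> l (p x) = g x \<ominus>\<^bsub>mid E\<^esub> incl E (\<chi> x)" by blast
    have "proj E (l x) = h x" if x: "x \<in> carrier X" for x
    proof -
      obtain y where y: "y \<in> carrier F" "x = p y" using ex x by blast
      then show ?thesis
        using l(2) gc [OF y(1)] lin_closed [OF i\<chi> y(1)] D(9) [OF lin_closed [OF \<chi>(1) y(1)]] lin_closed [OF h x]
        by (simp add: lin_diff [OF D(2,3,5)] g(2))
    qed
    with l(1) show "\<exists>l. lin R X (mid E) l \<and> (\<forall>x\<in>carrier X. proj E (l x) = h x)" by blast
  next
    assume "\<exists>l. lin R X (mid E) l \<and> (\<forall>x\<in>carrier X. proj E (l x) = h x)"
    then obtain l where l: "lin R X (mid E) l" "\<And>x. x \<in> carrier X \<Longrightarrow> proj E (l x) = h x" by blast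
    note lp = lin_comp [OF p l(1)]
    have "\<exists>y\<in>carrier Y. incl E y = g x \<ominus>\<^bsub>mid E\<^esub> l (p x)" if x: "x \<in> carrier F" for x
      using gc [OF x] lin_closed [OF lp x] lin_closed [OF p x] lin_closed [OF h lin_closed [OF p x]]
      by (intro D(10)) (simp_all add: lin_diff [OF D(2,3,5)] g(2) l(2) x)
    from lin_through_inj [OF F D(1,2,4,6) lin_minus_fun [OF F D(2) g(1) lp] this]
    obtain \<chi> where \<chi>: "lin R F Y \<chi>" "\<And>x. x \<in> carrier F \<Longrightarrow> incl E (\<chi> x) = g x \<ominus>\<^bsub>mid E\<^esub> l (p x)" by blast
    have "\<phi> k = \<chi> k" if k: "k \<in> carrier Ker" for k
    proof -
      have "incl E (\<chi> k) = incl E (\<phi> k)"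
        using \<chi>(2) [OF Ker_F [OF k]] g(3) [OF k] k lin_zero [OF X D(2) l(1)] gc [OF Ker_F [OF k]]
        by (simp add: Ker_iff)
      then show ?thesis
        using inj_onD [OF D(6)] lin_closed [OF \<chi>(1) Ker_F [OF k]] lin_closed [OF \<phi>(1) k] by metis
    qed
    with \<chi>(1) show "\<exists>\<chi>. lin R F Y \<chi> \<and> (\<forall>k\<in>carrier Ker. \<phi> k = \<chi> k)" by blast
  qed
qed

lemma rep_equiv:
  assumes E: "is_extn R X Y E" and \<phi>: "lin R Ker Y \<phi>" "rep \<phi> E (\<lambda>x. x)"
    and eq: "equiv_extn R Y E E'"
  shows "rep \<phi> E' (\<lambda>x. x)"
proof -
  obtain c where c: "c \<in> liso R (mid E) (mid E')" "\<And>y. y \<in> carrier Y \<Longrightarrow> c (incl E y) = incl E' y"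
    "\<And>e. e \<in> carrier (mid E) \<Longrightarrow> proj E' (c e) = proj E e"
    using eq by (auto simp: equiv_extn_def)
  then have "lin R (mid E) (mid E') c" by (simp add: liso_def lhom_lin)
  from rep_map [OF \<phi>(2,1) lin_id this c(2,3)] show ?thesis .
qed

lemma rep_unique:
  assumes E: "is_extn R X Y E" and E': "is_extn R X Y E'" and \<phi>: "lin R Ker Y \<phi>"
    and r: "rep \<phi> E (\<lambda>x. x)" "rep \<phi> E' (\<lambda>x. x)"
  shows "equiv_extn R Y E E'"
proof -
  note D = is_extnD [OF E]
  note D' = is_extnD [OF E']
  from r(1) obtain g where g: "lin R F (mid E) g" "\<And>x. x \<in> carrier F \<Longrightarrow> proj E (g x) = p x"
    "\<And>k. k \<in> carrier Ker \<Longrightarrow> g k = incl E (\<phi> k)" by (rule repE) blast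
  from r(2) obtain g' where g': "lin R F (mid E') g'" "\<And>x. x \<in> carrier F \<Longrightarrow> proj E' (g' x) = p x"
    "\<And>k. k \<in> carrier Ker \<Longrightarrow> g' k = incl E' (\<phi> k)" by (rule repE) blast
  have surj: "(\<lambda>x. proj E (g x)) ` carrier F = carrier X" using p_surj g(2) by (metis (no_types, lifting) image_cong)
  have compat: "g' x = incl E' y" if xy: "x \<in> carrier F" "y \<in> carrier Y" "g x = incl E y" for x y
  proof -
    have k: "x \<in> carrier Ker" using xy g(2) [OF xy(1)] D(9) [OF xy(2)] by (simp add: Ker_iff)
    then have "\<phi> x = y" using g(3) [OF k] xy inj_onD [OF D(6)] lin_closed [OF \<phi> k] by metis
    then show ?thesis using g'(3) [OF k] by simp
  qed
  from extn_glue [OF E F D'(2) g(1) surj g'(1) D'(4) compat] obtain c where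
    c: "lin R (mid E) (mid E') c" "\<And>x. x \<in> carrier F \<Longrightarrow> c (g x) = g' x"
    "\<And>y. y \<in> carrier Y \<Longrightarrow> c (incl E y) = incl E' y" by blast
  have fact: "proj E' (c e) = proj E e" if e: "e \<in> carrier (mid E)" for e
  proof -
    interpret M: left_module R "mid E" by (rule D)
    interpret X: left_module R X by (rule X)
    have "proj E e \<in> (\<lambda>x. proj E (g x)) ` carrier F" using surj lin_closed [OF D(5) e] by simp
    then obtain x where x: "x \<in> carrier F" "proj E e = proj E (g x)" by auto
    note gx = lin_closed [OF g(1) x(1)]
    have "proj E (e \<ominus>\<^bsub>mid E\<^esub> g x) = \<zero>\<^bsub>X\<^esub>"
      using x e gx lin_closed [OF D(5) gx] by (simp add: lin_diff [OF D(2,3,5)])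
    then obtain y where y: "y \<in> carrier Y" "incl E y = e \<ominus>\<^bsub>mid E\<^esub> g x"
      using D(10) e gx by (metis M.M.minus_closed)
    have "e = incl E y \<oplus>\<^bsub>mid E\<^esub> g x" using y e gx by simp
    then have "c e = c (incl E y \<oplus>\<^bsub>mid E\<^esub> g x)" by (rule arg_cong)
    then have "c e = incl E' y \<oplus>\<^bsub>mid E'\<^esub> g' x"
      using lin_add [OF c(1) lin_closed [OF D(4) y(1)] gx] by (simp only: c(2) [OF x(1)] c(3) [OF y(1)])
    then have "proj E' (c e) = p x"
      using lin_add [OF D'(5) lin_closed [OF D'(4) y(1)] lin_closed [OF g'(1) x(1)]] D'(9) [OF y(1)]
        g'(2) [OF x(1)] lin_closed [OF p x(1)] by simp
    then show ?thesis using x g(2) by simp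
  qed
  show ?thesis by (rule short_five [OF E E' c(1,3) fact])
qed

lemma rep_pullback:
  assumes E: "is_extn R Q Y E" and \<phi>: "lin R Ker Y \<phi>" "rep \<phi> E h" and h: "lin R X Q h"
  shows "rep \<phi> (pullback_extn Y X h E) (\<lambda>x. x)"
proof -
  note D = is_extnD [OF E]
  from \<phi>(2) obtain g where g: "lin R F (mid E) g" "\<And>x. x \<in> carrier F \<Longrightarrow> proj E (g x) = h (p x)"
    "\<And>k. k \<in> carrier Ker \<Longrightarrow> g k = incl E (\<phi> k)" by (rule repE) blast
  have "lin R F (mid (pullback_extn Y X h E)) (\<lambda>x. (g x, p x))"
    unfolding mid_pullback_extn
    by (rule lin_submod_cod [OF lin_pair [OF g(1) p]]) (simp add: g(2) lin_closed [OF g(1)] lin_closed [OF p])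
  then show ?thesis
  proof (rule repI)
    show "proj (pullback_extn Y X h E) (g x, p x) = p x" if "x \<in> carrier F" for x
      using that by (subst pullback_extn_simps(3)) (simp_all add: pullback_extn_simps(1) g(2) lin_closed [OF g(1)] lin_closed [OF p])
    show "(g k, p k) = incl (pullback_extn Y X h E) (\<phi> k)" if "k \<in> carrier Ker" for k
      using that by (simp add: pullback_extn_simps(2) lin_closed [OF \<phi>(1)] g(3) Ker_iff)
  qed
qed

lemma rep_pushout_exists:
  assumes Y: "left_module R Y" and \<phi>: "lin R Ker Y \<phi>"
  obtains E :: "('r, 'y \<times> 'x, 'y, 'x) extn" where "is_extn R X Y E" "rep \<phi> E (\<lambda>x. x)"
proof -
  define E0 where "E0 = \<lparr>mid = F, incl = (\<lambda>k\<in>carrier Ker. k), proj = (\<lambda>x\<in>carrier F. p x)\<rparr>"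
  have i: "lin R Ker F (\<lambda>k\<in>carrier Ker. k)"
    by (rule lin_congI [OF lin_Ker [OF lin_id] Ker]) simp
  have q: "lin R F X (\<lambda>x\<in>carrier F. p x)" by (rule lin_congI [OF p F]) simp
  have ex: "\<exists>y\<in>carrier F. p y = x" if "x \<in> carrier X" for x using p_surj that by (metis imageE)
  have E0: "is_extn R X Ker E0"
    unfolding is_extn_def E0_def extn.simps
  proof (rule short_exactI [OF Ker F X i _ q])
    show "\<exists>a\<in>carrier Ker. (\<lambda>k\<in>carrier Ker. k) a = b"
      if "b \<in> carrier F" "(\<lambda>x\<in>carrier F. p x) b = \<zero>\<^bsub>X\<^esub>" for b
      using that by (intro bexI [of _ b]) (auto simp: Ker_iff)
    show "\<exists>b\<in>carrier F. (\<lambda>x\<in>carrier F. p x) b = c" if "c \<in> carrier X" for c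
      using ex [OF that] by auto
  qed (auto simp: Ker_iff, simp add: Ker_def)
  have r0: "rep (\<lambda>k. k) E0 (\<lambda>x. x)"
    by (rule repI [of _ "\<lambda>x. x"]) (auto simp: E0_def Ker_iff lin_id)
  from is_extn_pushout [OF E0 Y \<phi>] obtain a where a: "is_extn R X Y (pushout_extn Ker Y \<phi> E0)"
    "lin R (mid E0) (mid (pushout_extn Ker Y \<phi> E0)) a"
    "\<And>y. y \<in> carrier Ker \<Longrightarrow> a (incl E0 y) = incl (pushout_extn Ker Y \<phi> E0) (\<phi> y)"
    "\<And>e. e \<in> carrier (mid E0) \<Longrightarrow> proj (pushout_extn Ker Y \<phi> E0) (a e) = proj E0 e" by blast
  have r1: "rep \<phi> (pushout_extn Ker Y \<phi> E0) (\<lambda>x. x)"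
    using rep_map [OF r0 lin_id lin_id a(2-4)] .
  obtain E' :: "('r, 'y \<times> 'x, 'y, 'x) extn" where E': "is_extn R X Y E'"
    "equiv_extn R Y (pushout_extn Ker Y \<phi> E0) E'"
    using extn_on_product [OF a(1)] by blast
  show thesis by (rule that [OF E'(1) rep_equiv [OF a(1) \<phi> r1 E'(2)]])
qed

lemma rep_split_extn:
  assumes Y: "left_module R Y"
  shows "is_extn R X Y (split_extn X Y)" "rep (\<lambda>k. \<zero>\<^bsub>Y\<^esub>) (split_extn X Y) (\<lambda>x. x)"
proof -
  interpret Y: left_module R Y by (rule Y)
  interpret X: left_module R X by (rule X)
  let ?P = "prod_module Y X"
  have P: "left_module R ?P" by (rule prod_module_left_module [OF Y X])
  have i: "lin R Y ?P (\<lambda>y\<in>carrier Y. (y, \<zero>\<^bsub>X\<^esub>))"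
    by (rule lin_congI [OF lin_pair [OF lin_id lin_const_zero [OF Y X]] Y]) simp
  have q: "lin R ?P X (\<lambda>p\<in>carrier ?P. snd p)" by (rule lin_congI [OF lin_snd P]) simp
  show "is_extn R X Y (split_extn X Y)"
    unfolding is_extn_def split_extn_def extn.simps
    by (rule short_exactI [OF Y P X i _ q]) (force simp del: restrict_apply simp: restrict_apply')+
  show "rep (\<lambda>k. \<zero>\<^bsub>Y\<^esub>) (split_extn X Y) (\<lambda>x. x)"
  proof (rule repI [of _ "\<lambda>x. (\<zero>\<^bsub>Y\<^esub>, p x)"])
    show "lin R F (mid (split_extn X Y)) (\<lambda>x. (\<zero>\<^bsub>Y\<^esub>, p x))"
      by (simp add: split_extn_def lin_pair [OF lin_const_zero [OF F Y] p])
  qed (auto simp: split_extn_def Ker_iff lin_closed [OF p])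
qed

lemma rep_baer_sum:
  assumes E: "is_extn R X Y E" and E': "is_extn R X Y E'"
    and \<phi>: "lin R Ker Y \<phi>" "rep \<phi> E (\<lambda>x. x)" and \<psi>: "lin R Ker Y \<psi>" "rep \<psi> E' (\<lambda>x. x)"
  shows "is_extn R X Y (baer_sum X Y E E')" "rep (\<lambda>k. \<phi> k \<oplus>\<^bsub>Y\<^esub> \<psi> k) (baer_sum X Y E E') (\<lambda>x. x)"
proof -
  note D = is_extnD [OF E]
  note D' = is_extnD [OF E']
  note Y = D(1)
  let ?E = "\<lambda>b. if b then E else E'"
  let ?XX = "direct_sum UNIV (\<lambda>_::bool. X)" and ?YY = "direct_sum UNIV (\<lambda>_::bool. Y)"
  let ?S = "sum_extn UNIV (\<lambda>_. Y) ?E"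
  let ?d = "diagonal_map UNIV X"
  have S: "is_extn R ?XX ?YY ?S" by (rule is_extn_sum [OF R]) (use E E' in auto)
  have YY: "left_module R ?YY" by (rule direct_sum_left_module [OF R Y])
  have d: "lin R X ?XX ?d"
    by (rule lin_direct_sumI [OF R X])
      (auto simp: diagonal_map_def direct_sum_carrier X intro: lin_congI [OF lin_id X])
  from \<phi>(2) obtain g where g: "lin R F (mid E) g" "\<And>x. x \<in> carrier F \<Longrightarrow> proj E (g x) = p x"
    "\<And>k. k \<in> carrier Ker \<Longrightarrow> g k = incl E (\<phi> k)" by (rule repE) blast
  from \<psi>(2) obtain g' where g': "lin R F (mid E') g'" "\<And>x. x \<in> carrier F \<Longrightarrow> proj E' (g' x) = p x"
    "\<And>k. k \<in> carrier Ker \<Longrightarrow> g' k = incl E' (\<psi> k)" by (rule repE) blast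
  let ?\<theta> = "\<lambda>k b. if b then \<phi> k else \<psi> k"
  have \<theta>: "lin R Ker ?YY ?\<theta>"
  proof (rule lin_direct_sumI [OF R Y _ _ Ker])
    show "lin R Ker Y (\<lambda>x. if b then \<phi> x else \<psi> x)" for b using \<phi>(1) \<psi>(1) by (cases b) simp_all
  qed (auto simp: direct_sum_carrier lin_closed [OF \<phi>(1)] lin_closed [OF \<psi>(1)])
  have gg: "lin R F (direct_sum UNIV (\<lambda>b. mid (?E b))) (\<lambda>x b. if b then g x else g' x)"
  proof (rule lin_direct_sumI [OF R _ _ _ F])
    show "lin R F (mid (?E b)) (\<lambda>x. if b then g x else g' x)" for b using g(1) g'(1) by (cases b) simp_all
  qed (auto simp: direct_sum_carrier lin_closed [OF g(1)] lin_closed [OF g'(1)] D D')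
  have rS: "rep ?\<theta> ?S ?d"
  proof (rule repI)
    show "lin R F (mid ?S) (\<lambda>x b. if b then g x else g' x)" using gg by (simp only: sum_extn_simps(1))
    show "proj ?S (\<lambda>b. if b then g x else g' x) = ?d (p x)" if "x \<in> carrier F" for x
      using that by (subst sum_extn_simps(3) [OF lin_closed [OF gg that]])
        (auto simp: g g' diagonal_map_def lin_closed [OF p])
    show "(\<lambda>b. if b then g k else g' k) = incl ?S (?\<theta> k)" if "k \<in> carrier Ker" for k
      using that by (subst sum_extn_simps(2) [OF lin_closed [OF \<theta> that]]) (auto simp: g g')
  qed
  let ?PB = "pullback_extn ?YY X ?d ?S"
  have PB: "is_extn R X ?YY ?PB" by (rule is_extn_pullback [OF S X d])
  have rPB: "rep ?\<theta> ?PB (\<lambda>x. x)" by (rule rep_pullback [OF S \<theta> rS d])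
  from is_extn_pushout [OF PB Y lin_summation_map(1) [OF Y]] obtain a where
    a: "is_extn R X Y (baer_sum X Y E E')" "lin R (mid ?PB) (mid (baer_sum X Y E E')) a"
    "\<And>y. y \<in> carrier ?YY \<Longrightarrow> a (incl ?PB y) = incl (baer_sum X Y E E') (summation_map UNIV Y y)"
    "\<And>e. e \<in> carrier (mid ?PB) \<Longrightarrow> proj (baer_sum X Y E E') (a e) = proj ?PB e"
    unfolding baer_sum_def by blast
  show "is_extn R X Y (baer_sum X Y E E')" by (rule a(1))
  from rep_map [OF rPB \<theta> lin_id a(2-4)]
  show "rep (\<lambda>k. \<phi> k \<oplus>\<^bsub>Y\<^esub> \<psi> k) (baer_sum X Y E E') (\<lambda>x. x)"
    by (rule rep_cong) (simp_all add: summation_map_bool [OF Y lin_closed [OF \<theta>]])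
qed

definition cls :: "('r, 'y) module \<Rightarrow> ((nat \<Rightarrow> 'r) \<Rightarrow> 'y) \<Rightarrow> ('r, 'y \<times> 'x, 'y, 'x) extn set" where
  "cls Y \<phi> = {E. is_extn R X Y E \<and> rep \<phi> E (\<lambda>x. x)}"

lemma extn_class_eq_cls:
  assumes E: "is_extn R X Y E" and \<phi>: "lin R Ker Y \<phi>" "rep \<phi> E (\<lambda>x. x)"
  shows "extn_class R X Y E = cls Y \<phi>"
  unfolding extn_class_def cls_def
  using rep_equiv [OF E \<phi>] rep_unique [OF E _ \<phi>(1) \<phi>(2)] by blast

lemma cls_cong: "(\<And>k. k \<in> carrier Ker \<Longrightarrow> \<phi> k = \<psi> k) \<Longrightarrow> cls Y \<phi> = cls Y \<psi>"
  unfolding cls_def by (auto elim: rep_cong)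

context
  fixes Y :: "('r, 'y) module"
  assumes Y: "left_module R Y"
begin

interpretation Y: left_module R Y by (rule Y)

lemma cls_nonempty:
  assumes "lin R Ker Y \<phi>"
  obtains E where "E \<in> cls Y \<phi>"
  using rep_pushout_exists [OF Y assms] unfolding cls_def by blast

lemma Ext1_carrier: "carrier (Ext1 R X Y) = {cls Y \<phi> | \<phi>. lin R Ker Y \<phi>}"
proof (intro equalityI subsetI)
  fix v assume "v \<in> carrier (Ext1 R X Y)"
  then obtain E :: "('r, 'y \<times> 'x, 'y, 'x) extn" where E: "is_extn R X Y E" "v = extn_class R X Y E"
    by (auto simp: Ext1_def)
  obtain \<phi> where \<phi>: "lin R Ker Y \<phi>" "rep \<phi> E (\<lambda>x. x)" using rep_exists [OF E(1) lin_id] by blast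
  then show "v \<in> {cls Y \<phi> | \<phi>. lin R Ker Y \<phi>}" using extn_class_eq_cls [OF E(1) \<phi>] E(2) by blast
next
  fix v assume "v \<in> {cls Y \<phi> | \<phi>. lin R Ker Y \<phi>}"
  then obtain \<phi> where \<phi>: "lin R Ker Y \<phi>" "v = cls Y \<phi>" by blast
  obtain E where "E \<in> cls Y \<phi>" using cls_nonempty [OF \<phi>(1)] .
  then have "is_extn R X Y E" "rep \<phi> E (\<lambda>x. x)" by (auto simp: cls_def)
  then show "v \<in> carrier (Ext1 R X Y)"
    using extn_class_eq_cls [OF _ \<phi>(1)] \<phi>(2) by (force simp: Ext1_def)
qed

lemma Ext1_zero: "\<zero>\<^bsub>Ext1 R X Y\<^esub> = cls Y (\<lambda>k. \<zero>\<^bsub>Y\<^esub>)"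
  unfolding Ext1_def
  using extn_class_eq_cls [OF rep_split_extn(1) [OF Y] lin_const_zero [OF Ker Y] rep_split_extn(2) [OF Y]] by simp

lemma Ext1_add:
  assumes \<phi>: "lin R Ker Y \<phi>" and \<psi>: "lin R Ker Y \<psi>"
  shows "cls Y \<phi> \<oplus>\<^bsub>Ext1 R X Y\<^esub> cls Y \<psi> = cls Y (\<lambda>k. \<phi> k \<oplus>\<^bsub>Y\<^esub> \<psi> k)"
proof -
  obtain E0 where E0: "E0 \<in> cls Y \<phi>" using cls_nonempty [OF \<phi>] .
  obtain E1 where E1: "E1 \<in> cls Y \<psi>" using cls_nonempty [OF \<psi>] .
  have "extn_class R X Y (baer_sum X Y E E') = cls Y (\<lambda>k. \<phi> k \<oplus>\<^bsub>Y\<^esub> \<psi> k)"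
    if "E \<in> cls Y \<phi>" "E' \<in> cls Y \<psi>" for E E'
    using that rep_baer_sum [OF _ _ \<phi> _ \<psi>] extn_class_eq_cls [OF _ lin_plus [OF Ker Y \<phi> \<psi>]]
    unfolding cls_def by blast
  then have "(\<Union>E\<in>cls Y \<phi>. \<Union>E'\<in>cls Y \<psi>. extn_class R X Y (baer_sum X Y E E')) = cls Y (\<lambda>k. \<phi> k \<oplus>\<^bsub>Y\<^esub> \<psi> k)"
    using E0 E1 by (intro SUP_eq_const) auto
  then show ?thesis by (simp add: Ext1_def)
qed

lemma Ext1_smult:
  assumes \<phi>: "lin R Ker Y \<phi>" and f: "lin R X X f" and t: "lin R F F t" "lin R Ker Ker t"
    "\<And>x. x \<in> carrier F \<Longrightarrow> p (t x) = f (p x)"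
  shows "f \<odot>\<^bsub>Ext1 R X Y\<^esub> cls Y \<phi> = cls Y (\<lambda>k. \<phi> (t k))"
proof -
  obtain E0 where E0: "E0 \<in> cls Y \<phi>" using cls_nonempty [OF \<phi>] .
  note \<phi>t = lin_comp [OF t(2) \<phi>]
  have "extn_class R X Y (pullback_extn Y X f E) = cls Y (\<lambda>k. \<phi> (t k))" if "E \<in> cls Y \<phi>" for E
  proof -
    have E: "is_extn R X Y E" "rep \<phi> E (\<lambda>x. x)" using that by (auto simp: cls_def)
    have "rep (\<lambda>k. \<phi> (t k)) E f" using rep_comp [OF E(2) t(1) f t(3)] .
    then show ?thesis
      by (intro extn_class_eq_cls is_extn_pullback [OF E(1) X f] \<phi>t rep_pullback [OF E(1) \<phi>t _ f])
  qed
  then have "(\<Union>E\<in>cls Y \<phi>. extn_class R X Y (pullback_extn Y X f E)) = cls Y (\<lambda>k. \<phi> (t k))"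
    using E0 by (intro SUP_eq_const) auto
  then show ?thesis by (simp add: Ext1_def)
qed

lemma Ext1_abelian_monoid: "abelian_monoid (Ext1 R X Y)"
proof (rule abelian_monoidI)
  let ?V = "Ext1 R X Y"
  show "\<zero>\<^bsub>?V\<^esub> \<in> carrier ?V"
    using lin_const_zero [OF Ker Y] by (auto simp: Ext1_carrier Ext1_zero)
  fix x assume "x \<in> carrier ?V"
  then obtain \<phi> where \<phi>: "lin R Ker Y \<phi>" "x = cls Y \<phi>" by (auto simp: Ext1_carrier)
  show "\<zero>\<^bsub>?V\<^esub> \<oplus>\<^bsub>?V\<^esub> x = x"
    using Ext1_add [OF lin_const_zero [OF Ker Y] \<phi>(1)] cls_cong [of "\<lambda>k. \<zero>\<^bsub>Y\<^esub> \<oplus>\<^bsub>Y\<^esub> \<phi> k" \<phi>] lin_closed [OF \<phi>(1)]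
    by (simp add: Ext1_zero \<phi>(2))
  fix y assume "y \<in> carrier ?V"
  then obtain \<psi> where \<psi>: "lin R Ker Y \<psi>" "y = cls Y \<psi>" by (auto simp: Ext1_carrier)
  note s = lin_plus [OF Ker Y \<phi>(1) \<psi>(1)]
  show "x \<oplus>\<^bsub>?V\<^esub> y \<in> carrier ?V" using s by (auto simp: Ext1_carrier \<phi>(2) \<psi>(2) Ext1_add \<phi>(1) \<psi>(1))
  have "cls Y (\<lambda>k. \<phi> k \<oplus>\<^bsub>Y\<^esub> \<psi> k) = cls Y (\<lambda>k. \<psi> k \<oplus>\<^bsub>Y\<^esub> \<phi> k)"
    by (rule cls_cong) (rule Y.M.a_comm [OF lin_closed [OF \<phi>(1)] lin_closed [OF \<psi>(1)]])
  then show "x \<oplus>\<^bsub>?V\<^esub> y = y \<oplus>\<^bsub>?V\<^esub> x" by (simp add: Ext1_add \<phi> \<psi>)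
  fix z assume "z \<in> carrier ?V"
  then obtain \<chi> where \<chi>: "lin R Ker Y \<chi>" "z = cls Y \<chi>" by (auto simp: Ext1_carrier)
  have "cls Y (\<lambda>k. \<phi> k \<oplus>\<^bsub>Y\<^esub> \<psi> k \<oplus>\<^bsub>Y\<^esub> \<chi> k) = cls Y (\<lambda>k. \<phi> k \<oplus>\<^bsub>Y\<^esub> (\<psi> k \<oplus>\<^bsub>Y\<^esub> \<chi> k))"
    by (rule cls_cong) (rule Y.M.a_assoc [OF lin_closed [OF \<phi>(1)] lin_closed [OF \<psi>(1)] lin_closed [OF \<chi>(1)]])
  then show "x \<oplus>\<^bsub>?V\<^esub> y \<oplus>\<^bsub>?V\<^esub> z = x \<oplus>\<^bsub>?V\<^esub> (y \<oplus>\<^bsub>?V\<^esub> z)"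
    by (simp add: Ext1_add \<phi> \<psi> \<chi> s lin_plus [OF Ker Y \<psi>(1) \<chi>(1)])
qed

lemma Ext1_finsum:
  assumes "finite A" "\<And>s. s \<in> A \<Longrightarrow> lin R Ker Y (\<phi> s)"
  shows "finsum (Ext1 R X Y) (\<lambda>s. cls Y (\<phi> s)) A = cls Y (\<lambda>k. finsum Y (\<lambda>s. \<phi> s k) A)"
  using assms
proof (induction A)
  case empty
  interpret V: abelian_monoid "Ext1 R X Y" by (rule Ext1_abelian_monoid)
  show ?case by (simp add: Ext1_zero)
next
  case (insert s A)
  interpret V: abelian_monoid "Ext1 R X Y" by (rule Ext1_abelian_monoid)
  have c: "cls Y (\<phi> i) \<in> carrier (Ext1 R X Y)" if "i \<in> insert s A" for i
    using insert.prems that by (auto simp: Ext1_carrier)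
  have l: "lin R Ker Y (\<lambda>k. finsum Y (\<lambda>s. \<phi> s k) A)"
    by (rule lin_finsum_fun [OF Ker Y]) (use insert in auto)
  have "finsum (Ext1 R X Y) (\<lambda>s. cls Y (\<phi> s)) (insert s A) =
      cls Y (\<phi> s) \<oplus>\<^bsub>Ext1 R X Y\<^esub> finsum (Ext1 R X Y) (\<lambda>s. cls Y (\<phi> s)) A"
    using insert.hyps c by (intro V.finsum_insert) auto
  also have "\<dots> = cls Y (\<lambda>k. \<phi> s k \<oplus>\<^bsub>Y\<^esub> finsum Y (\<lambda>s. \<phi> s k) A)"
    using insert l by (simp add: Ext1_add)
  also have "\<dots> = cls Y (\<lambda>k. finsum Y (\<lambda>s. \<phi> s k) (insert s A))"
  proof (rule cls_cong)
    fix k assume "k \<in> carrier Ker"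
    then show "\<phi> s k \<oplus>\<^bsub>Y\<^esub> finsum Y (\<lambda>s. \<phi> s k) A = finsum Y (\<lambda>s. \<phi> s k) (insert s A)"
      using insert.hyps lin_closed [OF insert.prems(1)] by (subst Y.M.finsum_insert) auto
  qed
  finally show ?case .
qed

lemma cls_eq_iff:
  assumes \<phi>: "lin R Ker Y \<phi>" and \<psi>: "lin R Ker Y \<psi>"
  shows "cls Y \<phi> = cls Y \<psi> \<longleftrightarrow> (\<exists>\<chi>. lin R F Y \<chi> \<and> (\<forall>k\<in>carrier Ker. \<phi> k \<ominus>\<^bsub>Y\<^esub> \<psi> k = \<chi> k))"
proof
  assume eq: "cls Y \<phi> = cls Y \<psi>"
  obtain E where E0: "E \<in> cls Y \<phi>" using cls_nonempty [OF \<phi>] .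
  then have E: "is_extn R X Y E" and r: "rep \<phi> E (\<lambda>x. x)" "rep \<psi> E (\<lambda>x. x)" using eq by (auto simp: cls_def)
  note D = is_extnD [OF E]
  interpret M: left_module R "mid E" by (rule D)
  interpret X: left_module R X by (rule D)
  from r(1) obtain g where g: "lin R F (mid E) g" "\<And>x. x \<in> carrier F \<Longrightarrow> proj E (g x) = p x"
    "\<And>k. k \<in> carrier Ker \<Longrightarrow> g k = incl E (\<phi> k)" by (rule repE) blast
  from r(2) obtain g' where g': "lin R F (mid E) g'" "\<And>x. x \<in> carrier F \<Longrightarrow> proj E (g' x) = p x"
    "\<And>k. k \<in> carrier Ker \<Longrightarrow> g' k = incl E (\<psi> k)" by (rule repE) blast
  have d: "lin R F (mid E) (\<lambda>x. g x \<ominus>\<^bsub>mid E\<^esub> g' x)" by (rule lin_minus_fun [OF F D(2) g(1) g'(1)])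
  have "\<exists>y\<in>carrier Y. incl E y = g x \<ominus>\<^bsub>mid E\<^esub> g' x" if x: "x \<in> carrier F" for x
    using lin_closed [OF g(1) x] lin_closed [OF g'(1) x] lin_closed [OF p x]
    by (intro D(10)) (simp_all add: lin_diff [OF D(2,3,5)] g g' x)
  from lin_through_inj [OF F D(1,2,4,6) d this] obtain \<chi> where
    \<chi>: "lin R F Y \<chi>" "\<And>x. x \<in> carrier F \<Longrightarrow> incl E (\<chi> x) = g x \<ominus>\<^bsub>mid E\<^esub> g' x" by blast
  have "\<phi> k \<ominus>\<^bsub>Y\<^esub> \<psi> k = \<chi> k" if k: "k \<in> carrier Ker" for k
  proof -
    note kc = lin_closed [OF \<phi> k] lin_closed [OF \<psi> k]
    have "incl E (\<phi> k \<ominus>\<^bsub>Y\<^esub> \<psi> k) = incl E (\<chi> k)"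
      using \<chi>(2) [OF Ker_F [OF k]] kc by (simp add: lin_diff [OF D(1,2,4)] g(3) g'(3) k)
    then show ?thesis using kc lin_closed [OF \<chi>(1) Ker_F [OF k]] by (intro inj_onD [OF D(6)]) auto
  qed
  with \<chi>(1) show "\<exists>\<chi>. lin R F Y \<chi> \<and> (\<forall>k\<in>carrier Ker. \<phi> k \<ominus>\<^bsub>Y\<^esub> \<psi> k = \<chi> k)" by blast
next
  assume "\<exists>\<chi>. lin R F Y \<chi> \<and> (\<forall>k\<in>carrier Ker. \<phi> k \<ominus>\<^bsub>Y\<^esub> \<psi> k = \<chi> k)"
  then obtain \<chi> where \<chi>: "lin R F Y \<chi>" "\<And>k. k \<in> carrier Ker \<Longrightarrow> \<phi> k \<ominus>\<^bsub>Y\<^esub> \<psi> k = \<chi> k" by blast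
  obtain E where E0: "E \<in> cls Y \<psi>" using cls_nonempty [OF \<psi>] .
  then have E: "is_extn R X Y E" and r: "rep \<psi> E (\<lambda>x. x)" by (auto simp: cls_def)
  note D = is_extnD [OF E]
  interpret X: left_module R X by (rule D)
  have "rep (\<lambda>k. \<chi> k) E (\<lambda>x. \<zero>\<^bsub>X\<^esub>)"
    by (rule repI [OF lin_comp [OF \<chi>(1) D(4)]]) (simp_all add: D(9) lin_closed [OF \<chi>(1)])
  from rep_add [OF E lin_Ker [OF \<chi>(1)] this \<psi> r]
  have "rep \<phi> E (\<lambda>x. x)"
  proof (rule rep_cong)
    show "\<chi> k \<oplus>\<^bsub>Y\<^esub> \<psi> k = \<phi> k" if "k \<in> carrier Ker" for k
      using \<chi>(2) [OF that, symmetric] lin_closed [OF \<phi> that] lin_closed [OF \<psi> that] by simp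
  qed simp
  then show "cls Y \<phi> = cls Y \<psi>"
    using extn_class_eq_cls [OF E \<phi>] extn_class_eq_cls [OF E \<psi> r] by simp
qed

end

end

section \<open>Universal sequences\<close>

lemma liso_lin: "f \<in> liso R M N \<Longrightarrow> lin R M N f"
  and liso_inj: "f \<in> liso R M N \<Longrightarrow> inj_on f (carrier M)"
  and liso_surj: "f \<in> liso R M N \<Longrightarrow> f ` carrier M = carrier N"
  by (auto simp: liso_def lhom_lin bij_betw_def)

lemma ex1_unique: "\<exists>!x. P x \<Longrightarrow> P a \<Longrightarrow> P b \<Longrightarrow> a = b"
  by auto

lemma direct_sum_decompose:
  assumes R: "ring R" and M: "\<And>k. k \<in> K \<Longrightarrow> left_module R (M k)"
    and f: "f \<in> carrier (direct_sum K M)" and A: "finite A" "A \<subseteq> K" "{k\<in>K. f k \<noteq> \<zero>\<^bsub>M k\<^esub>} \<subseteq> A"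
  shows "f = (\<Oplus>\<^bsub>direct_sum K M\<^esub>k\<in>A. single K M k (f k))"
proof -
  let ?D = "direct_sum K M"
  have D: "left_module R ?D" by (rule direct_sum_left_module [OF R M])
  have "copair K M ?D (single K M) f = f"
    by (rule lin_direct_sum_eq [OF R M D lin_copair [OF R M D lin_single [OF R M]] lin_id _ f])
      (simp_all add: copair_single [OF R M D lin_single [OF R M]])
  then show ?thesis using copair_superset [OF R M D lin_single [OF R M] f A] by simp
qed

lemma universal_map:
  fixes \<X> :: "('r, 'x) module set" and Y :: "('r, 'y) module"
    and S :: "('r, 'e, 'y, ('r, 'x) module \<times> ('r, 'y \<times> 'x, 'y, 'x) extn \<Rightarrow> 'x) extn"
  assumes B: "ext_bases R \<X> Y B" and S: "is_extn R (direct_sum (Sigma \<X> B) fst) Y S"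
    and eq: "equiv_extn R Y S (universal_extn \<X> Y B)"
    and XE: "X \<in> \<X>" "E \<in> B X"
  obtains a where "lin R (mid E) (mid S) a" "\<And>y. y \<in> carrier Y \<Longrightarrow> a (incl E y) = incl S y"
    "\<And>e. e \<in> carrier (mid E) \<Longrightarrow> proj S (a e) = single (Sigma \<X> B) fst (X, E) (proj E e)"
proof -
  note DS = is_extnD [OF S]
  have R: "ring R" using DS by (simp add: left_module_def)
  let ?K = "Sigma \<X> B"
  let ?k = "(X, E)"
  let ?U = "universal_extn \<X> Y B"
  have k: "?k \<in> ?K" using XE by simp
  have ext: "is_extn R (fst i) Y (snd i)" if "i \<in> ?K" for i
    using B that by (auto simp: ext_bases_def)
  let ?S = "sum_extn ?K (\<lambda>_. Y) snd"
  let ?YY = "direct_sum ?K (\<lambda>_. Y)"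
  have sum: "is_extn R (direct_sum ?K fst) ?YY ?S" by (rule is_extn_sum [OF R ext])
  note D = is_extnD [OF ext]
  from is_extn_pushout [OF sum DS(1) lin_summation_map(1) [OF DS(1)]] obtain a where
    a: "is_extn R (direct_sum ?K fst) Y ?U" "lin R (mid ?S) (mid ?U) a"
    "\<And>y. y \<in> carrier ?YY \<Longrightarrow> a (incl ?S y) = incl ?U (summation_map ?K Y y)"
    "\<And>e. e \<in> carrier (mid ?S) \<Longrightarrow> proj ?U (a e) = proj ?S e"
    unfolding universal_extn_def by blast
  note DU = is_extnD [OF a(1)]
  obtain c where c: "c \<in> liso R (mid S) (mid ?U)" "\<And>y. y \<in> carrier Y \<Longrightarrow> c (incl S y) = incl ?U y"
    "\<And>e. e \<in> carrier (mid S) \<Longrightarrow> proj ?U (c e) = proj S e"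
    using eq by (auto simp: equiv_extn_def)
  obtain b where b: "lin R (mid ?U) (mid S) b" "\<And>x. x \<in> carrier (mid S) \<Longrightarrow> b (c x) = x"
    "\<And>y. y \<in> carrier (mid ?U) \<Longrightarrow> c (b y) = y"
    using lin_inverse [OF DS(2) DU(2) liso_lin [OF c(1)] liso_inj [OF c(1)] liso_surj [OF c(1)]] by blast
  let ?m = "\<lambda>i. mid (snd i)"
  let ?s = "single ?K ?m ?k"
  have s: "lin R (mid E) (mid ?S) ?s"
    using lin_single [OF R, of ?K ?m ?k] D(2) k by (simp add: sum_extn_simps(1))
  have Yk: "single ?K (\<lambda>_. Y) ?k y \<in> carrier ?YY" if "y \<in> carrier Y" for y
    by (rule single_closed [OF R DS(1) k that])
  have sy: "?s (incl E y) = incl ?S (single ?K (\<lambda>_. Y) ?k y)" if y: "y \<in> carrier Y" for y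
    unfolding sum_extn_simps(2) [OF Yk [OF y]]
    by (rule extensionalityI [where A = ?K]) (auto simp: single_def lin_zero [OF D(1) D(2) D(4)])
  have sp: "proj ?S (?s e) = single ?K fst ?k (proj E e)" if e: "e \<in> carrier (mid E)" for e
  proof -
    have "?s e \<in> carrier (direct_sum ?K ?m)" using lin_closed [OF s e] by (simp add: sum_extn_simps(1))
    from sum_extn_simps(3) [OF this] show ?thesis
      by (intro extensionalityI [where A = ?K]) (auto simp: single_def lin_zero [OF D(2) D(3) D(5)])
  qed
  show thesis
  proof (rule that [OF lin_comp [OF lin_comp [OF s a(2)] b(1)]])
    fix y assume y: "y \<in> carrier Y"
    have "a (?s (incl E y)) = incl ?U y"
      using sy [OF y] a(3) [OF Yk [OF y]] lin_summation_map(2) [OF DS(1) k y] by simp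
    then show "b (a (?s (incl E y))) = incl S y"
      using b(2) [OF lin_closed [OF DS(4) y]] c(2) [OF y] by simp
  next
    fix e assume e: "e \<in> carrier (mid E)"
    have ae: "a (?s e) \<in> carrier (mid ?U)" using lin_closed [OF lin_comp [OF s a(2)] e] .
    have "proj S (b (a (?s e))) = proj ?U (a (?s e))"
      using c(3) [OF lin_closed [OF b(1) ae]] b(3) [OF ae] by simp
    then show "proj S (b (a (?s e))) = single ?K fst ?k (proj E e)"
      using a(4) [OF lin_closed [OF s e]] sp [OF e] by simp
  qed
qed

context free_cover
begin

lemma basis_combination:
  fixes \<X> :: "('r, 'x) module set" and Y :: "('r, 'y) module"
    and S :: "('r, 'e, 'y, ('r, 'x) module \<times> ('r, 'y \<times> 'x, 'y, 'x) extn \<Rightarrow> 'x) extn"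
  assumes B: "ext_bases R \<X> Y B" and S: "is_extn R (direct_sum (Sigma \<X> B) fst) Y S"
    and eq: "equiv_extn R Y S (universal_extn \<X> Y B)"
    and XX: "X \<in> \<X>" and A: "finite A"
    and e: "\<And>s. s \<in> A \<Longrightarrow> e s \<in> B X" "\<And>s. s \<in> A \<Longrightarrow> extn_class R X Y (e s) = s"
    and c: "\<And>s. s \<in> A \<Longrightarrow> lin R X X (c s)"
  obtains \<theta> where "lin R Ker Y \<theta>" "finsum (Ext1 R X Y) (\<lambda>s. c s \<odot>\<^bsub>Ext1 R X Y\<^esub> s) A = cls Y \<theta>"
    "rep \<theta> S (\<lambda>x. finsum (direct_sum (Sigma \<X> B) fst) (\<lambda>s. single (Sigma \<X> B) fst (X, e s) (c s x)) A)"
proof -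
  note DS = is_extnD [OF S]
  let ?K = "Sigma \<X> B"
  let ?Q = "direct_sum ?K fst"
  let ?V = "Ext1 R X Y"
  have ext: "is_extn R X Y (e s)" if "s \<in> A" for s using B XX e(1) [OF that] by (auto simp: ext_bases_def)
  have mods: "left_module R (fst i)" if "i \<in> ?K" for i
  proof -
    have "is_extn R (fst i) Y (snd i)" using B that by (auto simp: ext_bases_def)
    then show ?thesis by (rule is_extnD(3))
  qed
  have "\<exists>\<phi>. lin R Ker Y \<phi> \<and> rep \<phi> (e s) (\<lambda>x. x)" if "s \<in> A" for s
    using rep_exists [OF ext [OF that] lin_id] by blast
  then obtain \<phi> where \<phi>: "\<And>s. s \<in> A \<Longrightarrow> lin R Ker Y (\<phi> s)" "\<And>s. s \<in> A \<Longrightarrow> rep (\<phi> s) (e s) (\<lambda>x. x)"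
    by metis
  have "\<exists>t. lin R F F t \<and> lin R Ker Ker t \<and> (\<forall>x\<in>carrier F. p (t x) = c s (p x))" if "s \<in> A" for s
    using End_lift [OF c [OF that]] by metis
  then obtain t where t: "\<And>s. s \<in> A \<Longrightarrow> lin R F F (t s)" "\<And>s. s \<in> A \<Longrightarrow> lin R Ker Ker (t s)"
    "\<And>s x. s \<in> A \<Longrightarrow> x \<in> carrier F \<Longrightarrow> p (t s x) = c s (p x)" by metis
  have \<phi>t: "lin R Ker Y (\<lambda>k. \<phi> s (t s k))" if "s \<in> A" for s
    by (rule lin_comp [OF t(2) [OF that] \<phi>(1) [OF that]])
  have cs: "c s \<odot>\<^bsub>?V\<^esub> s = cls Y (\<lambda>k. \<phi> s (t s k))" if s: "s \<in> A" for s
  proof -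
    have "s = cls Y (\<phi> s)" using extn_class_eq_cls [OF ext [OF s] \<phi>(1) [OF s] \<phi>(2) [OF s]] e(2) [OF s] by simp
    then show ?thesis using Ext1_smult [OF DS(1) \<phi>(1) [OF s] c [OF s] t(1,2) [OF s] t(3) [OF s]] by metis
  qed
  show thesis
  proof (rule that)
    let ?\<theta> = "\<lambda>k. finsum Y (\<lambda>s. \<phi> s (t s k)) A"
    show "lin R Ker Y ?\<theta>" by (rule lin_finsum_fun [OF Ker DS(1) A \<phi>t])
    interpret V: abelian_monoid ?V by (rule Ext1_abelian_monoid [OF DS(1)])
    have "finsum ?V (\<lambda>s. c s \<odot>\<^bsub>?V\<^esub> s) A = finsum ?V (\<lambda>s. cls Y (\<lambda>k. \<phi> s (t s k))) A"
      by (rule V.finsum_cong') (use \<phi>t cs in \<open>auto simp: Ext1_carrier [OF DS(1)]\<close>)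
    also have "\<dots> = cls Y ?\<theta>" by (rule Ext1_finsum [OF DS(1) A \<phi>t])
    finally show "finsum ?V (\<lambda>s. c s \<odot>\<^bsub>?V\<^esub> s) A = cls Y ?\<theta>" .
    show "rep ?\<theta> S (\<lambda>x. finsum ?Q (\<lambda>s. single ?K fst (X, e s) (c s x)) A)"
    proof (rule rep_finsum [OF S A \<phi>t])
      fix s assume s: "s \<in> A"
      have k: "(X, e s) \<in> ?K" using XX e(1) [OF s] by simp
      have l: "lin R X ?Q (single ?K fst (X, e s))" using lin_single [where K = ?K and M = fst, OF R mods k] by simp
      show "lin R X ?Q (\<lambda>x. single ?K fst (X, e s) (c s x))" by (rule lin_comp [OF c [OF s] l])
      obtain a where a: "lin R (mid (e s)) (mid S) a" "\<And>y. y \<in> carrier Y \<Longrightarrow> a (incl (e s) y) = incl S y"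
        "\<And>m. m \<in> carrier (mid (e s)) \<Longrightarrow> proj S (a m) = single ?K fst (X, e s) (proj (e s) m)"
        using universal_map [OF B S eq XX e(1) [OF s]] by blast
      have r1: "rep (\<phi> s) S (\<lambda>x. single ?K fst (X, e s) x)"
        by (rule rep_map [OF \<phi>(2) [OF s] \<phi>(1) [OF s] lin_id a])
      show "rep (\<lambda>k. \<phi> s (t s k)) S (\<lambda>x. single ?K fst (X, e s) (c s x))"
        by (rule rep_comp [OF r1 t(1) [OF s] c [OF s] t(3) [OF s]])
    qed
  qed
qed

lemma universal_seq_extend:
  fixes \<X> :: "('r, 'x) module set" and Y :: "('r, 'y) module"
  assumes S: "universal_seq R \<X> Y S" and XX: "X \<in> \<X>" and \<psi>: "lin R Ker Y \<psi>"
  obtains g where "lin R F (mid S) g" "\<And>k. k \<in> carrier Ker \<Longrightarrow> g k = incl S (\<psi> k)"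
proof -
  obtain B where B: "ext_bases R \<X> Y B" "is_extn R (direct_sum (Sigma \<X> B) fst) Y S"
    "equiv_extn R Y S (universal_extn \<X> Y B)"
    using S by (auto simp: universal_seq_def)
  note DS = is_extnD [OF B(2)]
  interpret Y: left_module R Y by (rule DS)
  let ?V = "Ext1 R X Y" and ?D = "End_ring R X" and ?cl = "extn_class R X Y"
  have basis: "is_basis ?D ?V (?cl ` B X)" using B(1) XX by (simp add: ext_bases_def)
  have "cls Y \<psi> \<in> carrier ?V" using \<psi> by (auto simp: Ext1_carrier [OF DS(1)])
  then have "\<exists>!c. c \<in> carrier (free_module ?D (?cl ` B X)) \<and>
      cls Y \<psi> = (\<Oplus>\<^bsub>?V\<^esub> s \<in> {s \<in> ?cl ` B X. c s \<noteq> \<zero>\<^bsub>?D\<^esub>}. c s \<odot>\<^bsub>?V\<^esub> s)"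
    using basis unfolding is_basis_def by (elim conjE) (rule bspec)
  then obtain c where c: "c \<in> carrier (free_module ?D (?cl ` B X))"
    "cls Y \<psi> = (\<Oplus>\<^bsub>?V\<^esub> s \<in> {s \<in> ?cl ` B X. c s \<noteq> \<zero>\<^bsub>?D\<^esub>}. c s \<odot>\<^bsub>?V\<^esub> s)"
    by (elim ex1E conjE)
  define A where "A = {s \<in> ?cl ` B X. c s \<noteq> \<zero>\<^bsub>?D\<^esub>}"
  have A: "finite A" using c(1) by (simp add: A_def free_module_def direct_sum_carrier regular_module_def)
  have cl: "lin R X X (c s)" if "s \<in> A" for s
    using c(1) that by (auto simp: A_def free_module_def direct_sum_carrier regular_module_def End_ring_def intro: lhom_lin)
  let ?e = "inv_into (B X) ?cl"
  have e: "?e s \<in> B X" "?cl (?e s) = s" if "s \<in> A" for s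
    using that by (auto simp: A_def inv_into_into f_inv_into_f)
  obtain \<theta> where \<theta>: "lin R Ker Y \<theta>" "finsum ?V (\<lambda>s. c s \<odot>\<^bsub>?V\<^esub> s) A = cls Y \<theta>"
    "rep \<theta> S (\<lambda>x. finsum (direct_sum (Sigma \<X> B) fst) (\<lambda>s. single (Sigma \<X> B) fst (X, ?e s) (c s x)) A)"
    using basis_combination [where c = c and e = ?e, OF B XX A e cl] by blast
  have "cls Y \<psi> = cls Y \<theta>" using c(2) \<theta>(2) by (simp add: A_def)
  then obtain \<chi> where \<chi>: "lin R F Y \<chi>" "\<And>k. k \<in> carrier Ker \<Longrightarrow> \<psi> k \<ominus>\<^bsub>Y\<^esub> \<theta> k = \<chi> k"
    using cls_eq_iff [OF DS(1) \<psi> \<theta>(1)] by blast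
  from \<theta>(3) obtain g where g: "lin R F (mid S) g" "\<And>k. k \<in> carrier Ker \<Longrightarrow> g k = incl S (\<theta> k)"
    by (rule repE) blast
  show thesis
  proof (rule that [OF lin_plus [OF F DS(2) lin_comp [OF \<chi>(1) DS(4)] g(1)]])
    fix k assume k: "k \<in> carrier Ker"
    have "incl S (\<chi> k \<oplus>\<^bsub>Y\<^esub> \<theta> k) = incl S (\<psi> k)"
      using \<chi>(2) [OF k, symmetric] lin_closed [OF \<psi> k] lin_closed [OF \<theta>(1) k] by simp
    then show "incl S (\<chi> k) \<oplus>\<^bsub>mid S\<^esub> g k = incl S (\<psi> k)"
      using g(2) [OF k] lin_add [OF DS(4) lin_closed [OF \<chi>(1) Ker_F [OF k]] lin_closed [OF \<theta>(1) k]] by simp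
  qed
qed

lemma universal_seq_hom:
  fixes \<X> :: "('r, 'x) module set" and Y :: "('r, 'y) module"
  assumes S: "universal_seq R \<X> Y S" and semi: "semibrick R \<X>" and XX: "X \<in> \<X>"
    and l: "lin R X (mid S) l" and x: "x \<in> carrier X"
  obtains y where "y \<in> carrier Y" "incl S y = l x"
proof -
  obtain B where B: "ext_bases R \<X> Y B" "is_extn R (direct_sum (Sigma \<X> B) fst) Y S"
    "equiv_extn R Y S (universal_extn \<X> Y B)"
    using S by (auto simp: universal_seq_def)
  note DS = is_extnD [OF B(2)]
  interpret Y: left_module R Y by (rule DS)
  interpret X: left_module R X by (rule X)
  let ?V = "Ext1 R X Y" and ?D = "End_ring R X" and ?cl = "extn_class R X Y"
  let ?K = "Sigma \<X> B"
  let ?Q = "direct_sum ?K fst"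
  let ?S0 = "?cl ` B X"
  have mods: "left_module R (fst i)" if "i \<in> ?K" for i
  proof -
    have "is_extn R (fst i) Y (snd i)" using B that by (auto simp: ext_bases_def)
    then show ?thesis by (rule is_extnD(3))
  qed
  have basis: "is_basis ?D ?V ?S0" and inj: "inj_on ?cl (B X)" using B(1) XX by (simp_all add: ext_bases_def)
  define h where "h x = proj S (l x)" for x
  have h: "lin R X ?Q h" unfolding h_def by (rule lin_comp [OF l DS(5)])
  have hk: "lin R X (fst k) (\<lambda>x. h x k)" if "k \<in> ?K" for k
    by (rule lin_comp [OF h lin_component [OF that]])
  have off: "h x k = \<zero>\<^bsub>fst k\<^esub>" if "k \<in> ?K" "fst k \<noteq> X" "x \<in> carrier X" for k x
  proof -
    have "restrict (\<lambda>x. h x k) (carrier X) \<in> lhom R X (fst k)" by (rule lin_restrict [OF X hk [OF that(1)]])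
    then have "restrict (\<lambda>x. h x k) (carrier X) = zero_hom X (fst k)"
      using semi XX that(1,2) unfolding semibrick_def by force
    from fun_cong [OF this, of x] show ?thesis using that(3) by (simp add: zero_hom_def)
  qed
  obtain A0 where A0: "finite A0" "A0 \<subseteq> ?K"
    "\<And>x k. \<lbrakk>x \<in> carrier F; k \<in> ?K - A0\<rbrakk> \<Longrightarrow> h (p x) k = \<zero>\<^bsub>fst k\<^esub>"
    using free_module_finite_support [where K = ?K and M = fst, OF R mods lin_comp [OF p h]] by blast
  have A0': "h x k = \<zero>\<^bsub>fst k\<^esub>" if "x \<in> carrier X" "k \<in> ?K - A0" for x k
    using A0(3) [OF _ that(2)] p_surj that(1) by (metis imageE)
  let ?e = "inv_into (B X) ?cl"
  have e: "?e s \<in> B X" "?cl (?e s) = s" if "s \<in> ?S0" for s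
    using that by (auto simp: inv_into_into f_inv_into_f)
  have ecl: "?e (?cl E) = E" if "E \<in> B X" for E using inj that by simp
  have eK: "(X, ?e s) \<in> ?K" if "s \<in> ?S0" for s using e(1) [OF that] XX by simp
  define c where "c = (\<lambda>s\<in>?S0. restrict (\<lambda>x. h x (X, ?e s)) (carrier X))"
  have cl: "c s \<in> lhom R X X" if "s \<in> ?S0" for s
    using lin_restrict [OF X hk [OF eK [OF that]]] that by (simp add: c_def)
  have cx: "c s x = h x (X, ?e s)" if "s \<in> ?S0" "x \<in> carrier X" for s x using that by (simp add: c_def)
  define A where "A = {s \<in> ?S0. c s \<noteq> \<zero>\<^bsub>?D\<^esub>}"
  have AS: "A \<subseteq> ?S0" by (auto simp: A_def)
  have inj_e: "inj_on (\<lambda>s. (X, ?e s)) A"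
  proof (rule inj_onI)
    fix s s' assume s: "s \<in> A" "s' \<in> A" "(X, ?e s) = (X, ?e s')"
    then have "?e s = ?e s'" by simp
    then have "?cl (?e s) = ?cl (?e s')" by (rule arg_cong)
    moreover have "s \<in> ?S0" "s' \<in> ?S0" using s(1,2) AS by blast+
    ultimately show "s = s'" by (simp only: e(2))
  qed
  have "(\<lambda>s. (X, ?e s)) ` A \<subseteq> A0"
  proof (rule ccontr)
    assume "\<not> (\<lambda>s. (X, ?e s)) ` A \<subseteq> A0"
    then obtain s where s: "s \<in> A" "(X, ?e s) \<notin> A0" by blast
    then have sS: "s \<in> ?S0" using AS by blast
    have "h x (X, ?e s) = \<zero>\<^bsub>X\<^esub>" if "x \<in> carrier X" for x
      using A0' [OF that, of "(X, ?e s)"] eK [OF sS] s(2) by simp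
    then have "c s = zero_hom X X" using sS by (auto simp: c_def zero_hom_def restrict_def fun_eq_iff)
    then show False using s by (simp add: A_def End_ring_def)
  qed
  then have A: "finite A" by (rule finite_imageD [OF finite_subset [OF _ A0(1)] inj_e])
  note eA = e [OF subsetD [OF AS]]
  note clA = cl [OF subsetD [OF AS]]
  have cfree: "c \<in> carrier (free_module ?D ?S0)"
    using A cl by (auto simp: free_module_def direct_sum_carrier regular_module_def A_def c_def End_ring_def)
  obtain \<theta> where \<theta>: "lin R Ker Y \<theta>" "finsum ?V (\<lambda>s. c s \<odot>\<^bsub>?V\<^esub> s) A = cls Y \<theta>"
    "rep \<theta> S (\<lambda>x. finsum ?Q (\<lambda>s. single ?K fst (X, ?e s) (c s x)) A)"
    using basis_combination [where c = c and e = ?e, OF B XX A eA lhom_lin [OF clA]] by blast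
  have Qm: "left_module R ?Q" by (rule DS(3))
  interpret Q: left_module R ?Q by (rule Qm)
  have supp: "{k \<in> ?K. h x k \<noteq> \<zero>\<^bsub>fst k\<^esub>} \<subseteq> (\<lambda>s. (X, ?e s)) ` A" if x: "x \<in> carrier X" for x
  proof
    fix k assume k: "k \<in> {k \<in> ?K. h x k \<noteq> \<zero>\<^bsub>fst k\<^esub>}"
    then have kX: "fst k = X" using off x by blast
    then obtain E where E: "k = (X, E)" "E \<in> B X" using k by (cases k) auto
    define s where "s = ?cl E"
    have s: "s \<in> ?S0" "?e s = E" using E(2) ecl by (auto simp: s_def)
    have "c s x \<noteq> zero_hom X X x" using cx [OF s(1) x] s(2) k E x by (simp add: zero_hom_def)
    then have "s \<in> A" using s(1) by (auto simp: A_def End_ring_def)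
    then show "k \<in> (\<lambda>s. (X, ?e s)) ` A" using s(2) E(1) by blast
  qed
  have hsum: "finsum ?Q (\<lambda>s. single ?K fst (X, ?e s) (c s x)) A = h x" if x: "x \<in> carrier X" for x
  proof -
    have im: "finite ((\<lambda>s. (X, ?e s)) ` A)" "(\<lambda>s. (X, ?e s)) ` A \<subseteq> ?K" using A eK AS by blast+
    have cl2: "(\<lambda>k. single ?K fst k (h x k)) \<in> (\<lambda>s. (X, ?e s)) ` A \<rightarrow> carrier ?Q"
      using im(2) single_closed [where K = ?K and M = fst, OF R mods] direct_sum_component [OF lin_closed [OF h x]] by blast
    have "h x = finsum ?Q (\<lambda>k. single ?K fst k (h x k)) ((\<lambda>s. (X, ?e s)) ` A)"
      by (rule direct_sum_decompose [where K = ?K and M = fst, OF R mods lin_closed [OF h x] im supp [OF x]])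
    also have "\<dots> = finsum ?Q (\<lambda>s. single ?K fst (X, ?e s) (h x (X, ?e s))) A"
      by (rule Q.M.finsum_reindex [OF cl2 inj_e])
    also have "\<dots> = finsum ?Q (\<lambda>s. single ?K fst (X, ?e s) (c s x)) A"
    proof (rule Q.M.finsum_cong')
      show "(\<lambda>s. single ?K fst (X, ?e s) (c s x)) \<in> A \<rightarrow> carrier ?Q"
        using cl2 cx [OF subsetD [OF AS] x] by (simp add: Pi_iff)
      show "single ?K fst (X, ?e s) (h x (X, ?e s)) = single ?K fst (X, ?e s) (c s x)" if "s \<in> A" for s
        by (simp only: cx [OF subsetD [OF AS that] x])
    qed simp
    finally show ?thesis by simp
  qed
  have "rep \<theta> S h" by (rule rep_cong [OF \<theta>(3) _ hsum]) simp_all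
  then obtain \<chi> where \<chi>: "lin R F Y \<chi>" "\<And>k. k \<in> carrier Ker \<Longrightarrow> \<theta> k = \<chi> k"
    using iffD2 [OF rep_extends_iff [OF B(2) h \<theta>(1)]] l unfolding h_def by blast
  have z: "cls Y \<theta> = \<zero>\<^bsub>?V\<^esub>"
    unfolding Ext1_zero [OF DS(1)] cls_eq_iff [OF DS(1) \<theta>(1) lin_const_zero [OF Ker DS(1)]]
    using \<chi> lin_closed [OF \<theta>(1)] by (intro exI [of _ \<chi>]) auto
  interpret V: abelian_monoid ?V by (rule Ext1_abelian_monoid [OF DS(1)])
  let ?c0 = "\<lambda>s\<in>?S0. \<zero>\<^bsub>?D\<^esub>"
  have zl: "\<zero>\<^bsub>?D\<^esub> \<in> carrier ?D"
    using lin_restrict [OF X lin_const_zero [OF X X]] by (simp add: End_ring_def zero_hom_def)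
  have c0: "?c0 \<in> carrier (free_module ?D ?S0)"
    using zl by (auto simp: free_module_def direct_sum_carrier regular_module_def)
  have s0: "{s \<in> ?S0. ?c0 s \<noteq> \<zero>\<^bsub>?D\<^esub>} = {}" by auto
  have unique: "\<exists>!c. c \<in> carrier (free_module ?D ?S0) \<and>
      \<zero>\<^bsub>?V\<^esub> = (\<Oplus>\<^bsub>?V\<^esub> s \<in> {s\<in>?S0. c s \<noteq> \<zero>\<^bsub>?D\<^esub>}. c s \<odot>\<^bsub>?V\<^esub> s)"
    using basis V.zero_closed unfolding is_basis_def by (elim conjE) (rule bspec)
  have sum_c: "\<zero>\<^bsub>?V\<^esub> = (\<Oplus>\<^bsub>?V\<^esub> s \<in> {s\<in>?S0. c s \<noteq> \<zero>\<^bsub>?D\<^esub>}. c s \<odot>\<^bsub>?V\<^esub> s)"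
    using \<theta>(2) z unfolding A_def by simp
  have sum_c0: "\<zero>\<^bsub>?V\<^esub> = (\<Oplus>\<^bsub>?V\<^esub> s \<in> {s\<in>?S0. ?c0 s \<noteq> \<zero>\<^bsub>?D\<^esub>}. ?c0 s \<odot>\<^bsub>?V\<^esub> s)"
    unfolding s0 by simp
  have "c = ?c0"
    by (rule ex1_unique [OF unique]) (intro conjI cfree c0 sum_c sum_c0)+
  then have "A = {}" by (auto simp: A_def)
  then have "h x k = \<zero>\<^bsub>fst k\<^esub>" if "k \<in> ?K" for k using supp [OF x] that by blast
  then have "h x = \<zero>\<^bsub>?Q\<^esub>"
    using lin_closed [OF h x] by (intro extensionalityI [where A = ?K]) (auto simp: direct_sum_carrier)
  then have "proj S (l x) = \<zero>\<^bsub>?Q\<^esub>" by (simp only: h_def)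
  then show thesis using DS(10) [OF lin_closed [OF l x]] that by blast
qed

end

section \<open>Endomorphism rings\<close>

lemma End_ring_simps [simp]:
  "carrier (End_ring R M) = lhom R M M"
  "f \<otimes>\<^bsub>End_ring R M\<^esub> g = compose (carrier M) g f"
  "\<one>\<^bsub>End_ring R M\<^esub> = (\<lambda>x\<in>carrier M. x)"
  "\<zero>\<^bsub>End_ring R M\<^esub> = (\<lambda>x\<in>carrier M. \<zero>\<^bsub>M\<^esub>)"
  "f \<oplus>\<^bsub>End_ring R M\<^esub> g = (\<lambda>x\<in>carrier M. f x \<oplus>\<^bsub>M\<^esub> g x)"
  by (simp_all add: End_ring_def zero_hom_def)

lemma lhom_closed: "f \<in> lhom R M N \<Longrightarrow> x \<in> carrier M \<Longrightarrow> f x \<in> carrier N"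
  by (rule lin_closed [OF lhom_lin])

lemma lhom_compose:
  assumes "left_module R L" "f \<in> lhom R L M" "g \<in> lhom R M N"
  shows "compose (carrier L) g f \<in> lhom R L N"
  using lin_restrict [OF assms(1) lin_comp [OF lhom_lin [OF assms(2)] lhom_lin [OF assms(3)]]]
  by (simp add: compose_def)

lemma lhom_eqI:
  assumes "f \<in> lhom R M N" "g \<in> lhom R M N" "\<And>x. x \<in> carrier M \<Longrightarrow> f x = g x"
  shows "f = g"
  by (rule extensionalityI [where A = "carrier M"]) (use assms in \<open>auto simp: lhom_iff\<close>)

lemma End_ring_ring:
  assumes M: "left_module R M"
  shows "ring (End_ring R M)"
proof -
  interpret M: left_module R M by (rule M)
  have add: "(\<lambda>x\<in>carrier M. f x \<oplus>\<^bsub>M\<^esub> g x) \<in> lhom R M M" if "f \<in> lhom R M M" "g \<in> lhom R M M" for f g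
    by (rule lin_restrict [OF M lin_plus [OF M M lhom_lin [OF that(1)] lhom_lin [OF that(2)]]])
  have zero: "(\<lambda>x\<in>carrier M. \<zero>\<^bsub>M\<^esub>) \<in> lhom R M M"
    by (rule lin_restrict [OF M lin_const_zero [OF M M]])
  have one: "(\<lambda>x\<in>carrier M. x) \<in> lhom R M M"
    by (rule lin_restrict [OF M lin_id])
  note comp = lhom_compose [OF M]
  have uminus: "(\<lambda>x\<in>carrier M. \<zero>\<^bsub>M\<^esub> \<ominus>\<^bsub>M\<^esub> f x) \<in> lhom R M M" if "f \<in> lhom R M M" for f
    by (rule lin_restrict [OF M lin_minus_fun [OF M M lin_const_zero [OF M M] lhom_lin [OF that]]])
  note c = lhom_closed [of _ R M M]
  show ?thesis
  proof (rule ringI)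
    show "abelian_group (End_ring R M)"
    proof (rule abelian_groupI)
      fix f assume f: "f \<in> carrier (End_ring R M)"
      show "\<exists>g\<in>carrier (End_ring R M). g \<oplus>\<^bsub>End_ring R M\<^esub> f = \<zero>\<^bsub>End_ring R M\<^esub>"
        using f uminus [of f] by (intro bexI [of _ "\<lambda>x\<in>carrier M. \<zero>\<^bsub>M\<^esub> \<ominus>\<^bsub>M\<^esub> f x"]) (auto simp: fun_eq_iff c)
      show "\<zero>\<^bsub>End_ring R M\<^esub> \<oplus>\<^bsub>End_ring R M\<^esub> f = f"
        using f add [OF zero, of f] by (intro lhom_eqI [of _ R M M]) (simp_all add: c)
    next
      fix f g assume "f \<in> carrier (End_ring R M)" "g \<in> carrier (End_ring R M)"
      then show "f \<oplus>\<^bsub>End_ring R M\<^esub> g = g \<oplus>\<^bsub>End_ring R M\<^esub> f"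
        by (auto simp: fun_eq_iff intro: M.M.a_comm c)
    qed (auto simp: add zero fun_eq_iff M.M.a_assoc c)
    show "monoid (End_ring R M)"
    proof (rule monoidI)
      fix f assume f: "f \<in> carrier (End_ring R M)"
      then show "\<one>\<^bsub>End_ring R M\<^esub> \<otimes>\<^bsub>End_ring R M\<^esub> f = f" "f \<otimes>\<^bsub>End_ring R M\<^esub> \<one>\<^bsub>End_ring R M\<^esub> = f"
        using comp [of "\<lambda>x\<in>carrier M. x" M f] comp [of f M "\<lambda>x\<in>carrier M. x"] one
        by (auto intro!: lhom_eqI [of _ R M M] simp: compose_eq c)
    next
      fix f g assume "f \<in> carrier (End_ring R M)" "g \<in> carrier (End_ring R M)"
      then show "f \<otimes>\<^bsub>End_ring R M\<^esub> g \<in> carrier (End_ring R M)" using comp [of f M g] by simp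
    next
      show "\<one>\<^bsub>End_ring R M\<^esub> \<in> carrier (End_ring R M)" using one by simp
    qed (auto simp: compose_def fun_eq_iff c)
  qed (auto simp: compose_def fun_eq_iff c lin_add [OF lhom_lin])
qed

lemma brick_left_module: "brick R X \<Longrightarrow> left_module R X"
  by (simp add: brick_def finitely_presented_def)

lemma brick_nonzero:
  assumes "brick R X"
  obtains x where "x \<in> carrier X" "x \<noteq> \<zero>\<^bsub>X\<^esub>"
proof -
  have "(\<lambda>x\<in>carrier X. x) \<noteq> (\<lambda>x\<in>carrier X. \<zero>\<^bsub>X\<^esub>)"
    using assms by (simp add: brick_def division_ring_def)
  then show thesis using that by (metis restrict_ext)
qed

lemma brick_endo_bij:
  assumes X: "brick R X" and f: "lin R X X f" and x: "x \<in> carrier X" "f x \<noteq> \<zero>\<^bsub>X\<^esub>"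
  shows "inj_on f (carrier X)" "f ` carrier X = carrier X"
proof -
  let ?f = "restrict f (carrier X)"
  have "?f \<in> lhom R X X" by (rule lin_restrict [OF brick_left_module [OF X] f])
  moreover have "?f \<noteq> (\<lambda>x\<in>carrier X. \<zero>\<^bsub>X\<^esub>)" using x by (metis restrict_apply')
  ultimately have "?f \<in> Units (End_ring R X)" using X by (simp add: brick_def division_ring_def)
  then obtain g where g: "g \<in> lhom R X X" "compose (carrier X) ?f g = (\<lambda>x\<in>carrier X. x)"
    "compose (carrier X) g ?f = (\<lambda>x\<in>carrier X. x)"
    by (auto simp: Units_def)
  have gf: "g (f x) = x" "f (g x) = x" if "x \<in> carrier X" for x
    using fun_cong [OF g(2), of x] fun_cong [OF g(3), of x] that lhom_closed [OF g(1) that] by (simp_all add: compose_def)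
  show "inj_on f (carrier X)" using gf(1) by (metis inj_onI)
  show "f ` carrier X = carrier X"
    using gf(2) lhom_closed [OF g(1)] lin_closed [OF f] by (metis image_subset_iff subsetI subset_antisym image_eqI)
qed

definition fg_cover :: "('r, 'a) ring_scheme \<Rightarrow> ('r, 'x) module \<Rightarrow> nat \<Rightarrow> ((nat \<Rightarrow> 'r) \<Rightarrow> 'x) \<Rightarrow> bool" where
  "fg_cover R X n p \<longleftrightarrow> free_cover R X n p \<and>
     (\<exists>(m::nat) f. lin R (free_module R {..<m}) (free_module R {..<n}) f \<and>
        f ` carrier (free_module R {..<m}) = carrier (free_cover.Ker R X n p))"

lemma brick_fg_cover:
  assumes "brick R X"
  obtains n p where "fg_cover R X n p"
proof -
  have X: "left_module R X" by (rule brick_left_module [OF assms])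
  obtain m n :: nat and f g where f: "f \<in> lhom R (free_module R {..<m}) (free_module R {..<n})"
    and g: "g \<in> lhom R (free_module R {..<n}) X"
    and fg: "f ` carrier (free_module R {..<m}) = {x \<in> carrier (free_module R {..<n}). g x = \<zero>\<^bsub>X\<^esub>}"
    and surj: "g ` carrier (free_module R {..<n}) = carrier X"
    using assms unfolding brick_def finitely_presented_def by (elim conjE exE) (rule that)
  have c: "free_cover R X n g" by (rule free_cover.intro [OF X lhom_lin [OF g] surj])
  have "fg_cover R X n g"
    unfolding fg_cover_def free_cover.Ker_def [OF c] using c lhom_lin [OF f] fg by auto
  then show thesis by (rule that)
qed

section \<open>Modules with a universal filtration\<close>

locale universal_filtration =
  fixes R :: "('r, 'a) ring_scheme" and \<X> :: "('r, 'm) module set" and Y :: "('r, 'm) module"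
    and M :: "('r, 'l) module" and Z :: "nat \<Rightarrow> 'l set" and j :: "'m \<Rightarrow> 'l"
    and K :: "nat \<Rightarrow> 'k set" and D :: "nat \<Rightarrow> 'k \<Rightarrow> ('r, 'm) module" and \<pi> :: "nat \<Rightarrow> 'l \<Rightarrow> 'k \<Rightarrow> 'm"
  assumes semi: "semibrick R \<X>" and pd: "\<And>X. X \<in> \<X> \<Longrightarrow> proj_dim_le_one R X"
    and Y: "Y \<in> \<X>" and M: "left_module R M"
    and Z: "\<And>i. submod R (Z i) M" and Z_Suc: "\<And>i. Z i \<subseteq> Z (Suc i)"
    and Z_cover: "\<And>x. x \<in> carrier M \<Longrightarrow> \<exists>i. x \<in> Z i"
    and j: "lin R Y M j" "inj_on j (carrier Y)" "j ` carrier Y = Z 0"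
    and extend: "\<And>X n p \<psi> i. \<lbrakk>X \<in> \<X>; free_cover R X n p; lin R (free_cover.Ker R X n p) M \<psi>;
       \<And>k. k \<in> carrier (free_cover.Ker R X n p) \<Longrightarrow> \<psi> k \<in> Z i\<rbrakk> \<Longrightarrow>
       \<exists>g. lin R (free_module R {..<n}) M g \<and> (\<forall>k\<in>carrier (free_cover.Ker R X n p). g k = \<psi> k) \<and>
         (\<forall>x\<in>carrier (free_module R {..<n}). g x \<in> Z (Suc i))"
    and hom: "\<And>X l x. \<lbrakk>X \<in> \<X>; lin R X M l; x \<in> carrier X\<rbrakk> \<Longrightarrow> l x \<in> Z 0"
    and D: "\<And>i k. k \<in> K i \<Longrightarrow> D i k \<in> \<X>"
    and \<pi>: "\<And>i. lin R (M\<lparr>carrier := Z (Suc i)\<rparr>) (direct_sum (K i) (D i)) (\<pi> i)"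
    and \<pi>_surj: "\<And>i. \<pi> i ` Z (Suc i) = carrier (direct_sum (K i) (D i))"
    and \<pi>_ker: "\<And>i z. z \<in> Z (Suc i) \<Longrightarrow> \<pi> i z = \<zero>\<^bsub>direct_sum (K i) (D i)\<^esub> \<longleftrightarrow> z \<in> Z i"
begin

interpretation M: left_module R M by (rule M)

lemma R: "ring R" using M by (simp add: left_module_def)

lemma X_brick: "X \<in> \<X> \<Longrightarrow> brick R X"
  using semi by (simp add: semibrick_def)

lemma X_left_module: "X \<in> \<X> \<Longrightarrow> left_module R X"
  by (rule brick_left_module [OF X_brick])

lemma Z_mono: "i \<le> i' \<Longrightarrow> Z i \<subseteq> Z i'"
  by (rule lift_Suc_mono_le [of Z, OF Z_Suc])

lemma Z_M: "z \<in> Z i \<Longrightarrow> z \<in> carrier M"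
  by (rule submod_subset [OF Z])

abbreviation ZM :: "nat \<Rightarrow> ('r, 'l) module" where "ZM i \<equiv> M\<lparr>carrier := Z i\<rparr>"
abbreviation Q :: "nat \<Rightarrow> ('r, 'k \<Rightarrow> 'm) module" where "Q i \<equiv> direct_sum (K i) (D i)"

lemma ZM: "left_module R (ZM i)" by (rule submod_left_module [OF M Z])

lemma ZM_M: "lin R (ZM i) M (\<lambda>x. x)" by (rule lin_submod_dom [OF Z lin_id])

lemma DX: "k \<in> K i \<Longrightarrow> left_module R (D i k)" by (rule X_left_module [OF D])

lemma Q: "left_module R (Q i)" by (rule direct_sum_left_module [OF R DX])

lemma \<pi>_surj': "\<pi> i ` carrier (ZM (Suc i)) = carrier (Q i)" using \<pi>_surj by simp

lemma \<pi>_diff: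
  assumes "x \<in> Z (Suc i)" "y \<in> Z (Suc i)" "\<pi> i x = \<pi> i y"
  shows "x \<ominus>\<^bsub>M\<^esub> y \<in> Z i"
proof -
  interpret Q: left_module R "Q i" by (rule Q)
  have xy: "x \<ominus>\<^bsub>ZM (Suc i)\<^esub> y = x \<ominus>\<^bsub>M\<^esub> y"
    using lin_diff [OF ZM M ZM_M, of x "Suc i" y] assms by simp
  have "\<pi> i (x \<ominus>\<^bsub>ZM (Suc i)\<^esub> y) = \<zero>\<^bsub>Q i\<^esub>"
    using lin_diff [OF ZM Q \<pi>, of x i y] lin_closed [OF \<pi>, of y i] assms Q.M.diff_eq_zero_iff by simp
  then show ?thesis
    using \<pi>_ker [OF submod_diff [OF M Z assms(1,2)]] by (simp add: xy)
qed

lemma ker_map_in_Z0: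
  assumes XX: "X \<in> \<X>" and c: "free_cover R X n p" and g: "lin R (free_module R {..<n}) M g"
    and z: "\<And>k. k \<in> carrier (free_cover.Ker R X n p) \<Longrightarrow> g k = \<zero>\<^bsub>M\<^esub>"
    and x: "x \<in> carrier (free_module R {..<n})"
  shows "g x \<in> Z 0"
proof -
  interpret free_cover R X n p by (rule c)
  obtain l where l: "lin R X M l" "\<And>x. x \<in> carrier F \<Longrightarrow> l (p x) = g x" using F_factor [OF M g z] by blast
  show ?thesis using hom [OF XX l(1) lin_closed [OF p x]] l(2) [OF x] by simp
qed

lemma trace:
  assumes XX: "X \<in> \<X>" and c: "free_cover R X n p" and g: "lin R (free_module R {..<n}) M g"
    and z: "\<And>k. k \<in> carrier (free_cover.Ker R X n p) \<Longrightarrow> g k \<in> Z i"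
    and x: "x \<in> carrier (free_module R {..<n})"
  shows "g x \<in> Z (Suc i)"
proof -
  interpret free_cover R X n p by (rule c)
  obtain g' where g': "lin R F M g'" "\<And>k. k \<in> carrier Ker \<Longrightarrow> g' k = g k"
    "\<And>x. x \<in> carrier F \<Longrightarrow> g' x \<in> Z (Suc i)"
    using extend [OF XX c lin_Ker [OF g] z] by blast
  have "g x \<ominus>\<^bsub>M\<^esub> g' x \<in> Z 0"
    by (rule ker_map_in_Z0 [OF XX c lin_minus_fun [OF F M g g'(1)] _ x])
      (simp add: g'(2) lin_closed [OF g] Ker_F)
  then have "g x \<ominus>\<^bsub>M\<^esub> g' x \<in> Z (Suc i)" using Z_mono [of 0 "Suc i"] by blast
  then show ?thesis by (rule submod_diff_right [OF M Z lin_closed [OF g x] g'(3) [OF x]])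
qed

lemma layer_generated:
  assumes N: "submod R N M" and ZN: "Z i \<subseteq> N"
    and gen: "\<And>X n p g x. \<lbrakk>X \<in> \<X>; fg_cover R X n p; lin R (free_module R {..<n}) M g;
       \<And>k. k \<in> carrier (free_cover.Ker R X n p) \<Longrightarrow> g k \<in> Z i; x \<in> carrier (free_module R {..<n})\<rbrakk> \<Longrightarrow> g x \<in> N"
  shows "Z (Suc i) \<subseteq> N"
proof
  fix z assume z: "z \<in> Z (Suc i)"
  have sN: "submod R (Z (Suc i) \<inter> N) (ZM (Suc i))"
    using Z [of "Suc i"] N by (auto simp: submod_def)
  have "\<pi> i z \<in> \<pi> i ` (Z (Suc i) \<inter> N)"
  proof (rule direct_sum_generated [where K = "K i" and M = "D i", OF R DX submod_image [OF ZM Q \<pi> sN]])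
    fix k x assume k: "k \<in> K i" and x: "x \<in> carrier (D i k)"
    obtain n p where c: "fg_cover R (D i k) n p" using brick_fg_cover [OF X_brick [OF D [OF k]]] by blast
    then have c': "free_cover R (D i k) n p" by (simp add: fg_cover_def)
    interpret free_cover R "D i k" n p by (rule c')
    let ?s = "single (K i) (D i) k"
    have s: "lin R (D i k) (Q i) ?s" by (rule lin_single [OF R DX k])
    obtain g where g: "lin R F (ZM (Suc i)) g" "\<And>x. x \<in> carrier F \<Longrightarrow> \<pi> i (g x) = ?s (p x)"
      using F_lift [OF ZM Q \<pi> \<pi>_surj' s] by blast
    have gZ: "g x \<in> Z (Suc i)" if "x \<in> carrier F" for x using lin_closed [OF g(1) that] by simp
    have "g k' \<in> Z i" if "k' \<in> carrier Ker" for k'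
      using that g(2) [of k'] \<pi>_ker [OF gZ, of k'] lin_zero [OF X Q s] by (simp add: Ker_iff del: direct_sum_simps)
    then have gN: "g x \<in> N" if "x \<in> carrier F" for x
      using gen [OF D [OF k] c lin_submod_incl [OF Z g(1)]] that by blast
    obtain y where "y \<in> carrier F" "x = p y" using p_surj x by (metis imageE)
    then show "?s x \<in> \<pi> i ` (Z (Suc i) \<inter> N)" using g(2) gZ gN by (metis IntI imageI)
  next
    show "\<pi> i z \<in> carrier (Q i)" using lin_closed [OF \<pi>, of z i] z by simp
  qed
  then obtain y where y: "y \<in> Z (Suc i)" "y \<in> N" "\<pi> i z = \<pi> i y" by blast
  then have "z \<ominus>\<^bsub>M\<^esub> y \<in> N" using \<pi>_diff [OF z y(1,3)] ZN by blast
  then show "z \<in> N" by (rule submod_diff_right [OF M N Z_M [OF z] y(2)])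
qed

lemma filtered_generated:
  assumes N: "submod R N M" and Z0: "Z 0 \<subseteq> N"
    and gen: "\<And>X n p g x i. \<lbrakk>X \<in> \<X>; fg_cover R X n p; lin R (free_module R {..<n}) M g; Z i \<subseteq> N;
       \<And>k. k \<in> carrier (free_cover.Ker R X n p) \<Longrightarrow> g k \<in> Z i; x \<in> carrier (free_module R {..<n})\<rbrakk> \<Longrightarrow> g x \<in> N"
  shows "carrier M \<subseteq> N"
proof -
  have "Z i \<subseteq> N" for i
  proof (induction i)
    case (Suc i)
    then show ?case by (intro layer_generated [OF N Suc]) (rule gen, assumption+)
  qed (rule Z0)
  then show ?thesis using Z_cover by blast
qed

lemma hom_onto_Z0:
  assumes XX: "X \<in> \<X>" and l: "lin R X M l" and x: "x \<in> carrier X" "l x \<noteq> \<zero>\<^bsub>M\<^esub>"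
  shows "inj_on l (carrier X)" "l ` carrier X = Z 0"
proof -
  have YM: "left_module R Y" by (rule X_left_module [OF Y])
  have XM: "left_module R X" by (rule X_left_module [OF XX])
  have "\<exists>y\<in>carrier Y. j y = l a" if "a \<in> carrier X" for a
    using hom [OF XX l that] j(3) by (metis imageE)
  from lin_through_inj [OF XM YM M j(1,2) l this] obtain f where
    f: "lin R X Y f" "\<And>a. a \<in> carrier X \<Longrightarrow> j (f a) = l a" by blast
  have fx: "f x \<noteq> \<zero>\<^bsub>Y\<^esub>" using f(2) x lin_zero [OF YM M j(1)] by metis
  have XY: "X = Y"
  proof (rule ccontr)
    assume "X \<noteq> Y"
    then have "restrict f (carrier X) = zero_hom X Y"
      using lin_restrict [OF XM f(1)] semi XX Y unfolding semibrick_def by blast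
    from fun_cong [OF this, of x] show False using fx x by (simp add: zero_hom_def)
  qed
  have b: "inj_on f (carrier X)" "f ` carrier X = carrier X"
    using brick_endo_bij [OF X_brick [OF XX] _ x(1)] f(1) fx unfolding XY by blast+
  show "inj_on l (carrier X)"
  proof (rule inj_onI)
    fix a b' assume "a \<in> carrier X" "b' \<in> carrier X" "l a = l b'"
    then show "a = b'" using f(2) inj_onD [OF j(2)] lin_closed [OF f(1)] inj_onD [OF b(1)] by metis
  qed
  have "l ` carrier X = j ` f ` carrier X" using f(2) by (simp add: image_image cong: image_cong_simp)
  then show "l ` carrier X = Z 0" using b(2) j(3) XY by simp
qed

context
  fixes f
  assumes f: "lin R M M f"
begin

lemma endo_Z: "z \<in> Z i \<Longrightarrow> f z \<in> Z i"
proof -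
  have "Z i \<subseteq> {x \<in> carrier M. f x \<in> Z i}" for i
  proof (induction i)
    case 0
    have fj: "f (j y) \<in> Z 0" if "y \<in> carrier Y" for y using hom [OF Y lin_comp [OF j(1) f] that] .
    show ?case
    proof
      fix z assume z: "z \<in> Z 0"
      then obtain y where "y \<in> carrier Y" "z = j y" using j(3) by (metis imageE)
      then show "z \<in> {x \<in> carrier M. f x \<in> Z 0}" using fj Z_M [OF z] by simp
    qed
  next
    case (Suc i)
    show ?case
    proof (rule layer_generated [OF submod_vimage [OF M M f Z]])
      show "Z i \<subseteq> {x \<in> carrier M. f x \<in> Z (Suc i)}" using Suc Z_Suc by blast
      fix X n p g x
      assume *: "X \<in> \<X>" "fg_cover R X n p" "lin R (free_module R {..<n}) M g"
        "\<And>k. k \<in> carrier (free_cover.Ker R X n p) \<Longrightarrow> g k \<in> Z i" "x \<in> carrier (free_module R {..<n})"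
      have c: "free_cover R X n p" using *(2) by (simp add: fg_cover_def)
      have "f (g x) \<in> Z (Suc i)"
        by (rule trace [OF *(1) c lin_comp [OF *(3) f] _ *(5)]) (use subsetD [OF Suc *(4)] in simp)
      then show "g x \<in> {x \<in> carrier M. f x \<in> Z (Suc i)}" using lin_closed [OF *(3,5)] by simp
    qed
  qed
  then show "z \<in> Z i \<Longrightarrow> f z \<in> Z i" by blast
qed

end

lemma divisible_cover:
  assumes XX: "X \<in> \<X>" and c: "fg_cover R X n p" and \<psi>: "lin R (free_cover.Ker R X n p) M \<psi>"
  obtains g where "lin R (free_module R {..<n}) M g"
    "\<And>k. k \<in> carrier (free_cover.Ker R X n p) \<Longrightarrow> g k = \<psi> k"
proof -
  have c': "free_cover R X n p" using c by (simp add: fg_cover_def)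
  interpret free_cover R X n p by (rule c')
  obtain m :: nat and f where f: "lin R (free_module R {..<m}) F f" "f ` carrier (free_module R {..<m}) = carrier Ker"
    using c by (auto simp: fg_cover_def)
  have fK: "lin R (free_module R {..<m}) Ker f"
    unfolding Ker_def by (rule lin_submod_cod [OF f(1)]) (use f(2) Ker_iff in blast)
  obtain i where i: "\<forall>x\<in>carrier (free_module R {..<m}). \<psi> (f x) \<in> Z i"
    using free_module_chain [where N = Z, OF M Z Z_mono lin_comp [OF fK \<psi>]
        Z_cover [OF lin_closed [OF lin_comp [OF fK \<psi>]]]] by blast
  then have "\<psi> k \<in> Z i" if "k \<in> carrier Ker" for k using f(2) that by (metis imageE)
  from extend [OF XX c' \<psi> this] show thesis using that by blast
qed

lemma divisible_extend:
  assumes XX: "X \<in> \<X>" and E: "short_exact R A i B q X" and \<phi>: "lin R A M \<phi>"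
  obtains \<chi> where "lin R B M \<chi>" "\<And>a. a \<in> carrier A \<Longrightarrow> \<chi> (i a) = \<phi> a"
proof -
  obtain n p where c: "fg_cover R X n p" using brick_fg_cover [OF X_brick [OF XX]] by blast
  then have c': "free_cover R X n p" by (simp add: fg_cover_def)
  interpret free_cover R X n p by (rule c')
  let ?E = "\<lparr>mid = B, incl = i, proj = q\<rparr>"
  have EE: "is_extn R X A ?E" using E by (simp add: is_extn_def)
  note S = short_exactD [OF E]
  obtain \<psi> where \<psi>: "lin R Ker A \<psi>" "rep \<psi> ?E (\<lambda>x. x)" using rep_exists [OF EE lin_id] by blast
  from \<psi>(2) obtain g where g: "lin R F B g" "\<And>x. x \<in> carrier F \<Longrightarrow> q (g x) = p x"
    "\<And>k. k \<in> carrier Ker \<Longrightarrow> g k = i (\<psi> k)" by (auto elim!: repE)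
  obtain g' where g': "lin R F M g'" "\<And>k. k \<in> carrier Ker \<Longrightarrow> g' k = \<phi> (\<psi> k)"
    using divisible_cover [OF XX c lin_comp [OF \<psi>(1) \<phi>]] by blast
  have surj: "(\<lambda>x. q (g x)) ` carrier F = carrier X" using p_surj g(2) by (metis (no_types, lifting) image_cong)
  have compat: "g' x = \<phi> a" if xa: "x \<in> carrier F" "a \<in> carrier A" "g x = i a" for x a
  proof -
    have k: "x \<in> carrier Ker" using xa g(2) [OF xa(1)] S(9) [OF xa(2)] by (simp add: Ker_iff)
    then have "\<psi> x = a" using g(3) [OF k] xa inj_onD [OF S(6)] lin_closed [OF \<psi>(1) k] by metis
    then show ?thesis using g'(2) [OF k] by simp
  qed
  show thesis
  proof (rule extn_glue [OF EE F M, where g = g and a = g' and b = \<phi>])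
    fix \<chi> assume "lin R (mid ?E) M \<chi>" "\<And>y. y \<in> carrier A \<Longrightarrow> \<chi> (incl ?E y) = \<phi> y"
    then show thesis by (intro that [of \<chi>]) simp_all
  qed (use g(1) surj g'(1) \<phi> compat in simp_all)
qed

lemma endo_image_all:
  assumes f: "lin R M M f" and Z0: "Z 0 \<subseteq> f ` carrier M"
  shows "f ` carrier M = carrier M"
proof
  show "f ` carrier M \<subseteq> carrier M" using lin_closed [OF f] by blast
  let ?I = "f ` carrier M"
  have I: "submod R ?I M" by (rule submod_image [OF M M f submod_carrier [OF M]])
  have IM: "left_module R (M\<lparr>carrier := ?I\<rparr>)" by (rule submod_left_module [OF M I])
  show "carrier M \<subseteq> ?I"
  proof (rule filtered_generated [OF I Z0])
    fix X n p g x i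
    assume XX: "X \<in> \<X>" and c: "fg_cover R X n p" and g: "lin R (free_module R {..<n}) M g"
      and ZI: "Z i \<subseteq> ?I" and gZ: "\<And>k. k \<in> carrier (free_cover.Ker R X n p) \<Longrightarrow> g k \<in> Z i"
      and x: "x \<in> carrier (free_module R {..<n})"
    have c': "free_cover R X n p" using c by (simp add: fg_cover_def)
    interpret free_cover R X n p by (rule c')
    interpret F: left_module R F by (rule F)
    interpret X: left_module R X by (rule X)
    obtain P1 P0 :: "('r, 'm \<Rightarrow> 'r) module" and i1 q where P: "projective_module R P1" "projective_module R P0"
      and S: "short_exact R P1 i1 P0 q X"
      using pd [OF XX] unfolding proj_dim_le_one_def by blast
    note S' = short_exactD [OF S]
    obtain a where a: "lin R P0 F a" "\<And>y. y \<in> carrier P0 \<Longrightarrow> p (a y) = q y"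
      using projective_module_lift [OF P(2) F X p p_surj S'(5)] by blast
    note ga = lin_comp [OF a(1) g]
    have "g (a (i1 y)) \<in> ?I" if y: "y \<in> carrier P1" for y
    proof -
      note iy = lin_closed [OF S'(4) y]
      have "a (i1 y) \<in> carrier Ker" using a(2) [OF iy] S'(9) [OF y] lin_closed [OF a(1) iy] by (simp add: Ker_iff)
      then show ?thesis using gZ ZI by blast
    qed
    then have gi: "lin R P1 (M\<lparr>carrier := ?I\<rparr>) (\<lambda>y. g (a (i1 y)))"
      by (intro lin_submod_cod [OF lin_comp [OF S'(4) ga]])
    have fI: "lin R M (M\<lparr>carrier := ?I\<rparr>) f" by (rule lin_submod_cod [OF f]) simp
    obtain b where b: "lin R P1 M b" "\<And>y. y \<in> carrier P1 \<Longrightarrow> f (b y) = g (a (i1 y))"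
      using projective_module_lift [OF P(1) M IM fI _ gi] by auto
    obtain b' where b': "lin R P0 M b'" "\<And>y. y \<in> carrier P1 \<Longrightarrow> b' (i1 y) = b y"
      using divisible_extend [OF XX S b(1)] by blast
    note fb = lin_comp [OF b'(1) f]
    note d = lin_minus_fun [OF S'(2) M ga fb]
    have dz: "g (a y) \<ominus>\<^bsub>M\<^esub> f (b' y) = \<zero>\<^bsub>M\<^esub>" if y: "y \<in> carrier P0" "q y = \<zero>\<^bsub>X\<^esub>" for y
    proof -
      obtain w where "w \<in> carrier P1" "i1 w = y" using S'(10) [OF y] by blast
      then have "f (b' y) = g (a y)" using b(2) b'(2) by metis
      then show ?thesis using lin_closed [OF ga y(1)] by simp
    qed
    from lin_factor [OF S'(2) X M S'(5,7) d dz] obtain l where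
      l: "lin R X M l" "\<And>y. y \<in> carrier P0 \<Longrightarrow> l (q y) = g (a y) \<ominus>\<^bsub>M\<^esub> f (b' y)" by blast
    obtain y where y: "y \<in> carrier P0" "q y = p x" using S'(11) [OF lin_closed [OF p x]] by blast
    note ay = lin_closed [OF a(1) y(1)] and gay = lin_closed [OF ga y(1)]
    have "g (a y) \<ominus>\<^bsub>M\<^esub> f (b' y) \<in> ?I" using hom [OF XX l(1) lin_closed [OF p x]] l(2) [OF y(1)] y(2) Z0 by auto
    moreover have "f (b' y) \<in> ?I" using lin_closed [OF b'(1) y(1)] by blast
    ultimately have 1: "g (a y) \<in> ?I" using submod_diff_right [OF M I gay] by blast
    have "p (x \<ominus>\<^bsub>F\<^esub> a y) = \<zero>\<^bsub>X\<^esub>"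
      using a(2) [OF y(1)] y(2) lin_closed [OF p x] x ay by (simp add: lin_diff [OF F X p])
    then have "x \<ominus>\<^bsub>F\<^esub> a y \<in> carrier Ker" using x ay by (simp add: Ker_iff)
    then have "g (x \<ominus>\<^bsub>F\<^esub> a y) \<in> ?I" using gZ ZI by blast
    then have "g x \<ominus>\<^bsub>M\<^esub> g (a y) \<in> ?I" using x ay by (simp add: lin_diff [OF F M g])
    then show "g x \<in> ?I" by (rule submod_diff_right [OF M I lin_closed [OF g x] 1])
  qed
qed

lemma endo_surj:
  assumes f: "lin R M M f" and nz: "x \<in> carrier M" "f x \<noteq> \<zero>\<^bsub>M\<^esub>"
  shows "f ` carrier M = carrier M"
proof (rule endo_image_all [OF f])
  show "Z 0 \<subseteq> f ` carrier M"
  proof (cases "\<exists>y\<in>carrier Y. f (j y) \<noteq> \<zero>\<^bsub>M\<^esub>")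
    case True
    then obtain y where y: "y \<in> carrier Y" "f (j y) \<noteq> \<zero>\<^bsub>M\<^esub>" by blast
    have "(\<lambda>y. f (j y)) ` carrier Y = Z 0" by (rule hom_onto_Z0(2) [OF Y lin_comp [OF j(1) f] y])
    then show ?thesis using lin_closed [OF j(1)] by blast
  next
    case False
    show ?thesis
    proof (rule ccontr)
      assume nI: "\<not> Z 0 \<subseteq> f ` carrier M"
      have "carrier M \<subseteq> {x \<in> carrier M. f x = \<zero>\<^bsub>M\<^esub>}"
      proof (rule filtered_generated [OF submod_ker [OF M M f]])
        show "Z 0 \<subseteq> {x \<in> carrier M. f x = \<zero>\<^bsub>M\<^esub>}"
        proof
          fix z assume z: "z \<in> Z 0"
          then obtain y where "y \<in> carrier Y" "z = j y" using j(3) by (metis imageE)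
          then show "z \<in> {x \<in> carrier M. f x = \<zero>\<^bsub>M\<^esub>}" using False Z_M [OF z] by simp
        qed
        fix X n p g x i
        assume XX: "X \<in> \<X>" and c: "fg_cover R X n p" and g: "lin R (free_module R {..<n}) M g"
          and ZK: "Z i \<subseteq> {x \<in> carrier M. f x = \<zero>\<^bsub>M\<^esub>}"
          and gZ: "\<And>k. k \<in> carrier (free_cover.Ker R X n p) \<Longrightarrow> g k \<in> Z i"
          and x: "x \<in> carrier (free_module R {..<n})"
        have c': "free_cover R X n p" using c by (simp add: fg_cover_def)
        interpret free_cover R X n p by (rule c')
        have "f (g k) = \<zero>\<^bsub>M\<^esub>" if "k \<in> carrier Ker" for k using gZ [OF that] ZK by blast
        from F_factor [OF M lin_comp [OF g f] this] obtain l where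
          l: "lin R X M l" "\<And>x. x \<in> carrier F \<Longrightarrow> l (p x) = f (g x)" by blast
        have "f (g x) = \<zero>\<^bsub>M\<^esub>"
        proof (rule ccontr)
          assume "f (g x) \<noteq> \<zero>\<^bsub>M\<^esub>"
          then have "l ` carrier X = Z 0"
            using hom_onto_Z0(2) [OF XX l(1) lin_closed [OF p x]] l(2) [OF x] by simp
          moreover have "l ` carrier X \<subseteq> f ` carrier M"
          proof (intro subsetI)
            fix w assume "w \<in> l ` carrier X"
            then obtain a where a: "a \<in> carrier F" "w = l (p a)" using p_surj by (metis imageE)
            then show "w \<in> f ` carrier M" using l(2) lin_closed [OF g] by simp
          qed
          ultimately show False using nI by simp
        qed
        then show "g x \<in> {x \<in> carrier M. f x = \<zero>\<^bsub>M\<^esub>}" using lin_closed [OF g x] by simp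
      qed
      then show False using nz by blast
    qed
  qed
qed

end

context universal_filtration
begin

interpretation M: left_module R M by (rule M)

text \<open>On each layer \<open>Z (i + 1) / Z i\<close>, a sum of bricks, an endomorphism that is bijective on \<open>Z i\<close> induces a
  bijection on homomorphisms from every \<open>X \<in> \<X>\<close>, since these are classified by \<open>Ext\<^sup>1(X, Z i)\<close>.\<close>

lemma endo_lift:
  assumes f: "lin R M M f" and inj: "inj_on f (Z i)" and surj: "f ` Z i = Z i"
    and XX: "X \<in> \<X>" and c: "free_cover R X n p" and g: "lin R (free_module R {..<n}) M g"
    and gZ: "\<And>k. k \<in> carrier (free_cover.Ker R X n p) \<Longrightarrow> g k \<in> Z i"
  shows "\<exists>g'. lin R (free_module R {..<n}) M g' \<and> (\<forall>k\<in>carrier (free_cover.Ker R X n p). g' k \<in> Z i) \<and>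
    (\<forall>x\<in>carrier (free_module R {..<n}). g' x \<in> Z (Suc i) \<and> f (g' x) \<ominus>\<^bsub>M\<^esub> g x \<in> Z 0)"
proof -
  interpret free_cover R X n p by (rule c)
  have fi: "lin R (ZM i) M f" by (rule lin_submod_dom [OF Z f])
  have im: "\<exists>z\<in>carrier (ZM i). f z = g k" if "k \<in> carrier Ker" for k
  proof -
    have "g k \<in> f ` Z i" using gZ [OF that] surj by simp
    then show ?thesis by auto
  qed
  have inj': "inj_on f (carrier (ZM i))" using inj by simp
  obtain \<psi> where \<psi>: "lin R Ker (ZM i) \<psi>" "\<And>k. k \<in> carrier Ker \<Longrightarrow> f (\<psi> k) = g k"
    using lin_through_inj [OF Ker ZM M fi inj' lin_Ker [OF g] im] by blast
  have \<psi>Z: "\<psi> k \<in> Z i" if "k \<in> carrier Ker" for k using lin_closed [OF \<psi>(1) that] by simp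
  obtain g' where g': "lin R F M g'" "\<And>k. k \<in> carrier Ker \<Longrightarrow> g' k = \<psi> k"
    "\<And>x. x \<in> carrier F \<Longrightarrow> g' x \<in> Z (Suc i)"
    using extend [OF XX c lin_submod_incl [OF Z \<psi>(1)] \<psi>Z] by blast
  show ?thesis
  proof (intro exI [of _ g'] conjI ballI g'(1,3))
    show "g' k \<in> Z i" if "k \<in> carrier Ker" for k using g'(2) \<psi>Z that by simp
    show "f (g' x) \<ominus>\<^bsub>M\<^esub> g x \<in> Z 0" if "x \<in> carrier F" for x
      by (rule ker_map_in_Z0 [OF XX c lin_minus_fun [OF F M lin_comp [OF g'(1) f] g] _ that])
        (simp add: g'(2) \<psi>(2) lin_closed [OF g] Ker_F)
  qed
qed

lemma endo_layer_surj:
  assumes f: "lin R M M f" and inj: "inj_on f (Z i)" and surj: "f ` Z i = Z i"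
  shows "f ` Z (Suc i) = Z (Suc i)"
proof
  show "f ` Z (Suc i) \<subseteq> Z (Suc i)" using endo_Z [OF f] by blast
  have N: "submod R (f ` Z (Suc i)) M" by (rule submod_image [OF M M f Z])
  have ZN: "Z i \<subseteq> f ` Z (Suc i)" using surj Z_Suc [of i] by blast
  show "Z (Suc i) \<subseteq> f ` Z (Suc i)"
  proof (rule layer_generated [OF N ZN])
    fix X n p g x
    assume *: "X \<in> \<X>" "fg_cover R X n p" "lin R (free_module R {..<n}) M g"
      "\<And>k. k \<in> carrier (free_cover.Ker R X n p) \<Longrightarrow> g k \<in> Z i" and x: "x \<in> carrier (free_module R {..<n})"
    have c: "free_cover R X n p" using *(2) by (simp add: fg_cover_def)
    obtain g' where g': "lin R (free_module R {..<n}) M g'"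
      "\<And>x. x \<in> carrier (free_module R {..<n}) \<Longrightarrow> g' x \<in> Z (Suc i)"
      "\<And>x. x \<in> carrier (free_module R {..<n}) \<Longrightarrow> f (g' x) \<ominus>\<^bsub>M\<^esub> g x \<in> Z 0"
      using endo_lift [OF f inj surj *(1) c *(3,4)] by blast
    note gx = lin_closed [OF *(3) x] and g'x = lin_closed [OF g'(1) x]
    have 1: "f (g' x) \<in> f ` Z (Suc i)" using g'(2) [OF x] by blast
    have 2: "f (g' x) \<ominus>\<^bsub>M\<^esub> g x \<in> f ` Z (Suc i)" using g'(3) [OF x] ZN Z_mono [of 0 i] by blast
    have "f (g' x) \<ominus>\<^bsub>M\<^esub> (f (g' x) \<ominus>\<^bsub>M\<^esub> g x) = g x"
      using M.M.add_diff_cancel [of "g x" "f (g' x) \<ominus>\<^bsub>M\<^esub> g x"] M.M.a_comm [of "g x" "f (g' x) \<ominus>\<^bsub>M\<^esub> g x"]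
        gx lin_closed [OF f g'x] by simp
    then show "g x \<in> f ` Z (Suc i)" using submod_diff [OF M N 1 2] by simp
  qed
qed

lemma endo_layer_inj:
  assumes f: "lin R M M f" and inj: "inj_on f (Z i)" and surj: "f ` Z i = Z i"
  shows "inj_on f (Z (Suc i))"
proof -
  interpret Q: left_module R "Q i" by (rule Q)
  have fZ: "lin R (ZM (Suc i)) (ZM (Suc i)) f"
    by (rule lin_submod_cod [OF lin_submod_dom [OF Z f]]) (simp add: endo_Z [OF f])
  have ker: "\<pi> i (f z) = \<zero>\<^bsub>Q i\<^esub>" if "z \<in> carrier (ZM (Suc i))" "\<pi> i z = \<zero>\<^bsub>Q i\<^esub>" for z
  proof -
    have z: "z \<in> Z (Suc i)" using that by simp
    then have "z \<in> Z i" using \<pi>_ker that(2) by blast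
    then show ?thesis using \<pi>_ker [OF endo_Z [OF f z]] endo_Z [OF f] by blast
  qed
  obtain \<alpha> where \<alpha>: "lin R (Q i) (Q i) \<alpha>" "\<And>z. z \<in> carrier (ZM (Suc i)) \<Longrightarrow> \<alpha> (\<pi> i z) = \<pi> i (f z)"
    using lin_factor [OF ZM Q Q \<pi> \<pi>_surj' lin_comp [OF fZ \<pi>] ker] by blast
  have Z_of_diff: "\<pi> i x = \<pi> i y" if "x \<in> Z (Suc i)" "y \<in> Z (Suc i)" "x \<ominus>\<^bsub>M\<^esub> y \<in> Z 0" for x y
  proof -
    have d: "x \<ominus>\<^bsub>ZM (Suc i)\<^esub> y = x \<ominus>\<^bsub>M\<^esub> y"
      using lin_diff [OF ZM M ZM_M, of x "Suc i" y] that by simp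
    have "\<pi> i (x \<ominus>\<^bsub>M\<^esub> y) = \<zero>\<^bsub>Q i\<^esub>"
      using \<pi>_ker [OF submod_diff [OF M Z that(1,2)]] that(3) Z_mono [of 0 i] by blast
    then have "\<pi> i x \<ominus>\<^bsub>Q i\<^esub> \<pi> i y = \<zero>\<^bsub>Q i\<^esub>"
      using lin_diff [OF ZM Q \<pi>, of x i y] d that by (simp del: direct_sum_simps)
    then show ?thesis
      using Q.M.diff_eq_zero_iff lin_closed [OF \<pi>, of x i] lin_closed [OF \<pi>, of y i] that by simp
  qed
  have onto: "\<exists>h'. lin R X (Q i) h' \<and> (\<forall>x\<in>carrier X. \<alpha> (h' x) = h x)"
    and mono: "\<lbrakk>\<And>x. x \<in> carrier X \<Longrightarrow> \<alpha> (h x) = \<zero>\<^bsub>Q i\<^esub>; x \<in> carrier X\<rbrakk> \<Longrightarrow> h x = \<zero>\<^bsub>Q i\<^esub>"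
    if XX: "X \<in> \<X>" and h: "lin R X (Q i) h" for X h x
  proof -
    obtain n p where c: "fg_cover R X n p" using brick_fg_cover [OF X_brick [OF XX]] by blast
    then have c': "free_cover R X n p" by (simp add: fg_cover_def)
    interpret free_cover R X n p by (rule c')
    obtain g where g: "lin R F (ZM (Suc i)) g" "\<And>x. x \<in> carrier F \<Longrightarrow> \<pi> i (g x) = h (p x)"
      using F_lift [OF ZM Q \<pi> \<pi>_surj' h] by blast
    have gZ: "g x \<in> Z (Suc i)" if "x \<in> carrier F" for x using lin_closed [OF g(1) that] by simp
    have gK: "g k \<in> Z i" if k: "k \<in> carrier Ker" for k
    proof -
      have "\<pi> i (g k) = \<zero>\<^bsub>Q i\<^esub>" using g(2) [OF Ker_F [OF k]] k lin_zero [OF X Q h] by (simp only: Ker_iff)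
      then show ?thesis using \<pi>_ker [OF gZ [OF Ker_F [OF k]]] by blast
    qed
    have gM: "lin R F M g" by (rule lin_submod_incl [OF Z g(1)])
    have ex: "\<exists>y\<in>carrier F. x = p y" if "x \<in> carrier X" for x using p_surj that by auto
    show "\<exists>h'. lin R X (Q i) h' \<and> (\<forall>x\<in>carrier X. \<alpha> (h' x) = h x)"
    proof -
      obtain g' where g': "lin R F M g'" "\<And>k. k \<in> carrier Ker \<Longrightarrow> g' k \<in> Z i"
        "\<And>x. x \<in> carrier F \<Longrightarrow> g' x \<in> Z (Suc i)" "\<And>x. x \<in> carrier F \<Longrightarrow> f (g' x) \<ominus>\<^bsub>M\<^esub> g x \<in> Z 0"
        using endo_lift [OF f inj surj XX c' gM gK] by blast
      have g'Z: "lin R F (ZM (Suc i)) g'" by (rule lin_submod_cod [OF g'(1,3)])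
      have "\<pi> i (g' k) = \<zero>\<^bsub>Q i\<^esub>" if "k \<in> carrier Ker" for k
        using \<pi>_ker [OF g'(3) [OF Ker_F [OF that]]] g'(2) [OF that] by blast
      from F_factor [OF Q lin_comp [OF g'Z \<pi>] this] obtain h' where
        h': "lin R X (Q i) h'" "\<And>x. x \<in> carrier F \<Longrightarrow> h' (p x) = \<pi> i (g' x)" by blast
      have "\<alpha> (h' x) = h x" if x: "x \<in> carrier X" for x
      proof -
        obtain y where y: "y \<in> carrier F" "x = p y" using ex [OF x] by blast
        have "\<alpha> (h' x) = \<pi> i (f (g' y))" using h'(2) [OF y(1)] \<alpha>(2) [of "g' y"] g'(3) [OF y(1)] y(2) by simp
        also have "\<dots> = \<pi> i (g y)"
          by (rule Z_of_diff [OF endo_Z [OF f g'(3) [OF y(1)]] gZ [OF y(1)] g'(4) [OF y(1)]])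
        finally show ?thesis using g(2) y by simp
      qed
      with h'(1) show ?thesis by blast
    qed
    show "h x = \<zero>\<^bsub>Q i\<^esub>" if z: "\<And>x. x \<in> carrier X \<Longrightarrow> \<alpha> (h x) = \<zero>\<^bsub>Q i\<^esub>" and x: "x \<in> carrier X"
    proof -
      have fg: "f (g y) \<in> Z i" if y: "y \<in> carrier F" for y
      proof -
        have "\<pi> i (f (g y)) = \<alpha> (h (p y))" using \<alpha>(2) [of "g y"] gZ [OF y] g(2) [OF y] by simp
        then have "\<pi> i (f (g y)) = \<zero>\<^bsub>Q i\<^esub>" using z [OF lin_closed [OF p y]] by (simp only:)
        then show ?thesis using \<pi>_ker [OF endo_Z [OF f gZ [OF y]]] by blast
      qed
      have fi: "lin R (ZM i) M f" by (rule lin_submod_dom [OF Z f])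
      have inj': "inj_on f (carrier (ZM i))" using inj by simp
      have im: "\<exists>w\<in>carrier (ZM i). f w = f (g y)" if "y \<in> carrier F" for y
      proof -
        have "f (g y) \<in> f ` Z i" using fg [OF that] surj by simp
        then show ?thesis by auto
      qed
      obtain \<chi> where \<chi>: "lin R F (ZM i) \<chi>" "\<And>y. y \<in> carrier F \<Longrightarrow> f (\<chi> y) = f (g y)"
        using lin_through_inj [OF F ZM M fi inj' lin_comp [OF gM f] im] by blast
      have \<chi>M: "lin R F M \<chi>" by (rule lin_submod_incl [OF Z \<chi>(1)])
      have \<chi>Z: "\<chi> y \<in> Z i" if "y \<in> carrier F" for y using lin_closed [OF \<chi>(1) that] by simp
      have eq: "g k \<ominus>\<^bsub>M\<^esub> \<chi> k = \<zero>\<^bsub>M\<^esub>" if k: "k \<in> carrier Ker" for k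
      proof -
        have "\<chi> k = g k" by (rule inj_onD [OF inj \<chi>(2) [OF Ker_F [OF k]] \<chi>Z [OF Ker_F [OF k]] gK [OF k]])
        then show ?thesis using lin_closed [OF gM Ker_F [OF k]] by simp
      qed
      obtain y where y: "y \<in> carrier F" "x = p y" using ex [OF x] by blast
      have "g y \<ominus>\<^bsub>M\<^esub> \<chi> y \<in> Z 0"
        by (rule ker_map_in_Z0 [OF XX c' lin_minus_fun [OF F M gM \<chi>M] eq y(1)])
      then have "g y \<ominus>\<^bsub>M\<^esub> \<chi> y \<in> Z i" using Z_mono [of 0 i] by blast
      then have "g y \<in> Z i" by (rule submod_diff_right [OF M Z lin_closed [OF gM y(1)] \<chi>Z [OF y(1)]])
      then have "\<pi> i (g y) = \<zero>\<^bsub>Q i\<^esub>" using \<pi>_ker [OF gZ [OF y(1)]] by blast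
      then show ?thesis using g(2) [OF y(1)] y(2) by (simp only:)
    qed
  qed
  have s: "lin R (D i k) (Q i) (single (K i) (D i) k)" if "k \<in> K i" for k by (rule lin_single [OF R DX that])
  have "\<exists>\<sigma>. lin R (D i k) (Q i) \<sigma> \<and> (\<forall>x\<in>carrier (D i k). \<alpha> (\<sigma> x) = single (K i) (D i) k x)" if "k \<in> K i" for k
    by (rule onto [OF D [OF that] s [OF that]])
  then obtain \<sigma> where \<sigma>: "\<And>k. k \<in> K i \<Longrightarrow> lin R (D i k) (Q i) (\<sigma> k)"
    "\<And>k x. k \<in> K i \<Longrightarrow> x \<in> carrier (D i k) \<Longrightarrow> \<alpha> (\<sigma> k x) = single (K i) (D i) k x" by metis
  define \<tau> where "\<tau> = copair (K i) (D i) (Q i) \<sigma>"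
  have \<tau>: "lin R (Q i) (Q i) \<tau>" unfolding \<tau>_def by (rule lin_copair [where K = "K i" and M = "D i", OF R DX Q \<sigma>(1)])
  have \<tau>s: "\<tau> (single (K i) (D i) k x) = \<sigma> k x" if "k \<in> K i" "x \<in> carrier (D i k)" for k x
    unfolding \<tau>_def by (rule copair_single [where K = "K i" and M = "D i", OF R DX Q \<sigma>(1) that])
  have \<alpha>\<tau>: "\<alpha> (\<tau> q) = q" if "q \<in> carrier (Q i)" for q
    by (rule lin_direct_sum_eq [where K = "K i" and M = "D i", OF R DX Q lin_comp [OF \<tau> \<alpha>(1)] lin_id _ that]) (simp_all add: \<tau>s \<sigma>(2))
  have \<tau>\<alpha>: "\<tau> (\<alpha> q) = q" if "q \<in> carrier (Q i)" for q
  proof (rule lin_direct_sum_eq [where K = "K i" and M = "D i", OF R DX Q lin_comp [OF \<alpha>(1) \<tau>] lin_id _ that])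
    fix k x assume k: "k \<in> K i" and x: "x \<in> carrier (D i k)"
    let ?s = "single (K i) (D i) k"
    let ?h = "\<lambda>x. \<tau> (\<alpha> (?s x)) \<ominus>\<^bsub>Q i\<^esub> ?s x"
    note s\<alpha> = lin_comp [OF s [OF k] \<alpha>(1)]
    note s\<tau> = lin_comp [OF s\<alpha> \<tau>]
    have h: "lin R (D i k) (Q i) ?h" by (rule lin_minus_fun [OF DX [OF k] Q s\<tau> s [OF k]])
    have "\<alpha> (?h x) = \<zero>\<^bsub>Q i\<^esub>" if x: "x \<in> carrier (D i k)" for x
    proof -
      have "\<alpha> (?h x) = \<alpha> (\<tau> (\<alpha> (?s x))) \<ominus>\<^bsub>Q i\<^esub> \<alpha> (?s x)"
        by (rule lin_diff [OF Q Q \<alpha>(1) lin_closed [OF s\<tau> x] lin_closed [OF s [OF k] x]])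
      then show ?thesis
        using \<alpha>\<tau> [OF lin_closed [OF s\<alpha> x]] lin_closed [OF s\<alpha> x] Q.M.diff_eq_zero_iff by simp
    qed
    then have "?h x = \<zero>\<^bsub>Q i\<^esub>" using mono [OF D [OF k] h _ x] by blast
    then show "\<tau> (\<alpha> (?s x)) = ?s x"
      using Q.M.diff_eq_zero_iff [OF lin_closed [OF s\<tau> x] lin_closed [OF s [OF k] x]] by blast
  qed (simp_all)
  have "z = \<zero>\<^bsub>M\<^esub>" if z: "z \<in> Z (Suc i)" "f z = \<zero>\<^bsub>M\<^esub>" for z
  proof -
    have \<pi>z: "\<pi> i z \<in> carrier (Q i)" using lin_closed [OF \<pi>, of z i] z(1) by simp
    have "\<pi> i (f z) = \<zero>\<^bsub>Q i\<^esub>" using \<pi>_ker [OF endo_Z [OF f z(1)]] z(2) submod_zero [OF Z] by simp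
    then have "\<alpha> (\<pi> i z) = \<zero>\<^bsub>Q i\<^esub>" using \<alpha>(2) [of z] z(1) by (simp del: direct_sum_simps)
    then have "\<pi> i z = \<zero>\<^bsub>Q i\<^esub>" using \<tau>\<alpha> [OF \<pi>z] lin_zero [OF Q Q \<tau>] by metis
    then have "z \<in> Z i" using \<pi>_ker [OF z(1)] by blast
    then show ?thesis
      using inj_onD [OF inj, of z "\<zero>\<^bsub>M\<^esub>"] z(2) lin_zero [OF M M f] submod_zero [OF Z] by simp
  qed
  then show ?thesis
    using lin_inj_iff [OF ZM M lin_submod_dom [OF Z f], of "Suc i"] by simp
qed

lemma endo_bij:
  assumes f: "lin R M M f" and y: "y \<in> carrier Y" "f (j y) \<noteq> \<zero>\<^bsub>M\<^esub>"
  shows "inj_on f (carrier M)" "f ` carrier M = carrier M"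
proof -
  show "f ` carrier M = carrier M" by (rule endo_surj [OF f lin_closed [OF j(1) y(1)] y(2)])
  have fj: "inj_on (\<lambda>y. f (j y)) (carrier Y)" "(\<lambda>y. f (j y)) ` carrier Y = Z 0"
    by (rule hom_onto_Z0 [OF Y lin_comp [OF j(1) f] y])+
  have *: "inj_on f (Z i) \<and> f ` Z i = Z i" for i
  proof (induction i)
    case 0
    have "inj_on f (j ` carrier Y)" using fj(1) by (auto simp: inj_on_def)
    moreover have "f ` (j ` carrier Y) = Z 0" using fj(2) by (simp add: image_image)
    ultimately show ?case by (simp add: j(3))
  next
    case (Suc i)
    then show ?case using endo_layer_inj [OF f] endo_layer_surj [OF f] by blast
  qed
  have "x = \<zero>\<^bsub>M\<^esub>" if x: "x \<in> carrier M" "f x = \<zero>\<^bsub>M\<^esub>" for x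
  proof -
    obtain i where "x \<in> Z i" using Z_cover [OF x(1)] by blast
    then show ?thesis
      using inj_onD [OF conjunct1 [OF *], of x "\<zero>\<^bsub>M\<^esub>" i] x(2) lin_zero [OF M M f] submod_zero [OF Z] by simp
  qed
  then show "inj_on f (carrier M)" using lin_inj_iff [OF M M f] by blast
qed

abbreviation E :: "('l \<Rightarrow> 'l) ring" where "E \<equiv> End_ring R M"

definition J :: "('l \<Rightarrow> 'l) set" where
  "J = {f \<in> carrier E. \<forall>y\<in>carrier Y. f (j y) = \<zero>\<^bsub>M\<^esub>}"

lemma J_left_ideal: "left_ideal J E"
proof -
  interpret E: ring E by (rule End_ring_ring [OF M])
  have jc: "j y \<in> carrier M" if "y \<in> carrier Y" for y by (rule lin_closed [OF j(1) that])
  have "subgroup J (add_monoid E)"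
  proof (rule E.add.subgroupI)
    show "J \<subseteq> carrier E" by (auto simp: J_def)
    have "\<zero>\<^bsub>E\<^esub> \<in> J" using E.zero_closed by (simp add: J_def jc)
    then show "J \<noteq> {}" by blast
    show "\<ominus>\<^bsub>E\<^esub> f \<in> J" if f: "f \<in> J" for f
    proof -
      have fE: "f \<in> carrier E" using f by (simp add: J_def)
      have "(\<ominus>\<^bsub>E\<^esub> f) (j y) = \<zero>\<^bsub>M\<^esub>" if y: "y \<in> carrier Y" for y
      proof -
        have "(\<ominus>\<^bsub>E\<^esub> f \<oplus>\<^bsub>E\<^esub> f) (j y) = \<zero>\<^bsub>M\<^esub>" unfolding E.l_neg [OF fE] using jc [OF y] by simp
        moreover have "(\<ominus>\<^bsub>E\<^esub> f) (j y) \<in> carrier M"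
          using lhom_closed [of "\<ominus>\<^bsub>E\<^esub> f" R M M] E.a_inv_closed [OF fE] jc [OF y] by simp
        ultimately show ?thesis using f y jc [OF y] by (simp add: J_def)
      qed
      then show ?thesis using E.a_inv_closed [OF fE] by (simp add: J_def)
    qed
    show "f \<oplus>\<^bsub>E\<^esub> g \<in> J" if "f \<in> J" "g \<in> J" for f g
      using that E.a_closed [of f g] by (auto simp: J_def jc)
  qed
  moreover have "f \<otimes>\<^bsub>E\<^esub> g \<in> J" if "f \<in> carrier E" "g \<in> J" for f g
  proof -
    have fl: "lin R M M f" and g: "g \<in> carrier E" "\<And>y. y \<in> carrier Y \<Longrightarrow> g (j y) = \<zero>\<^bsub>M\<^esub>"
      using that by (auto simp: J_def lhom_lin)
    have "g (f (j y)) = \<zero>\<^bsub>M\<^esub>" if y: "y \<in> carrier Y" for y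
    proof -
      have "f (j y) \<in> j ` carrier Y" unfolding j(3) by (rule hom [OF Y lin_comp [OF j(1) fl] y])
      then show ?thesis using g(2) by auto
    qed
    then show ?thesis using E.m_closed [OF that(1) g(1)] by (simp add: J_def compose_eq jc)
  qed
  ultimately show ?thesis by (simp add: left_ideal_def additive_subgroup_def)
qed

lemma one_notin_J: "\<one>\<^bsub>E\<^esub> \<notin> J"
proof
  assume "\<one>\<^bsub>E\<^esub> \<in> J"
  then have "\<forall>y\<in>carrier Y. \<one>\<^bsub>E\<^esub> (j y) = \<zero>\<^bsub>M\<^esub>" unfolding J_def by blast
  then have z: "j y = \<zero>\<^bsub>M\<^esub>" if "y \<in> carrier Y" for y
    using lin_closed [OF j(1) that] that by auto
  obtain y where y: "y \<in> carrier Y" "y \<noteq> \<zero>\<^bsub>Y\<^esub>" using brick_nonzero [OF X_brick [OF Y]] .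
  have YM: "left_module R Y" by (rule X_left_module [OF Y])
  show False using lin_inj_iff [OF YM M j(1)] j(2) z y by blast
qed

lemma proper_left_ideal_le_J:
  assumes L: "left_ideal L E" and ne: "L \<noteq> carrier E"
  shows "L \<subseteq> J"
proof
  interpret E: ring E by (rule End_ring_ring [OF M])
  have LE: "L \<subseteq> carrier E" using L unfolding left_ideal_def by (blast dest: additive_subgroup.a_subset)
  fix f assume f: "f \<in> L"
  show "f \<in> J"
  proof (rule ccontr)
    assume fJ: "f \<notin> J"
    have fE: "f \<in> carrier E" using f LE by blast
    then have fl: "lin R M M f" by (simp add: lhom_lin)
    obtain y where y: "y \<in> carrier Y" "f (j y) \<noteq> \<zero>\<^bsub>M\<^esub>" using fJ fE unfolding J_def by blast
    obtain g where g: "lin R M M g" "\<And>x. x \<in> carrier M \<Longrightarrow> g (f x) = x" "\<And>x. x \<in> carrier M \<Longrightarrow> f (g x) = x"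
      using lin_inverse [OF M M fl endo_bij [OF fl y]] by blast
    let ?g = "restrict g (carrier M)"
    have gE: "?g \<in> carrier E" using lin_restrict [OF M g(1)] by simp
    have "?g \<otimes>\<^bsub>E\<^esub> f = \<one>\<^bsub>E\<^esub>" by (auto simp: compose_def fun_eq_iff g(3))
    then have one: "\<one>\<^bsub>E\<^esub> \<in> L" using L f gE unfolding left_ideal_def by metis
    have "r \<in> L" if "r \<in> carrier E" for r
    proof -
      have "r \<otimes>\<^bsub>E\<^esub> \<one>\<^bsub>E\<^esub> \<in> L" using L one that unfolding left_ideal_def by blast
      then show ?thesis using E.r_one [OF that] by metis
    qed
    then show False using ne LE by blast
  qed
qed

lemma J_carrier: "J \<noteq> carrier E"
proof -
  interpret E: ring E by (rule End_ring_ring [OF M])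
  show ?thesis using one_notin_J E.one_closed by blast
qed

lemma maximal_left_ideal_iff: "maximal_left_ideal I E \<longleftrightarrow> I = J"
proof
  assume I: "maximal_left_ideal I E"
  then have "I \<subseteq> J" unfolding maximal_left_ideal_def by (intro proper_left_ideal_le_J) auto
  then show "I = J" using I J_left_ideal J_carrier unfolding maximal_left_ideal_def by blast
next
  assume "I = J"
  then show "maximal_left_ideal I E"
    unfolding maximal_left_ideal_def using J_left_ideal J_carrier proper_left_ideal_le_J by blast
qed

lemma End_local: "local_ring E"
  unfolding local_ring_def maximal_left_ideal_iff using End_ring_ring [OF M] by blast

lemma End_jacobson_radical: "jacobson_radical E = J"
  unfolding jacobson_radical_def maximal_left_ideal_iff by (auto simp: J_def)

lemma End_surj:
  assumes f: "f \<in> carrier E" "f \<noteq> \<zero>\<^bsub>E\<^esub>"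
  shows "f ` carrier M = carrier M"
proof -
  have fl: "f \<in> lhom R M M" using f by simp
  have "\<exists>x\<in>carrier M. f x \<noteq> \<zero>\<^bsub>M\<^esub>"
  proof (rule ccontr)
    assume "\<not> ?thesis"
    then have "f = \<zero>\<^bsub>E\<^esub>"
      using fl by (intro extensionalityI [where A = "carrier M"]) (auto simp: lhom_iff)
    then show False using f by blast
  qed
  then show ?thesis using endo_surj [OF lhom_lin [OF fl]] by blast
qed

end

section \<open>Direct limits\<close>

lemma UN_pair_const:
  assumes "A \<noteq> {}" "\<And>m x. (m, x) \<in> A \<Longrightarrow> f m x = c"
  shows "(\<Union>(m, x)\<in>A. f m x) = c"
  using assms by (intro SUP_eq_const) auto

locale module_sequence =
  fixes R :: "('r, 'a) ring_scheme" and T :: "nat \<Rightarrow> ('r, 'e) module" and u :: "nat \<Rightarrow> 'e \<Rightarrow> 'e"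
  assumes T: "\<And>n. left_module R (T n)" and u: "\<And>n. lin R (T n) (T (Suc n)) (u n)"
    and u_inj: "\<And>n. inj_on (u n) (carrier (T n))"
begin

lemma transition_add: "transition u m (d + e) x = transition u (m + d) e (transition u m d x)"
  by (induction e) (simp_all add: add.assoc)

lemma lin_transition_add: "lin R (T m) (T (m + d)) (transition u m d)"
proof (induction d)
  case 0
  then show ?case using lin_id [of R "T m"] by (simp add: lin_def)
next
  case (Suc d)
  from lin_comp [OF Suc u] show ?case by simp
qed

lemma inj_transition: "inj_on (transition u m d) (carrier (T m))"
proof (induction d)
  case (Suc d)
  show ?case
  proof (rule inj_onI)
    fix x y assume xy: "x \<in> carrier (T m)" "y \<in> carrier (T m)" "transition u m (Suc d) x = transition u m (Suc d) y"
    then have "transition u m d x = transition u m d y"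
      using inj_onD [OF u_inj] lin_closed [OF lin_transition_add] by simp
    then show "x = y" using inj_onD [OF Suc] xy by blast
  qed
qed simp

lemma lin_transition: "m \<le> k \<Longrightarrow> lin R (T m) (T k) (transition u m (k - m))"
  using lin_transition_add [of m "k - m"] by simp

lemma transition_trans:
  assumes "m \<le> k" "k \<le> l"
  shows "transition u m (l - m) x = transition u k (l - k) (transition u m (k - m) x)"
  using transition_add [of m "k - m" "l - k" x] assms by simp

abbreviation L :: "nat \<Rightarrow> 'e \<Rightarrow> (nat \<times> 'e) set" where
  "L n x \<equiv> limit_rel T u `` {(n, x)}"

lemma limit_rel_iff:
  "((m, x), (n, y)) \<in> limit_rel T u \<longleftrightarrow> x \<in> carrier (T m) \<and> y \<in> carrier (T n) \<and>
     (\<exists>k. m \<le> k \<and> n \<le> k \<and> transition u m (k - m) x = transition u n (k - n) y)"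
  by (auto simp: limit_rel_def)

lemma limit_rel_upward:
  assumes "transition u m (k - m) x = transition u n (k - n) y" "m \<le> k" "n \<le> k" "k \<le> l"
  shows "transition u m (l - m) x = transition u n (l - n) y"
  using transition_trans [of m k l x] transition_trans [of n k l y] assms by simp

lemma limit_rel_equiv: "equiv (SIGMA n:UNIV. carrier (T n)) (limit_rel T u)"
proof (rule equivI)
  show "limit_rel T u \<subseteq> (SIGMA n:UNIV. carrier (T n)) \<times> (SIGMA n:UNIV. carrier (T n))"
    by (auto simp: limit_rel_def)
  show "refl_on (SIGMA n:UNIV. carrier (T n)) (limit_rel T u)"
    by (auto simp: refl_on_def limit_rel_iff)
  show "sym (limit_rel T u)"
  proof (rule symI)
    fix a b assume "(a, b) \<in> limit_rel T u"
    then show "(b, a) \<in> limit_rel T u"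
      by (cases a, cases b) (auto simp: limit_rel_iff intro: sym)
  qed
  show "trans (limit_rel T u)"
  proof (rule transI)
    fix a b c assume ab: "(a, b) \<in> limit_rel T u" and bc: "(b, c) \<in> limit_rel T u"
    obtain m x n y l z where abc: "a = (m, x)" "b = (n, y)" "c = (l, z)" by (cases a, cases b, cases c) auto
    from ab obtain k where k: "m \<le> k" "n \<le> k" "transition u m (k - m) x = transition u n (k - n) y"
      by (auto simp: abc limit_rel_iff)
    from bc obtain k' where k': "n \<le> k'" "l \<le> k'" "transition u n (k' - n) y = transition u l (k' - l) z"
      by (auto simp: abc limit_rel_iff)
    have "transition u m (max k k' - m) x = transition u l (max k k' - l) z"
      using limit_rel_upward [OF k(3,1,2), of "max k k'"] limit_rel_upward [OF k'(3,1,2), of "max k k'"] by simp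
    then show "(a, c) \<in> limit_rel T u"
      using ab bc k(1) k'(2) by (auto simp: abc limit_rel_iff intro!: exI [of _ "max k k'"])
  qed
qed

lemma L_eq_iff:
  assumes "x \<in> carrier (T m)" "y \<in> carrier (T n)"
  shows "L m x = L n y \<longleftrightarrow> (\<exists>k. m \<le> k \<and> n \<le> k \<and> transition u m (k - m) x = transition u n (k - n) y)"
  using eq_equiv_class_iff [OF limit_rel_equiv, of "(m, x)" "(n, y)"] assms by (simp add: limit_rel_iff)

lemma L_transition:
  assumes "x \<in> carrier (T m)" "m \<le> k"
  shows "L k (transition u m (k - m) x) = L m x"
  using assms lin_closed [OF lin_transition [OF assms(2)] assms(1)]
  by (subst L_eq_iff) (auto intro!: exI [of _ k])

lemma L_u: "x \<in> carrier (T n) \<Longrightarrow> L (Suc n) (u n x) = L n x"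
  using L_transition [of x n "Suc n"] by simp

lemma L_inj: "inj_on (L n) (carrier (T n))"
proof (rule inj_onI)
  fix x y assume xy: "x \<in> carrier (T n)" "y \<in> carrier (T n)" "L n x = L n y"
  then obtain k where "transition u n (k - n) x = transition u n (k - n) y"
    using L_eq_iff [OF xy(1,2)] by blast
  then show "x = y" using inj_onD [OF inj_transition] xy(1,2) by metis
qed

lemma direct_limit_carrier: "A \<in> carrier (direct_limit T u) \<longleftrightarrow> (\<exists>n. \<exists>x\<in>carrier (T n). A = L n x)"
  by (auto simp: direct_limit_def quotient_def)

lemma L_rep:
  assumes "x \<in> carrier (T n)" "(m, y) \<in> L n x"
  shows "y \<in> carrier (T m)" "L m y = L n x"
  using assms equiv_class_eq [OF limit_rel_equiv, of "(n, x)" "(m, y)"] by (auto simp: limit_rel_iff)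

lemma L_self: "x \<in> carrier (T n) \<Longrightarrow> (n, x) \<in> L n x"
  by (auto simp: limit_rel_iff)

lemma direct_limit_add:
  assumes x: "x \<in> carrier (T n)" and y: "y \<in> carrier (T n)"
  shows "L n x \<oplus>\<^bsub>direct_limit T u\<^esub> L n y = L n (x \<oplus>\<^bsub>T n\<^esub> y)"
proof -
  have "L (max m l) (transition u m (max m l - m) x' \<oplus>\<^bsub>T (max m l)\<^esub> transition u l (max m l - l) y') =
      L n (x \<oplus>\<^bsub>T n\<^esub> y)" if a: "(m, x') \<in> L n x" "(l, y') \<in> L n y" for m x' l y'
  proof -
    interpret Tn: left_module R "T n" by (rule T)
    let ?k = "max m l"
    interpret Tk: left_module R "T ?k" by (rule T)
    note c = L_rep(1) [OF x a(1)] L_rep(1) [OF y a(2)]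
    obtain k1 where k1: "m \<le> k1" "n \<le> k1" "transition u m (k1 - m) x' = transition u n (k1 - n) x"
      using L_rep(2) [OF x a(1)] L_eq_iff [OF c(1) x] by blast
    obtain k2 where k2: "l \<le> k2" "n \<le> k2" "transition u l (k2 - l) y' = transition u n (k2 - n) y"
      using L_rep(2) [OF y a(2)] L_eq_iff [OF c(2) y] by blast
    define k where "k = max k1 k2"
    have k: "?k \<le> k" "n \<le> k" "m \<le> ?k" "l \<le> ?k" using k1 k2 by (auto simp: k_def)
    have e1: "transition u m (k - m) x' = transition u n (k - n) x"
      by (rule limit_rel_upward [OF k1(3,1,2)]) (simp add: k_def)
    have e2: "transition u l (k - l) y' = transition u n (k - n) y"
      by (rule limit_rel_upward [OF k2(3,1,2)]) (simp add: k_def)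
    note c1 = lin_closed [OF lin_transition [OF k(3)] c(1)] and c2 = lin_closed [OF lin_transition [OF k(4)] c(2)]
    have "transition u ?k (k - ?k) (transition u m (?k - m) x' \<oplus>\<^bsub>T ?k\<^esub> transition u l (?k - l) y') =
        transition u n (k - n) (x \<oplus>\<^bsub>T n\<^esub> y)"
      using transition_trans [OF k(3,1), of x'] transition_trans [OF k(4,1), of y'] e1 e2
      by (simp add: lin_add [OF lin_transition [OF k(1)] c1 c2] lin_add [OF lin_transition [OF k(2)] x y])
    then show ?thesis
      using k c1 c2 x y by (subst L_eq_iff) auto
  qed
  moreover have ne: "L n x \<noteq> {}" "L n y \<noteq> {}" using L_self [OF x] L_self [OF y] by blast+
  ultimately have "(\<Union>(m, x')\<in>L n x. \<Union>(l, y')\<in>L n y. let k = max m l in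
      L k (transition u m (k - m) x' \<oplus>\<^bsub>T k\<^esub> transition u l (k - l) y')) = L n (x \<oplus>\<^bsub>T n\<^esub> y)"
    unfolding Let_def by (intro UN_pair_const)
  then show ?thesis by (simp add: direct_limit_def)
qed

lemma direct_limit_smult:
  assumes r: "r \<in> carrier R" and x: "x \<in> carrier (T n)"
  shows "r \<odot>\<^bsub>direct_limit T u\<^esub> L n x = L n (r \<odot>\<^bsub>T n\<^esub> x)"
proof -
  have "L m (r \<odot>\<^bsub>T m\<^esub> x') = L n (r \<odot>\<^bsub>T n\<^esub> x)" if a: "(m, x') \<in> L n x" for m x'
  proof -
    interpret Tn: left_module R "T n" by (rule T)
    interpret Tm: left_module R "T m" by (rule T)
    note c = L_rep(1) [OF x a]
    obtain k where k: "m \<le> k" "n \<le> k" "transition u m (k - m) x' = transition u n (k - n) x"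
      using L_rep(2) [OF x a] L_eq_iff [OF c x] by blast
    then have "transition u m (k - m) (r \<odot>\<^bsub>T m\<^esub> x') = transition u n (k - n) (r \<odot>\<^bsub>T n\<^esub> x)"
      by (simp add: lin_smult [OF lin_transition [OF k(1)] r c] lin_smult [OF lin_transition [OF k(2)] r x])
    then show ?thesis using k c x r by (subst L_eq_iff) auto
  qed
  moreover have "L n x \<noteq> {}" using L_self [OF x] by blast
  ultimately have "(\<Union>(m, x')\<in>L n x. L m (r \<odot>\<^bsub>T m\<^esub> x')) = L n (r \<odot>\<^bsub>T n\<^esub> x)"
    by (intro UN_pair_const)
  then show ?thesis by (simp add: direct_limit_def)
qed

lemma lin_L: "lin R (T n) (direct_limit T u) (L n)"
  by (rule linI) (auto simp: direct_limit_carrier direct_limit_add direct_limit_smult)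

lemma L_mono_range:
  assumes "m \<le> k"
  shows "L m ` carrier (T m) \<subseteq> L k ` carrier (T k)"
proof (rule image_subsetI)
  fix x assume x: "x \<in> carrier (T m)"
  show "L m x \<in> L k ` carrier (T k)"
    using imageI [OF lin_closed [OF lin_transition [OF assms] x], of "L k"] by (simp only: L_transition [OF x assms])
qed

lemma direct_limit_left_module: "left_module R (direct_limit T u)"
proof (rule left_module_locally_image [OF T lin_L])
  fix i
  interpret Ti: left_module R "T i" by (rule T)
  interpret T0: left_module R "T 0" by (rule T)
  have "transition u 0 (i - 0) \<zero>\<^bsub>T 0\<^esub> = \<zero>\<^bsub>T i\<^esub>"
    by (rule lin_zero [OF T T lin_transition]) simp
  then show "L i \<zero>\<^bsub>T i\<^esub> = \<zero>\<^bsub>direct_limit T u\<^esub>"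
    using L_transition [of "\<zero>\<^bsub>T 0\<^esub>" 0 i] by (simp add: direct_limit_def)
next
  fix A B C assume "A \<in> carrier (direct_limit T u)" "B \<in> carrier (direct_limit T u)" "C \<in> carrier (direct_limit T u)"
  then obtain a b c where "A \<in> L a ` carrier (T a)" "B \<in> L b ` carrier (T b)" "C \<in> L c ` carrier (T c)"
    unfolding direct_limit_carrier by blast
  then have "{A, B, C} \<subseteq> L (max a (max b c)) ` carrier (T (max a (max b c)))"
    using L_mono_range [of a "max a (max b c)"] L_mono_range [of b "max a (max b c)"]
      L_mono_range [of c "max a (max b c)"] by (simp add: subset_iff)
  then show "\<exists>i. {A, B, C} \<subseteq> L i ` carrier (T i)" by blast
qed

end

section \<open>The Pruefer module\<close>

lemma universal_tower_filtration:
  fixes R :: "('r, 'a) ring_scheme" and \<X> :: "('r, 'm) module set" and T :: "nat \<Rightarrow> ('r, 'e) module"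
  assumes semi: "semibrick R \<X>" and pd: "\<And>X. X \<in> \<X> \<Longrightarrow> proj_dim_le_one R X"
    and YX: "Y \<in> \<X>" and tower: "universal_tower R \<X> Y j T u"
  shows "\<exists>Z (K :: nat \<Rightarrow> (('r, 'm) module \<times> ('r, 'e \<times> 'm, 'e, 'm) extn) set) D \<pi>.
    universal_filtration R \<X> Y (direct_limit T u) Z (compose (carrier Y) (limit_map T u 0) j) K D \<pi>"
proof -
  have "\<forall>n. \<exists>S. universal_seq R \<X> (T n) S \<and> mid S = T (Suc n) \<and> incl S = u n"
    using tower by (simp add: universal_tower_def)
  then obtain S where S: "\<And>n. universal_seq R \<X> (T n) (S n)" "\<And>n. mid (S n) = T (Suc n)" "\<And>n. incl (S n) = u n"
    by metis
  have "\<exists>B. is_extn R (direct_sum (Sigma \<X> B) fst) (T n) (S n)" for n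
    using S(1) [of n] by (auto simp: universal_seq_def)
  then obtain B where B: "\<And>n. is_extn R (direct_sum (Sigma \<X> (B n)) fst) (T n) (S n)" by metis
  note E = is_extnD [OF B, unfolded S(2,3)]
  interpret module_sequence R T u by (rule module_sequence.intro) (rule E)+
  let ?M = "direct_limit T u"
  note M = direct_limit_left_module
  define Z where "Z n = L n ` carrier (T n)" for n
  have Z: "submod R (Z n) ?M" for n
    unfolding Z_def by (rule submod_image [OF T M lin_L submod_carrier [OF T]])
  have LZ: "L n x \<in> Z n" if "x \<in> carrier (T n)" for n x using that by (simp add: Z_def)
  have Z_Suc: "Z n \<subseteq> Z (Suc n)" for n
    unfolding Z_def by (rule L_mono_range) simp
  have Z_mono: "Z i \<subseteq> Z k" if "i \<le> k" for i k by (rule lift_Suc_mono_le [of Z, OF Z_Suc that])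
  have Z_cover: "\<exists>i. x \<in> Z i" if "x \<in> carrier ?M" for x
    using that unfolding direct_limit_carrier Z_def by blast
  have LT: "\<exists>y\<in>carrier (T i). L i y = z" if "z \<in> Z i" for i z using that by (auto simp: Z_def)
  have ZM: "left_module R (?M\<lparr>carrier := Z i\<rparr>)" for i by (rule submod_left_module [OF M Z])
  have "\<exists>\<nu>. lin R (?M\<lparr>carrier := Z (Suc i)\<rparr>) (T (Suc i)) \<nu> \<and> (\<forall>x\<in>carrier (T (Suc i)). \<nu> (L (Suc i) x) = x)" for i
  proof -
    have "lin R (T (Suc i)) (?M\<lparr>carrier := Z (Suc i)\<rparr>) (L (Suc i))"
      by (rule lin_submod_cod [OF lin_L LZ])
    moreover have "L (Suc i) ` carrier (T (Suc i)) = carrier (?M\<lparr>carrier := Z (Suc i)\<rparr>)" by (simp add: Z_def)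
    ultimately show ?thesis using lin_inverse [OF T ZM _ L_inj] by metis
  qed
  then obtain \<nu> where \<nu>: "\<And>i. lin R (?M\<lparr>carrier := Z (Suc i)\<rparr>) (T (Suc i)) (\<nu> i)"
    "\<And>i x. x \<in> carrier (T (Suc i)) \<Longrightarrow> \<nu> i (L (Suc i) x) = x" by metis
  define \<pi> where "\<pi> i z = proj (S i) (\<nu> i z)" for i z
  have \<pi>L: "\<pi> i (L (Suc i) x) = proj (S i) x" if "x \<in> carrier (T (Suc i))" for i x
    by (simp add: \<pi>_def \<nu>(2) [OF that])
  let ?\<iota> = "compose (carrier Y) (limit_map T u 0) j"
  have jT: "j \<in> liso R Y (T 0)" using tower by (simp add: universal_tower_def)
  note jl = liso_lin [OF jT]
  have YM: "left_module R Y" using semi YX brick_left_module by (auto simp: semibrick_def)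
  have \<iota>: "?\<iota> y = L 0 (j y)" if "y \<in> carrier Y" for y
    using lin_closed [OF jl that] that by (simp add: compose_eq limit_map_def)
  have "universal_filtration R \<X> Y ?M Z ?\<iota> (\<lambda>i. Sigma \<X> (B i)) (\<lambda>_. fst) \<pi>"
  proof (rule universal_filtration.intro [OF semi pd YX M Z Z_Suc Z_cover])
    show "lin R Y ?M ?\<iota>" by (rule lin_congI [OF lin_comp [OF jl lin_L] YM \<iota>])
    show "inj_on ?\<iota> (carrier Y)"
    proof (rule inj_onI)
      fix x y assume xy: "x \<in> carrier Y" "y \<in> carrier Y" "?\<iota> x = ?\<iota> y"
      then have "j x = j y" using inj_onD [OF L_inj] lin_closed [OF jl] by (simp add: \<iota>)
      then show "x = y" using inj_onD [OF liso_inj [OF jT]] xy by blast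
    qed
    have "?\<iota> ` carrier Y = L 0 ` j ` carrier Y" unfolding image_image by (rule image_cong [OF refl \<iota>])
    then show "?\<iota> ` carrier Y = Z 0" by (simp only: Z_def liso_surj [OF jT])
  next
    fix X n p \<psi> i
    assume XX: "X \<in> \<X>" and c: "free_cover R X n p" and \<psi>: "lin R (free_cover.Ker R X n p) ?M \<psi>"
      and \<psi>Z: "\<And>k. k \<in> carrier (free_cover.Ker R X n p) \<Longrightarrow> \<psi> k \<in> Z i"
    interpret free_cover R X n p by (rule c)
    obtain \<psi>' where \<psi>': "lin R Ker (T i) \<psi>'" "\<And>k. k \<in> carrier Ker \<Longrightarrow> L i (\<psi>' k) = \<psi> k"
      using lin_through_inj [OF Ker T M lin_L L_inj \<psi> LT [OF \<psi>Z]] by blast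
    obtain g where g: "lin R F (T (Suc i)) g" "\<And>k. k \<in> carrier Ker \<Longrightarrow> g k = u i (\<psi>' k)"
      using universal_seq_extend [OF S(1) XX \<psi>'(1), unfolded S(2,3)] by blast
    show "\<exists>g. lin R F ?M g \<and> (\<forall>k\<in>carrier Ker. g k = \<psi> k) \<and> (\<forall>x\<in>carrier F. g x \<in> Z (Suc i))"
    proof (intro exI [of _ "\<lambda>x. L (Suc i) (g x)"] conjI ballI)
      show "lin R F ?M (\<lambda>x. L (Suc i) (g x))" by (rule lin_comp [OF g(1) lin_L])
      show "L (Suc i) (g k) = \<psi> k" if "k \<in> carrier Ker" for k
        using L_u [OF lin_closed [OF \<psi>'(1) that]] \<psi>'(2) [OF that] by (simp add: g(2) [OF that])
      show "L (Suc i) (g x) \<in> Z (Suc i)" if "x \<in> carrier F" for x by (rule LZ [OF lin_closed [OF g(1) that]])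
    qed
  next
    fix X l x assume XX: "X \<in> \<X>" and l: "lin R X ?M l" and x: "x \<in> carrier X"
    have "brick R X" using semi XX by (simp add: semibrick_def)
    then obtain n p where "fg_cover R X n p" using brick_fg_cover by blast
    then interpret free_cover R X n p by (simp add: fg_cover_def)
    obtain i where i: "\<forall>x\<in>carrier F. l (p x) \<in> Z i"
      using free_module_chain [where N = Z, OF M Z Z_mono lin_comp [OF p l]
          Z_cover [OF lin_closed [OF lin_comp [OF p l]]]] by blast
    have "l x \<in> Z i" if "x \<in> carrier X" for x using i p_surj that by (metis imageE)
    then have "\<forall>x\<in>carrier X. l x \<in> Z 0"
    proof (induction i)
      case (Suc i)
      obtain l' where l': "lin R X (T (Suc i)) l'" "\<And>x. x \<in> carrier X \<Longrightarrow> L (Suc i) (l' x) = l x"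
        using lin_through_inj [OF X T M lin_L L_inj l LT [OF Suc.prems]] by blast
      have "l x \<in> Z i" if x: "x \<in> carrier X" for x
      proof -
        obtain y where "y \<in> carrier (T i)" "u i y = l' x"
          using universal_seq_hom [OF S(1) semi XX, unfolded S(2,3), OF l'(1) x] by blast
        then show ?thesis using l'(2) [OF x] L_u LZ by metis
      qed
      then show ?case by (rule Suc.IH)
    qed simp
    then show "l x \<in> Z 0" using x by blast
  next
    show "fst k \<in> \<X>" if "k \<in> Sigma \<X> (B i)" for i k using that by auto
    show "lin R (?M\<lparr>carrier := Z (Suc i)\<rparr>) (direct_sum (Sigma \<X> (B i)) fst) (\<pi> i)" for i
      unfolding \<pi>_def [abs_def] by (rule lin_comp [OF \<nu>(1) E(5)])
    show "\<pi> i ` Z (Suc i) = carrier (direct_sum (Sigma \<X> (B i)) fst)" for i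
    proof -
      have "\<pi> i ` Z (Suc i) = proj (S i) ` carrier (T (Suc i))"
        unfolding Z_def image_image by (rule image_cong [OF refl \<pi>L])
      then show ?thesis by (simp only: E(7))
    qed
    fix i z assume "z \<in> Z (Suc i)"
    then obtain t where t: "t \<in> carrier (T (Suc i))" "z = L (Suc i) t" using LT by metis
    show "\<pi> i z = \<zero>\<^bsub>direct_sum (Sigma \<X> (B i)) fst\<^esub> \<longleftrightarrow> z \<in> Z i"
    proof
      assume "\<pi> i z = \<zero>\<^bsub>direct_sum (Sigma \<X> (B i)) fst\<^esub>"
      then have "proj (S i) t = \<zero>\<^bsub>direct_sum (Sigma \<X> (B i)) fst\<^esub>" using \<pi>L [OF t(1)] t(2) by simp
      then obtain y where "y \<in> carrier (T i)" "u i y = t" using E(10) [OF t(1)] by blast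
      then show "z \<in> Z i" using t(2) L_u LZ by metis
    next
      assume "z \<in> Z i"
      then obtain y where y: "y \<in> carrier (T i)" "L i y = z" using LT by metis
      have uy: "u i y \<in> carrier (T (Suc i))" by (rule lin_closed [OF u y(1)])
      have "L (Suc i) (u i y) = L (Suc i) t" using L_u [OF y(1)] y(2) t(2) by metis
      then have "u i y = t" using inj_onD [OF L_inj] uy t(1) by blast
      then show "\<pi> i z = \<zero>\<^bsub>direct_sum (Sigma \<X> (B i)) fst\<^esub>"
        using \<pi>L [OF t(1)] t(2) E(9) [OF y(1)] by simp
    qed
  qed
  then show ?thesis by blast
qed

theorem proposition6p3:
  fixes R :: "('r, 'a) ring_scheme"
    and \<X> :: "('r, 'm) module set"
    and Y :: "('r, 'm) module"
    and T :: "nat \<Rightarrow> ('r, 'e) module"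
    and u :: "nat \<Rightarrow> 'e \<Rightarrow> 'e"
    and j :: "'m \<Rightarrow> 'e"
    and Ybar :: "('r, (nat \<times> 'e) set) module"
    and \<iota> :: "'m \<Rightarrow> (nat \<times> 'e) set"
    and E :: "((nat \<times> 'e) set \<Rightarrow> (nat \<times> 'e) set) ring"
  assumes "ring R"
    and "semibrick R \<X>"
    and "\<And>X. X \<in> \<X> \<Longrightarrow> proj_dim_le_one R X"
    and "\<And>X. X \<in> \<X> \<Longrightarrow> \<not> divisible R \<X> X"
    and "Y \<in> \<X>"
    and "universal_tower R \<X> Y j T u"
    and "Ybar = direct_limit T u"
    and "\<iota> = compose (carrier Y) (limit_map T u 0) j"
    and "E = End_ring R Ybar"
  shows "local_ring E
    \<and> jacobson_radical E = {f \<in> carrier E. \<forall>y\<in>carrier Y. f (\<iota> y) = \<zero>\<^bsub>Ybar\<^esub>}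
    \<and> (\<forall>f\<in>carrier E. f \<noteq> \<zero>\<^bsub>E\<^esub> \<longrightarrow> f ` carrier Ybar = carrier Ybar)"
proof -
  obtain Z and K :: "nat \<Rightarrow> (('r, 'm) module \<times> ('r, 'e \<times> 'm, 'e, 'm) extn) set" and D \<pi>
    where "universal_filtration R \<X> Y Ybar Z \<iota> K D \<pi>"
    using universal_tower_filtration [OF assms(2,3,5,6)] assms(7,8) by blast
  then interpret universal_filtration R \<X> Y Ybar Z \<iota> K D \<pi> .
  show ?thesis
    unfolding assms(9) using End_local End_jacobson_radical End_surj by (simp add: J_def)
qed

end
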